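(* Let $G$ be a compact group. Then $G$ contains a subgroup which is a surface group if and only if $G$ contains a subgroup which is a free group.
   Context: Topological groups are assumed to be Hausdorff. A free group means a nonabelian free group, i.e. a free group on at least two generators. A surface group is a group isomorphic to the fundamental group of a closed oriented surface of genus at least $2$. Subgroups are abstract subgroups (not necessarily closed). *)

theory Defs
  imports "HOL-Analysis.Analysis" "HOL-Algebra.Coset"
begin

section \<open>Compact groups\<close>

locale topological_group = group G for G (structure) +
  fixes T :: "'a topology"
  assumes topspace_eq: "topspace T = carrier G"
    and continuous_mult: "continuous_map (prod_topology T T) T (\<lambda>(x, y). x \<otimes> y)"
    and continuous_inv: "continuous_map T T (\<lambda>x. inv x)"
    and hausdorff: "Hausdorff_space T"

locale compact_group = topological_group +
  assumes compact: "compact_space T"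

section \<open>Free groups\<close>

text \<open>
  A word over \<open>S\<close> is a list of letters; the letter \<open>(s, True)\<close> stands for \<open>s\<close> and
  \<open>(s, False)\<close> for the inverse of \<open>s\<close>.
\<close>

definition reduced_words :: "'a set \<Rightarrow> ('a \<times> bool) list set" where
  "reduced_words S =
     {w. set w \<subseteq> S \<times> UNIV \<and>
         (\<forall>i. Suc i < length w \<longrightarrow> w ! Suc i \<noteq> (fst (w ! i), \<not> snd (w ! i)))}"

definition word_value :: "('a, 'b) monoid_scheme \<Rightarrow> ('a \<times> bool) list \<Rightarrow> 'a" where
  "word_value G w =
     foldr (\<lambda>(s, e) y. (if e then s else inv\<^bsub>G\<^esub> s) \<otimes>\<^bsub>G\<^esub> y) w \<one>\<^bsub>G\<^esub>"

definition free_basis :: "('a, 'b) monoid_scheme \<Rightarrow> 'a set \<Rightarrow> bool" where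
  "free_basis G S \<longleftrightarrow>
     S \<subseteq> carrier G \<and> bij_betw (word_value G) (reduced_words S) (carrier G)"

text \<open>
  Free on at least two generators; the basis may be infinite, so \<open>card\<close> is avoided.
\<close>

definition nonabelian_free_group :: "('a, 'b) monoid_scheme \<Rightarrow> bool" where
  "nonabelian_free_group G \<longleftrightarrow>
     group G \<and> (\<exists>S. free_basis G S \<and> (\<exists>s\<in>S. \<exists>t\<in>S. s \<noteq> t))"

section \<open>The fundamental group\<close>

text \<open>
  The library's \<open>+++\<close> and \<open>homotopic_paths\<close> are confined to types of class
  \<open>topological_space\<close>; the following are their counterparts for abstract topologies.
\<close>

definition loops :: "'a topology \<Rightarrow> 'a \<Rightarrow> (real \<Rightarrow> 'a) set" where
  "loops X x = {p. pathin X p \<and> p 0 = x \<and> p 1 = x}"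

definition loop_homotopic :: "'a topology \<Rightarrow> 'a \<Rightarrow> (real \<Rightarrow> 'a) \<Rightarrow> (real \<Rightarrow> 'a) \<Rightarrow> bool" where
  "loop_homotopic X x p q \<longleftrightarrow>
     homotopic_with (\<lambda>l. l 0 = x \<and> l 1 = x) (top_of_set {0..1}) X p q"

definition loop_concat :: "(real \<Rightarrow> 'a) \<Rightarrow> (real \<Rightarrow> 'a) \<Rightarrow> real \<Rightarrow> 'a" where
  "loop_concat p q = (\<lambda>t. if t \<le> 1/2 then p (2 * t) else q (2 * t - 1))"

definition loop_class :: "'a topology \<Rightarrow> 'a \<Rightarrow> (real \<Rightarrow> 'a) \<Rightarrow> (real \<Rightarrow> 'a) set" where
  "loop_class X x p = {q. loop_homotopic X x p q}"

definition fundamental_group :: "'a topology \<Rightarrow> 'a \<Rightarrow> (real \<Rightarrow> 'a) set monoid" where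
  "fundamental_group X x =
     \<lparr> carrier = loop_class X x ` loops X x,
       mult = (\<lambda>A B. \<Union>p\<in>A. \<Union>q\<in>B. loop_class X x (loop_concat p q)),
       one = loop_class X x (\<lambda>_. x) \<rparr>"

lemma loop_homotopic_sym: "loop_homotopic X x p q \<Longrightarrow> loop_homotopic X x q p"
  unfolding loop_homotopic_def by (rule homotopic_with_symD)

lemma loop_homotopic_trans:
  "loop_homotopic X x p q \<Longrightarrow> loop_homotopic X x q r \<Longrightarrow> loop_homotopic X x p r"
  unfolding loop_homotopic_def by (rule homotopic_with_trans)

lemma loop_homotopic_refl: "loop_homotopic X x p p \<longleftrightarrow> p \<in> loops X x"
  unfolding loop_homotopic_def loops_def pathin_def by simp

lemma loop_homotopic_loops: "loop_homotopic X x p q \<Longrightarrow> p \<in> loops X x \<and> q \<in> loops X x"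
  by (meson loop_homotopic_refl loop_homotopic_sym loop_homotopic_trans)

lemma loop_class_eq_iff:
  assumes "p \<in> loops X x"
  shows "loop_class X x p = loop_class X x q \<longleftrightarrow> loop_homotopic X x p q"
proof
  assume "loop_class X x p = loop_class X x q"
  moreover have "p \<in> loop_class X x p"
    using assms by (simp add: loop_class_def loop_homotopic_refl)
  ultimately show "loop_homotopic X x p q"
    by (simp add: loop_class_def loop_homotopic_sym)
next
  assume "loop_homotopic X x p q"
  then show "loop_class X x p = loop_class X x q"
    unfolding loop_class_def by (blast intro: loop_homotopic_trans loop_homotopic_sym)
qed

lemma loop_concat_homotopic:
  assumes "loop_homotopic X x p p'" "loop_homotopic X x q q'"
  shows "loop_homotopic X x (loop_concat p q) (loop_concat p' q')"
proof -
  let ?I = "top_of_set {0..1::real}"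
  obtain h where h: "continuous_map (prod_topology ?I ?I) X h"
    "\<And>s. h (0, s) = p s" "\<And>s. h (1, s) = p' s" "\<And>t. t \<in> {0..1} \<Longrightarrow> h (t, 0) = x \<and> h (t, 1) = x"
    using assms(1) unfolding loop_homotopic_def homotopic_with_def by auto
  obtain k where k: "continuous_map (prod_topology ?I ?I) X k"
    "\<And>s. k (0, s) = q s" "\<And>s. k (1, s) = q' s" "\<And>t. t \<in> {0..1} \<Longrightarrow> k (t, 0) = x \<and> k (t, 1) = x"
    using assms(2) unfolding loop_homotopic_def homotopic_with_def by auto
  define m where "m = (\<lambda>z::real \<times> real. if snd z \<le> 1/2 then h (fst z, 2 * snd z) else k (fst z, 2 * snd z - 1))"
  have P: "prod_topology ?I ?I = top_of_set ({0..1} \<times> {0..1})"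
    by (simp add: prod_topology_subtopology subtopology_subtopology Times_Int_Times)
  have "continuous_map (prod_topology ?I ?I) X m"
    unfolding m_def
  proof (rule continuous_map_cases_le)
    show "continuous_map (prod_topology ?I ?I) euclideanreal snd"
      "continuous_map (prod_topology ?I ?I) euclideanreal (\<lambda>z. 1/2)"
      unfolding P by (auto intro!: continuous_intros)
    have "continuous_map (subtopology (prod_topology ?I ?I) {z \<in> topspace (prod_topology ?I ?I). snd z \<le> 1/2})
       (prod_topology ?I ?I) (\<lambda>z. (fst z, 2 * snd z))"
      unfolding P by (auto simp: subtopology_subtopology intro!: continuous_intros)
    from continuous_map_compose[OF this h(1)]
    show "continuous_map (subtopology (prod_topology ?I ?I) {z \<in> topspace (prod_topology ?I ?I). snd z \<le> 1/2})
       X (\<lambda>z. h (fst z, 2 * snd z))" by (simp add: o_def)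
    have "continuous_map (subtopology (prod_topology ?I ?I) {z \<in> topspace (prod_topology ?I ?I). 1/2 \<le> snd z})
       (prod_topology ?I ?I) (\<lambda>z. (fst z, 2 * snd z - 1))"
      unfolding P by (auto simp: subtopology_subtopology intro!: continuous_intros)
    from continuous_map_compose[OF this k(1)]
    show "continuous_map (subtopology (prod_topology ?I ?I) {z \<in> topspace (prod_topology ?I ?I). 1/2 \<le> snd z})
       X (\<lambda>z. k (fst z, 2 * snd z - 1))" by (simp add: o_def)
  next
    fix z assume "z \<in> topspace (prod_topology ?I ?I)" "snd z = 1/2"
    then have "fst z \<in> {0..1}" "2 * snd z = 1" "2 * snd z - 1 = 0" by auto
    then show "h (fst z, 2 * snd z) = k (fst z, 2 * snd z - 1)" using h(4) k(4) by metis
  qed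
  then show ?thesis
    unfolding loop_homotopic_def homotopic_with_def
    by (intro exI[of _ m]) (auto simp: m_def loop_concat_def h k)
qed

lemma loop_reparametrize:
  assumes p: "pathin X p"
    and \<phi>: "continuous_on {0..1} \<phi>" "\<phi> ` {0..1} \<subseteq> {0..1::real}"
    and \<psi>: "continuous_on {0..1} \<psi>" "\<psi> ` {0..1} \<subseteq> {0..1::real}"
    and ends: "\<phi> 0 = \<psi> 0" "\<phi> 1 = \<psi> 1" "p (\<phi> 0) = x" "p (\<phi> 1) = x"
  shows "loop_homotopic X x (p \<circ> \<phi>) (p \<circ> \<psi>)"
proof -
  let ?I = "top_of_set {0..1::real}"
  define m where "m = (\<lambda>z::real \<times> real. (1 - fst z) * \<phi> (snd z) + fst z * \<psi> (snd z))"
  have P: "prod_topology ?I ?I = top_of_set ({0..1} \<times> {0..1})"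
    by (simp add: prod_topology_subtopology subtopology_subtopology Times_Int_Times)
  have "m z \<in> {0..1}" if "z \<in> {0..1} \<times> {0..1}" for z
  proof -
    have "\<phi> (snd z) \<in> {0..1}" "\<psi> (snd z) \<in> {0..1}" "fst z \<in> {0..1}" using that \<phi> \<psi> by auto
    then show ?thesis
      unfolding m_def using convexD_alt[of "{0..1::real}" "\<phi> (snd z)" "\<psi> (snd z)" "fst z"]
      by (simp add: convex_real_interval)
  qed
  moreover have "continuous_on ({0..1} \<times> {0..1}) m"
    unfolding m_def
    by (intro continuous_intros continuous_on_compose2[OF \<phi>(1)] continuous_on_compose2[OF \<psi>(1)]) auto
  ultimately have "continuous_map (prod_topology ?I ?I) ?I m"
    unfolding P by auto
  from continuous_map_compose[OF this p[unfolded pathin_def]]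
  have "continuous_map (prod_topology ?I ?I) X (p \<circ> m)" .
  moreover have m: "m (t, 0) = \<phi> 0" "m (t, 1) = \<phi> 1" for t
    unfolding m_def using ends by (auto simp: algebra_simps)
  moreover have "p (m (t, 0)) = x" "p (m (t, 1)) = x" for t
    using ends m by simp_all
  ultimately show ?thesis
    unfolding loop_homotopic_def homotopic_with_def
    by (intro exI[of _ "p \<circ> m"]) (auto, auto simp: m_def)
qed

lemma loop_concat_loops: "p \<in> loops X x \<Longrightarrow> q \<in> loops X x \<Longrightarrow> loop_concat p q \<in> loops X x"
  using loop_concat_homotopic[of X x p p q q] by (simp add: loop_homotopic_refl)

lemma const_loop: "x \<in> topspace X \<Longrightarrow> (\<lambda>_. x) \<in> loops X x"
  by (simp add: loops_def pathin_def)

lemma loop_reparametrize_loop: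
  assumes p: "p \<in> loops X x"
    and \<phi>: "continuous_on {0..1} \<phi>" "\<phi> ` {0..1} \<subseteq> {0..1::real}" "\<phi> 0 = 0" "\<phi> 1 = 1"
  shows "loop_homotopic X x (p \<circ> \<phi>) p"
  using loop_reparametrize[of X p \<phi> "\<lambda>t. t" x] p \<phi> by (auto simp: loops_def o_def)

lemma cont_if: 
  assumes "continuous_on {0..1} f" "continuous_on {0..1} g" "f a = g a" "0 \<le> a" "a \<le> (1::real)"
  shows "continuous_on {0..1} (\<lambda>t. if t \<le> a then f t else (g t :: real))"
  by (rule continuous_on_cases_le[where h="\<lambda>t. t"])
     (use assms in \<open>auto intro: continuous_on_subset\<close>)

lemma loop_concat_assoc:
  assumes "p \<in> loops X x" "q \<in> loops X x" "r \<in> loops X x"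
  shows "loop_homotopic X x (loop_concat (loop_concat p q) r) (loop_concat p (loop_concat q r))"
proof -
  define \<phi> :: "real \<Rightarrow> real" where
    "\<phi> = (\<lambda>t. if t \<le> 1/2 then (if t \<le> 1/4 then 2 * t else t + 1/4) else t / 2 + 1/2)"
  have "continuous_on {0..1} \<phi>"
    unfolding \<phi>_def by (intro cont_if continuous_intros) auto
  then have "loop_homotopic X x (loop_concat p (loop_concat q r) \<circ> \<phi>) (loop_concat p (loop_concat q r))"
    by (intro loop_reparametrize_loop loop_concat_loops assms) (auto simp: \<phi>_def)
  moreover have "loop_concat p (loop_concat q r) \<circ> \<phi> = loop_concat (loop_concat p q) r"
  proof
    fix t 
    show "(loop_concat p (loop_concat q r) \<circ> \<phi>) t = loop_concat (loop_concat p q) r t"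
    proof -
      consider "t \<le> 1/4" | "1/4 < t" "t \<le> 1/2" | "1/2 < t" by linarith
      then show ?thesis
      proof cases
        case 1 then show ?thesis by (simp add: loop_concat_def \<phi>_def)
      next
        case 2
        have "2 * (2 * (t + 1/4) - 1) = 2 * (2 * t) - 1" by simp
        with 2 show ?thesis by (simp add: loop_concat_def \<phi>_def)
      next
        case 3
        have "2 * (2 * (t / 2 + 1/2) - 1) - 1 = 2 * t - 1" by simp
        with 3 show ?thesis by (simp add: loop_concat_def \<phi>_def)
      qed
    qed
  qed
  ultimately show ?thesis by simp
qed

lemma loop_concat_left_unit:
  assumes "p \<in> loops X x"
  shows "loop_homotopic X x (loop_concat (\<lambda>_. x) p) p"
proof -
  define \<phi> :: "real \<Rightarrow> real" where "\<phi> = (\<lambda>t. if t \<le> 1/2 then 0 else 2 * t - 1)"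
  have "continuous_on {0..1} \<phi>"
    unfolding \<phi>_def by (intro cont_if continuous_intros) auto
  then have "loop_homotopic X x (p \<circ> \<phi>) p"
    by (intro loop_reparametrize_loop assms) (auto simp: \<phi>_def)
  moreover have "p \<circ> \<phi> = loop_concat (\<lambda>_. x) p"
    using assms by (auto simp: loop_concat_def \<phi>_def loops_def)
  ultimately show ?thesis by simp
qed

lemma loop_concat_left_inv:
  assumes "p \<in> loops X x"
  shows "(\<lambda>t. p (1 - t)) \<in> loops X x" "loop_homotopic X x (loop_concat (\<lambda>t. p (1 - t)) p) (\<lambda>_. x)"
proof -
  have p: "pathin X p" "p 0 = x" "p 1 = x" using assms by (auto simp: loops_def)
  have "loop_homotopic X x (p \<circ> (\<lambda>t. 1 - t)) (p \<circ> (\<lambda>t. 1 - t))"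
    by (rule loop_reparametrize[OF p(1)]) (auto simp: p intro!: continuous_intros)
  then show "(\<lambda>t. p (1 - t)) \<in> loops X x" by (simp add: loop_homotopic_refl o_def)
  define \<phi> :: "real \<Rightarrow> real" where "\<phi> = (\<lambda>t. if t \<le> 1/2 then 1 - 2 * t else 2 * t - 1)"
  have "continuous_on {0..1} \<phi>"
    unfolding \<phi>_def by (intro cont_if continuous_intros) auto
  then have "loop_homotopic X x (p \<circ> \<phi>) (p \<circ> (\<lambda>_. 1))"
    by (intro loop_reparametrize p) (auto simp: \<phi>_def p)
  moreover have "p \<circ> \<phi> = loop_concat (\<lambda>t. p (1 - t)) p"
    by (auto simp: loop_concat_def \<phi>_def)
  ultimately show "loop_homotopic X x (loop_concat (\<lambda>t. p (1 - t)) p) (\<lambda>_. x)"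
    by (simp add: o_def p)
qed

lemma fundamental_group_mult:
  assumes "p \<in> loops X x" "q \<in> loops X x"
  shows "loop_class X x p \<otimes>\<^bsub>fundamental_group X x\<^esub> loop_class X x q = loop_class X x (loop_concat p q)"
proof -
  have "loop_class X x (loop_concat p' q') = loop_class X x (loop_concat p q)"
    if "p' \<in> loop_class X x p" "q' \<in> loop_class X x q" for p' q'
  proof -
    have "loop_homotopic X x (loop_concat p q) (loop_concat p' q')"
      using that by (intro loop_concat_homotopic) (simp_all add: loop_class_def)
    then show ?thesis
      using loop_class_eq_iff[OF loop_concat_loops[OF assms], THEN iffD2] by metis
  qed
  then have "(\<Union>p'\<in>loop_class X x p. \<Union>q'\<in>loop_class X x q. loop_class X x (loop_concat p' q'))
      = (\<Union>p'\<in>loop_class X x p. \<Union>q'\<in>loop_class X x q. loop_class X x (loop_concat p q))"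
    by (intro SUP_cong refl)
  moreover have "loop_class X x p \<noteq> {}" "loop_class X x q \<noteq> {}"
    using assms by (auto simp: loop_class_def loop_homotopic_refl[symmetric])
  ultimately show ?thesis
    by (simp add: fundamental_group_def)
qed

lemma group_fundamental_group:
  assumes "x \<in> topspace X"
  shows "group (fundamental_group X x)"
proof -
  have c: "carrier (fundamental_group X x) = loop_class X x ` loops X x"
    and o: "\<one>\<^bsub>fundamental_group X x\<^esub> = loop_class X x (\<lambda>_. x)"
    by (auto simp: fundamental_group_def)
  note [simp] = fundamental_group_mult loop_concat_loops const_loop[OF assms] loop_class_eq_iff
  have assoc: "loop_class X x (loop_concat (loop_concat p q) r) = loop_class X x (loop_concat p (loop_concat q r))"
    if "p \<in> loops X x" "q \<in> loops X x" "r \<in> loops X x" for p q r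
    using that by (simp add: loop_concat_assoc)
  have unit: "loop_class X x (loop_concat (\<lambda>_. x) p) = loop_class X x p" if "p \<in> loops X x" for p
    using that by (simp add: loop_concat_left_unit)
  show ?thesis
  proof (rule groupI, unfold c o)
    fix A assume "A \<in> loop_class X x ` loops X x"
    then obtain p where p: "p \<in> loops X x" "A = loop_class X x p" by auto
    show "\<exists>B\<in>loop_class X x ` loops X x. B \<otimes>\<^bsub>fundamental_group X x\<^esub> A = loop_class X x (\<lambda>_. x)"
      using loop_concat_left_inv[OF p(1)] p by (intro bexI[of _ "loop_class X x (\<lambda>t. p (1 - t))"]) auto
  next
    show "loop_class X x (\<lambda>_. x) \<in> loop_class X x ` loops X x"
      by (rule imageI) simp
  next
    fix A B assume "A \<in> loop_class X x ` loops X x" "B \<in> loop_class X x ` loops X x"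
    then show "A \<otimes>\<^bsub>fundamental_group X x\<^esub> B \<in> loop_class X x ` loops X x"
      by (auto simp del: loop_class_eq_iff)
  next
    fix A B C assume "A \<in> loop_class X x ` loops X x" "B \<in> loop_class X x ` loops X x"
      "C \<in> loop_class X x ` loops X x"
    then obtain p q r where "p \<in> loops X x" "q \<in> loops X x" "r \<in> loops X x"
      "A = loop_class X x p" "B = loop_class X x q" "C = loop_class X x r" by blast
    then show "A \<otimes>\<^bsub>fundamental_group X x\<^esub> B \<otimes>\<^bsub>fundamental_group X x\<^esub> C
        = A \<otimes>\<^bsub>fundamental_group X x\<^esub> (B \<otimes>\<^bsub>fundamental_group X x\<^esub> C)"
      by (simp del: loop_class_eq_iff add: assoc)
  next
    fix A assume "A \<in> loop_class X x ` loops X x"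
    then obtain p where "p \<in> loops X x" "A = loop_class X x p" by blast
    then show "loop_class X x (\<lambda>_. x) \<otimes>\<^bsub>fundamental_group X x\<^esub> A = A"
      by (simp del: loop_class_eq_iff add: unit)
  qed
qed

section \<open>Closed oriented surfaces and surface groups\<close>

definition quotient_topology :: "'a topology \<Rightarrow> ('a \<times> 'a) set \<Rightarrow> 'a set topology" where
  "quotient_topology X R = topology (\<lambda>U. U \<subseteq> topspace X // R \<and> openin X (\<Union>U))"

lemma quotient_map_quotient_topology:
  assumes "equiv (topspace X) R"
  shows "quotient_map X (quotient_topology X R) (\<lambda>x. R `` {x})"
proof -
  let ?P = "\<lambda>U. U \<subseteq> topspace X // R \<and> openin X (\<Union>U)"
  have int: "\<Union>(U \<inter> V) = \<Union>U \<inter> \<Union>V" if "U \<subseteq> topspace X // R" "V \<subseteq> topspace X // R" for U V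
    using quotient_disj[OF assms] that by blast
  have "istopology ?P"
    unfolding istopology_def
  proof (intro conjI allI impI)
    fix U V assume "?P U" "?P V"
    then show "U \<inter> V \<subseteq> topspace X // R" "openin X (\<Union>(U \<inter> V))" by (auto simp: int)
  next
    fix \<K> assume K: "\<forall>K\<in>\<K>. ?P K"
    then show "\<Union>\<K> \<subseteq> topspace X // R" by blast
    have "\<Union>(\<Union>\<K>) = \<Union>(Union ` \<K>)" by blast
    with K show "openin X (\<Union>(\<Union>\<K>))" by (metis (no_types, lifting) imageE openin_Union)
  qed
  then have op: "openin (quotient_topology X R) U \<longleftrightarrow> ?P U" for U
    by (simp add: quotient_topology_def)
  have "openin (quotient_topology X R) (topspace X // R)"
    by (simp add: op Union_quotient[OF assms])
  then have ts: "topspace (quotient_topology X R) = topspace X // R"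
    using op unfolding topspace_def by blast
  have "{x \<in> topspace X. R `` {x} \<in> U} = \<Union>U" if "U \<subseteq> topspace X // R" for U
  proof -
    have "R `` {x} = C" if "C \<in> topspace X // R" "x \<in> C" for x C
      using that assms by (metis Image_singleton_iff equiv_class_eq quotientE)
    moreover have "C \<subseteq> topspace X" if "C \<in> topspace X // R" for C
      using that Union_quotient[OF assms] by blast
    moreover have "x \<in> R `` {x}" if "x \<in> topspace X" for x
      using assms that equiv_class_self by metis
    ultimately show ?thesis using that by blast
  qed
  then show ?thesis
    unfolding quotient_map_def ts op by (auto simp: quotient_def)
qed

text \<open>
  The closed unit disc is regarded as a polygon with \<open>4 * g\<close> edges, the \<open>k\<close>-th edge being
  the arc \<open>t \<mapsto> polygon_boundary g (k + t)\<close>, \<open>0 \<le> t \<le> 1\<close>. Reading the boundary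
  counterclockwise, the edges are labelled by the word
  \<open>a\<^sub>1 b\<^sub>1 a\<^sub>1\<^sup>-\<^sup>1 b\<^sub>1\<^sup>-\<^sup>1 \<dots> a\<^sub>g b\<^sub>g a\<^sub>g\<^sup>-\<^sup>1 b\<^sub>g\<^sup>-\<^sup>1\<close>.
  Since each label occurs with both signs, paired edges are identified with opposite
  boundary orientations and the quotient is orientable.
\<close>

definition polygon_boundary :: "nat \<Rightarrow> real \<Rightarrow> complex" where
  "polygon_boundary g s = cis (2 * pi * s / (4 * real g))"

inductive edge_pairing :: "nat \<Rightarrow> complex \<Rightarrow> complex \<Rightarrow> bool" for g :: nat where
  a_edge: "j < g \<Longrightarrow> 0 \<le> t \<Longrightarrow> t \<le> 1 \<Longrightarrow>
     edge_pairing g (polygon_boundary g (4 * real j + t)) (polygon_boundary g (4 * real j + 3 - t))"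
| b_edge: "j < g \<Longrightarrow> 0 \<le> t \<Longrightarrow> t \<le> 1 \<Longrightarrow>
     edge_pairing g (polygon_boundary g (4 * real j + 1 + t)) (polygon_boundary g (4 * real j + 4 - t))"

definition polygon_gluing :: "nat \<Rightarrow> (complex \<times> complex) set" where
  "polygon_gluing g = {(z, w). z \<in> cball 0 1 \<and> w \<in> cball 0 1 \<and> equivclp (edge_pairing g) z w}"

text \<open>
  The standard model of the closed oriented surface of genus \<open>g\<close>, for \<open>g \<ge> 1\<close>. (For \<open>g = 0\<close> nothing is glued and
  one gets the disc.)
\<close>

definition closed_surface :: "nat \<Rightarrow> complex set topology" where
  "closed_surface g = quotient_topology (top_of_set (cball 0 1)) (polygon_gluing g)"

lemma equiv_polygon_gluing: "equiv (cball 0 1) (polygon_gluing g)"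
proof (rule equivI)
  show "sym (polygon_gluing g)"
    by (auto simp: polygon_gluing_def sym_def intro: equivclp_sym)
  show "trans (polygon_gluing g)"
    unfolding polygon_gluing_def trans_def by (auto intro: equivclp_trans)
qed (auto simp: polygon_gluing_def refl_on_def)

lemma quotient_map_closed_surface:
  "quotient_map (top_of_set (cball 0 1)) (closed_surface g) (\<lambda>z. polygon_gluing g `` {z})"
  unfolding closed_surface_def
  by (rule quotient_map_quotient_topology) (simp add: equiv_polygon_gluing)

definition closed_oriented_surface_of_genus :: "nat \<Rightarrow> 'a topology \<Rightarrow> bool" where
  "closed_oriented_surface_of_genus g X \<longleftrightarrow> g \<ge> 1 \<and> X homeomorphic_space closed_surface g"

text \<open>
  Since \<open>closed_surface g\<close> itself is a surface of genus \<open>g\<close> of the type used here, letting \<open>X\<close>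
  range over this one type costs no generality.
\<close>

definition surface_group :: "('a, 'b) monoid_scheme \<Rightarrow> bool" where
  "surface_group H \<longleftrightarrow>
     group H \<and>
     (\<exists>g\<ge>2. \<exists>X :: complex set topology. closed_oriented_surface_of_genus g X \<and>
        (\<exists>x\<in>topspace X. H \<cong> fundamental_group X x))"

end

theory Submission
  imports Defs "HOL-Algebra.Generated_Groups" "HOL-Computational_Algebra.Polynomial"
begin

text \<open>
  From free groups to surface groups: let \<open>a\<close>, \<open>b\<close> be free generators in the compact group and
  \<open>u = [a, b]\<close>. For every \<open>t\<close> in the closure \<open>C\<close> of the powers of \<open>u\<close> there is a homomorphism from
  the surface group \<open>[a\<^sub>1, b\<^sub>1] [a\<^sub>2, b\<^sub>2] = 1\<close> of genus 2 with
  \<open>a\<^sub>1 \<mapsto> a\<close>, \<open>b\<^sub>1 \<mapsto> b\<close>, \<open>a\<^sub>2 \<mapsto> t b t\<^sup>-\<^sup>1\<close>, \<open>b\<^sub>2 \<mapsto> t a t\<^sup>-\<^sup>1\<close>. A nontrivial element of the surface group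
  dies for only finitely many \<open>t = u\<^sup>n\<close> (Baumslag), hence for a closed, nowhere dense set of
  \<open>t\<close>, and Baire's theorem gives a \<open>t\<close> for which the homomorphism is injective. Baumslag's lemma is
  checked in a free group of integer matrices in which \<open>u\<close> is upper triangular: the lower left entry of
  the image of an alternating product is a nonzero polynomial in \<open>n\<close>.

  From surface groups to free groups: the surface group maps onto the free group of integer matrices,
  by killing all \<open>b\<^sub>i\<close> and all but two of the \<open>a\<^sub>i\<close>.

  What is needed about the fundamental group of the glued polygon is that edge labels in a group \<open>K\<close>
  satisfying the boundary relation define a homomorphism to \<open>K\<close>, namely the holonomy of a local system,
  and that the edge loops generate.
\<close>

section \<open>Words and their values\<close>

text \<open>No single power of \<open>u\<close> can serve as \<open>t\<close>: a surface group does
  not embed in the free group on \<open>a\<close> and \<open>b\<close>, so every power loses some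
  element and only a limit of powers can be faithful. Compactness enters twice. It makes the powers
  of \<open>u\<close> accumulate, so that a nonempty open subset of \<open>C\<close> contains
  infinitely many of them, and it makes \<open>C\<close> a Baire space.

  Injectivity is not read off from a presentation of the fundamental group. Words are rewritten into
  alternating form by means of one relation, the equality of two commutators, which holds at once in
  the fundamental group, in the compact group and in the matrices. A rewritten word is either a
  power of the commutator, the same power everywhere, or visibly nontrivial in the matrices for
  almost all \<open>n\<close>. The generators of the second factor are interchanged because the
  relation of genus 2 makes the commutators of the two handles inverse to each other, whereas
  amalgamation asks for equality.\<close>

definition ev :: "('g, 'r) monoid_scheme \<Rightarrow> ('s \<Rightarrow> 'g) \<Rightarrow> ('s \<times> bool) list \<Rightarrow> 'g" where
  "ev K f w = foldr (\<lambda>(s, e) y. (if e then f s else inv\<^bsub>K\<^esub> (f s)) \<otimes>\<^bsub>K\<^esub> y) w \<one>\<^bsub>K\<^esub>"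

definition inv_letter :: "'s \<times> bool \<Rightarrow> 's \<times> bool" where
  "inv_letter l = (fst l, \<not> snd l)"

definition inv_word :: "('s \<times> bool) list \<Rightarrow> ('s \<times> bool) list" where
  "inv_word w = rev (map inv_letter w)"

lemma ev_Nil [simp]: "ev K f [] = \<one>\<^bsub>K\<^esub>"
  by (simp add: ev_def)

lemma ev_Cons:
  "ev K f ((s, e) # w) = (if e then f s else inv\<^bsub>K\<^esub> (f s)) \<otimes>\<^bsub>K\<^esub> ev K f w"
  by (simp add: ev_def)

lemma word_value_eq_ev: "word_value K w = ev K (\<lambda>s. s) w"
  by (simp add: word_value_def ev_def)

text \<open>The letters of \<open>word_value\<close> are group elements; those of \<open>ev\<close>
  are symbols, so that one word can be compared in several groups. This is the passage between the
  two.\<close>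

lemma word_value_map: "word_value K (map (map_prod f (\<lambda>e. e)) w) = ev K f w"
  by (induction w) (auto simp: word_value_eq_ev ev_Cons)

context group
begin

lemma ev_closed [simp]: "(\<And>s. f s \<in> carrier G) \<Longrightarrow> ev G f w \<in> carrier G"
  by (induction w) (auto simp: ev_Cons split_paired_all)

lemma ev_append:
  assumes "\<And>s. f s \<in> carrier G"
  shows "ev G f (v @ w) = ev G f v \<otimes> ev G f w"
proof (induction v)
  case (Cons l v)
  then show ?case using assms by (cases l) (simp add: ev_Cons m_assoc)
qed (simp add: assms)

lemma ev_inv_word:
  assumes "\<And>s. f s \<in> carrier G"
  shows "ev G f (inv_word w) = inv (ev G f w)"
proof (induction w)
  case (Cons l w)
  obtain s e where l: "l = (s, e)" by fastforce
  have "ev G f (inv_word w @ [inv_letter l]) = inv (ev G f w) \<otimes> (if e then inv (f s) else f s)"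
    using Cons assms by (simp add: ev_append l inv_letter_def ev_Cons)
  also have "\<dots> = inv (ev G f (l # w))"
    using assms by (simp add: l ev_Cons inv_mult_group)
  finally show ?case by (simp add: inv_word_def)
qed (simp add: inv_word_def)

end

lemma hom_ev:
  assumes "group G" "group K" "\<phi> \<in> hom G K" "\<And>s. f s \<in> carrier G"
  shows "\<phi> (ev G f w) = ev K (\<lambda>s. \<phi> (f s)) w"
proof -
  interpret group_hom G K \<phi>
    using assms by (simp add: group_hom_def group_hom_axioms_def)
  show ?thesis
  proof (induction w)
    case (Cons l w)
    then show ?case using assms(4) by (cases l) (simp add: ev_Cons)
  qed simp
qed

lemma ev_subgroup:
  assumes "group G" "subgroup H G" "\<And>s. f s \<in> H"
  shows "ev (G\<lparr>carrier := H\<rparr>) f w = ev G f w"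
proof (induction w)
  case (Cons l w)
  then show ?case
    using assms(3) by (cases l) (simp add: ev_Cons group.m_inv_consistent[OF assms(1,2)])
qed simp

subsection \<open>Free reduction\<close>

text \<open>Working from the right, the tail is already reduced when a letter is put in front, so
  only one cancellation, at the head, has to be considered.\<close>

fun reduce :: "('s \<times> bool) list \<Rightarrow> ('s \<times> bool) list" where
  "reduce [] = []"
| "reduce (l # w) =
     (case reduce w of [] \<Rightarrow> [l] | m # v \<Rightarrow> if m = inv_letter l then v else l # m # v)"

lemma all_nat_Suc: "(\<forall>i. P i) \<longleftrightarrow> P 0 \<and> (\<forall>i. P (Suc i))"
  by (metis not0_implies_Suc)

lemma reduced_words_Nil [simp]: "[] \<in> reduced_words S"
  by (simp add: reduced_words_def)

lemma reduced_words_Cons: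
  "l # w \<in> reduced_words S \<longleftrightarrow>
     fst l \<in> S \<and> w \<in> reduced_words S \<and> (w \<noteq> [] \<longrightarrow> hd w \<noteq> inv_letter l)"
proof (cases w)
  case Nil
  then show ?thesis by (cases l) (auto simp: reduced_words_def)
next
  case (Cons m v)
  have "(\<forall>i. Suc i < length (l # w) \<longrightarrow> (l # w) ! Suc i \<noteq> inv_letter ((l # w) ! i)) \<longleftrightarrow>
        m \<noteq> inv_letter l \<and> (\<forall>i. Suc i < length w \<longrightarrow> w ! Suc i \<noteq> inv_letter (w ! i))"
    by (subst all_nat_Suc) (auto simp: Cons)
  then show ?thesis
    by (cases l) (auto simp: reduced_words_def Cons inv_letter_def)
qed

lemma reduce_reduced: "fst ` set w \<subseteq> S \<Longrightarrow> reduce w \<in> reduced_words S"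
  by (induction w) (auto simp: reduced_words_Cons split: list.splits)

lemma (in group) ev_reduce:
  assumes "\<And>s. f s \<in> carrier G"
  shows "ev G f (reduce w) = ev G f w"
proof (induction w)
  case (Cons l w)
  note IH = this
  obtain s e where l: "l = (s, e)" by fastforce
  show ?case
  proof (cases "reduce w")
    case Nil
    then show ?thesis using Cons l by (simp add: ev_Cons)
  next
    case (Cons m v)
    show ?thesis
    proof (cases "m = inv_letter l")
      case True
      then have "ev G f w = (if e then inv (f s) else f s) \<otimes> ev G f v"
        using IH Cons l by (auto simp: inv_letter_def ev_Cons)
      then show ?thesis
        using Cons True assms by (auto simp: l ev_Cons m_assoc[symmetric])
    next
      case False
      then show ?thesis using IH l Cons by (simp add: ev_Cons)
    qed
  qed
qed simp

section \<open>A free group of integer matrices\<close>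

type_synonym mat2 = "int \<times> int \<times> int \<times> int"

definition SL2 :: "mat2 monoid" where
  "SL2 = \<lparr> carrier = {(x, y, z, w). x * w - y * z = 1},
     mult = (\<lambda>(x, y, z, w) (x', y', z', w').
       (x * x' + y * z', x * y' + y * w', z * x' + w * z', z * y' + w * w')),
     one = (1, 0, 0, 1) \<rparr>"

lemma SL2_carrier [simp]: "(x, y, z, w) \<in> carrier SL2 \<longleftrightarrow> x * w - y * z = 1"
  by (simp add: SL2_def)

lemma SL2_mult [simp]: "(x, y, z, w) \<otimes>\<^bsub>SL2\<^esub> (x', y', z', w') =
    (x * x' + y * z', x * y' + y * w', z * x' + w * z', z * y' + w * w')"
  by (simp add: SL2_def)

lemma SL2_one [simp]: "\<one>\<^bsub>SL2\<^esub> = (1, 0, 0, 1)"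
  by (simp add: SL2_def)

lemma SL2_det_mult:
  fixes x :: int
  assumes "x * w - y * z = 1" "x' * w' - y' * z' = 1"
  shows "(x * x' + y * z') * (z * y' + w * w') - (x * y' + y * w') * (z * x' + w * z') = 1"
proof -
  have "(x * x' + y * z') * (z * y' + w * w') - (x * y' + y * w') * (z * x' + w * z')
      = (x * w - y * z) * (x' * w' - y' * z')"
    by (simp add: algebra_simps)
  then show ?thesis by (simp only: assms mult_1)
qed

lemma group_SL2: "group SL2"
proof (rule groupI)
  show "a \<otimes>\<^bsub>SL2\<^esub> b \<in> carrier SL2" if "a \<in> carrier SL2" "b \<in> carrier SL2" for a b
    using that by (cases a, cases b) (simp add: SL2_det_mult)
  show "a \<otimes>\<^bsub>SL2\<^esub> b \<otimes>\<^bsub>SL2\<^esub> c = a \<otimes>\<^bsub>SL2\<^esub> (b \<otimes>\<^bsub>SL2\<^esub> c)" for a b c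
    by (cases a, cases b, cases c) (simp add: algebra_simps)
  show "\<exists>b\<in>carrier SL2. b \<otimes>\<^bsub>SL2\<^esub> a = \<one>\<^bsub>SL2\<^esub>" if "a \<in> carrier SL2" for a
  proof -
    obtain x y z w where "a = (x, y, z, w)" by (cases a)
    with that show ?thesis
      by (intro bexI[of _ "(w, - y, - z, x)"]) (auto simp: algebra_simps)
  qed
qed auto

interpretation SL2: group SL2
  by (rule group_SL2)

lemma SL2_inv [simp]:
  assumes "x * w - y * z = 1"
  shows "inv\<^bsub>SL2\<^esub> (x, y, z, w) = (w, - y, - z, x)"
  by (rule SL2.inv_equality) (use assms in \<open>auto simp: algebra_simps\<close>)

text \<open>The side pairings of an ideal quadrilateral, which glue it to a once-punctured torus.
  The commutator runs round the puncture and is the parabolic element at the cusp \<infinity>, so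
  that being a power of the commutator becomes the vanishing of one matrix entry.\<close>

definition rho :: "bool \<Rightarrow> mat2" where
  "rho g = (if g then (3, 1, - 1, 0) else (2, 1, 1, 1))"

lemma rho_carrier [simp]: "rho g \<in> carrier SL2"
  by (simp add: rho_def)

definition ev_letter :: "bool \<times> bool \<Rightarrow> mat2" where
  "ev_letter l = (if snd l then rho (fst l) else inv\<^bsub>SL2\<^esub> (rho (fst l)))"

lemma ev_letter_simps [simp]:
  "ev_letter (True, True) = (3, 1, - 1, 0)"
  "ev_letter (True, False) = (0, - 1, 1, 3)"
  "ev_letter (False, True) = (2, 1, 1, 1)"
  "ev_letter (False, False) = (1, - 1, - 1, 2)"
  by (simp_all add: ev_letter_def rho_def)

lemma ev_rho_Cons: "ev SL2 rho (l # w) = ev_letter l \<otimes>\<^bsub>SL2\<^esub> ev SL2 rho w"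
  by (cases l) (simp add: ev_Cons ev_letter_def)

subsection \<open>Ping-pong\<close>

fun act :: "mat2 \<Rightarrow> int \<times> int \<Rightarrow> int \<times> int" where
  "act (x, y, z, w) (p, q) = (x * p + y * q, z * p + w * q)"

text \<open>
  The slopes \<open>p / q\<close> of the four regions fill the intervals between the consecutive points
  \<open>\<infinity>, -1, -1/2, 0\<close>, the vertices of an ideal quadrilateral whose sides are paired by
  the two matrices.
\<close>

fun region :: "bool \<times> bool \<Rightarrow> int \<times> int \<Rightarrow> bool" where
  "region (True, True) (p, q) \<longleftrightarrow> (q > 0 \<and> p < - q) \<or> (q < 0 \<and> p > - q)"
| "region (True, False) (p, q) \<longleftrightarrow> (p < 0 \<and> - q < 2 * p) \<or> (p > 0 \<and> 2 * p < - q)"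
| "region (False, True) (p, q) \<longleftrightarrow> (p > 0 \<and> q > 0) \<or> (p < 0 \<and> q < 0)"
| "region (False, False) (p, q) \<longleftrightarrow> (q > 0 \<and> - q < p \<and> 2 * p < - q) \<or> (q < 0 \<and> p < - q \<and> - q < 2 * p)"

text \<open>Ping-pong: a letter expands the interval of its inverse over the complement of its own,
  so the other three intervals are pressed into its own.\<close>

lemma region_step: "region m v \<Longrightarrow> m \<noteq> inv_letter l \<Longrightarrow> region l (act (ev_letter l) v)"
  by (cases l; cases "fst l"; cases "snd l"; cases "(m, v)" rule: region.cases) (auto simp: inv_letter_def)

lemma region_disjoint: "region m v \<Longrightarrow> region l v \<Longrightarrow> m = l"
  by (cases "(m, v)" rule: region.cases; cases "(l, v)" rule: region.cases) auto

lemma region_nonempty: "\<exists>v. region l v"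
proof -
  have "region (True, True) (-2, 1)" "region (True, False) (-1, 4)"
    "region (False, True) (1, 1)" "region (False, False) (-3, 4)"
    by simp_all
  then show ?thesis by (metis prod.exhaust)
qed

lemma act_mult: "act (A \<otimes>\<^bsub>SL2\<^esub> B) v = act A (act B v)"
  by (cases A; cases B; cases v) (simp add: algebra_simps)

lemma region_word:
  assumes "w \<in> reduced_words UNIV" "w \<noteq> []" "region m v" "m \<noteq> inv_letter (last w)"
  shows "region (hd w) (act (ev SL2 rho w) v)"
  using assms
proof (induction w)
  case (Cons l w)
  show ?case
  proof (cases "w = []")
    case True
    have "ev_letter l \<otimes>\<^bsub>SL2\<^esub> \<one>\<^bsub>SL2\<^esub> = ev_letter l"
      by (cases "ev_letter l") simp
    with True Cons.prems show ?thesis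
      by (simp add: ev_rho_Cons region_step del: SL2_one)
  next
    case False
    with Cons have "region (hd w) (act (ev SL2 rho w) v)" "hd w \<noteq> inv_letter l"
      by (auto simp: reduced_words_Cons)
    then show ?thesis
      by (simp add: ev_rho_Cons act_mult region_step)
  qed
qed simp

lemma reduced_word_nontrivial:
  assumes "w \<in> reduced_words UNIV" "w \<noteq> []"
  shows "ev SL2 rho w \<noteq> \<one>\<^bsub>SL2\<^esub>"
proof
  assume triv: "ev SL2 rho w = \<one>\<^bsub>SL2\<^esub>"
  \<comment> \<open>The starting region must differ from that of the inverse of the last letter, for
    the ping-pong to begin, and from that of the first letter, for it to end elsewhere.\<close>
  have "\<exists>m. m \<noteq> l \<and> m \<noteq> l'" for l l' :: "bool \<times> bool"
  proof -
    have "(True, True) \<noteq> (True, False)" "(True, True) \<noteq> (False, True)" "(True, False) \<noteq> (False, True)" by auto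
    then show ?thesis by metis
  qed
  then obtain m where m: "m \<noteq> inv_letter (last w)" "m \<noteq> hd w" by blast
  obtain v where v: "region m v" using region_nonempty by blast
  have "act (ev SL2 rho w) v = v" by (cases v) (simp add: triv)
  with region_word[OF assms v m(1)] have "region (hd w) v" by simp
  with v m(2) region_disjoint show False by blast
qed

lemma trivial_word_reduces:
  "ev SL2 rho w = \<one>\<^bsub>SL2\<^esub> \<Longrightarrow> reduce w = []"
  using reduced_word_nontrivial[of "reduce w"] reduce_reduced[of w UNIV]
  by (auto simp: SL2.ev_reduce)

text \<open>The universal property of the matrices as a free group, in terms of words: a word with
  trivial matrix reduces to the empty word, and free reduction keeps the value in every
  group.\<close>

lemma (in group) ev_eq_of_rho_eq:
  assumes "ev SL2 rho v = ev SL2 rho w" "\<And>g. f g \<in> carrier G"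
  shows "ev G f v = ev G f w"
proof -
  have "ev SL2 rho (v @ inv_word w) = \<one>\<^bsub>SL2\<^esub>"
    by (simp add: SL2.ev_append SL2.ev_inv_word assms(1) del: SL2_one)
  then have "ev G f (v @ inv_word w) = \<one>"
    using ev_reduce[of f "v @ inv_word w"] assms(2) by (simp add: trivial_word_reduces)
  then show ?thesis
    using assms(2) inv_equality[of "ev G f v" "inv (ev G f w)"] by (simp add: ev_append ev_inv_word)
qed

subsection \<open>Powers of the commutator\<close>

definition comm_word :: "(bool \<times> bool) list" where
  "comm_word = [(True, True), (False, True), (True, False), (False, False)]"

definition word_pow :: "('s \<times> bool) list \<Rightarrow> int \<Rightarrow> ('s \<times> bool) list" where
  "word_pow w j = concat (replicate (nat \<bar>j\<bar>) (if j \<ge> 0 then w else inv_word w))"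

lemma (in group) ev_word_pow:
  assumes f: "\<And>s. f s \<in> carrier G"
  shows "ev G f (word_pow w j) = ev G f w [^] j"
proof -
  have *: "ev G f (concat (replicate n v)) = ev G f v [^] n" for n v
  proof (induction n)
    case (Suc n)
    then have "ev G f (concat (replicate (Suc n) v)) = ev G f v \<otimes> ev G f v [^] n"
      using f by (simp add: ev_append)
    also have "\<dots> = ev G f v [^] Suc n"
      using f by (metis nat_pow_Suc2 ev_closed)
    finally show ?case .
  qed simp
  show ?thesis
  proof (cases "j \<ge> 0")
    case True
    then show ?thesis by (simp only: word_pow_def * int_pow_def2) simp
  next
    case False
    have "ev G f (word_pow w j) = inv (ev G f w) [^] nat (- j)"
    proof -
      have "nat \<bar>j\<bar> = nat (- j)" using False by simp
      then show ?thesis by (simp only: word_pow_def False if_False * ev_inv_word[of f, OF f])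
    qed
    also have "\<dots> = inv (ev G f w [^] nat (- j))"
      by (rule nat_pow_inv) (simp add: f)
    finally show ?thesis using False by (simp only: int_pow_def2 not_le if_True)
  qed
qed

abbreviation "comm_matrix \<equiv> (- 1, 6, 0, - 1) :: mat2"

lemma ev_comm_word: "ev SL2 rho comm_word = comm_matrix"
  by (simp add: comm_word_def ev_rho_Cons)

lemma comm_matrix_pow: "comm_matrix [^]\<^bsub>SL2\<^esub> (j::int) = (if even j then (1, - 6 * j, 0, 1) else (- 1, 6 * j, 0, - 1))"
proof -
  have *: "comm_matrix [^]\<^bsub>SL2\<^esub> (n::nat) = (if even n then (1, - 6 * int n, 0, 1) else (- 1, 6 * int n, 0, - 1))" for n
    by (induction n) (auto simp: algebra_simps)
  show ?thesis
  proof (cases "j \<ge> 0")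
    case True
    then obtain n where "j = int n" by (metis nonneg_int_cases)
    then show ?thesis by (simp add: int_pow_int *)
  next
    case False
    then have "j = - int (nat (- j))" by simp
    then obtain n where "j = - int n" ..
    then show ?thesis by (simp add: SL2.int_pow_neg_int *)
  qed
qed

text \<open>The groups generated by the two matrices modulo 3 and modulo 4.\<close>

definition K3 :: "mat2 set" where
  "K3 = {(0, 1, 2, 0), (0, 2, 1, 0), (1, 0, 0, 1), (1, 1, 1, 2), (1, 2, 2, 2), (2, 0, 0, 2), (2, 1, 1, 1), (2, 2, 2, 1)}"

definition K4 :: "mat2 set" where
  "K4 = {(0, 1, 3, 3), (0, 3, 1, 3), (1, 0, 0, 1), (1, 1, 1, 2), (1, 2, 2, 1), (1, 3, 3, 2),
    (2, 1, 1, 1), (2, 3, 3, 1), (3, 0, 2, 3), (3, 1, 3, 0), (3, 2, 0, 3), (3, 3, 1, 0)}"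

fun red :: "int \<Rightarrow> mat2 \<Rightarrow> mat2" where
  "red m (x, y, z, w) = (x mod m, y mod m, z mod m, w mod m)"

lemma red_mult: "red m (A \<otimes>\<^bsub>SL2\<^esub> B) = red m (A \<otimes>\<^bsub>SL2\<^esub> red m B)"
proof -
  have "(a * b + c * d) mod m = (a * (b mod m) + c * (d mod m)) mod m" for a b c d
    by (metis mod_add_eq mod_mult_right_eq)
  then show ?thesis by (cases A; cases B) simp
qed

lemma red_ev: "red 3 (ev SL2 rho w) \<in> K3 \<and> red 4 (ev SL2 rho w) \<in> K4"
proof (induction w)
  case Nil
  then show ?case by (simp add: K3_def K4_def)
next
  case (Cons l w)
  have "red 3 (ev_letter l \<otimes>\<^bsub>SL2\<^esub> B) \<in> K3" if "B \<in> K3" for B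
    using that unfolding K3_def by (cases l; cases "fst l"; cases "snd l") auto
  moreover have "red 4 (ev_letter l \<otimes>\<^bsub>SL2\<^esub> B) \<in> K4" if "B \<in> K4" for B
    using that unfolding K4_def by (cases l; cases "fst l"; cases "snd l") auto
  ultimately show ?case
    using Cons unfolding ev_rho_Cons by (subst (1 2) red_mult) blast
qed

definition entry21 :: "mat2 \<Rightarrow> int" where
  "entry21 A = fst (snd (snd A))"

text \<open>The determinant leaves the diagonals 1, 1 and -1, -1. The congruences modulo 3 and 4
  make the corner entry divisible by 12 in the first case and congruent to 6 modulo 12 in the
  second. These are exactly the even and the odd powers of the commutator.\<close>

lemma upper_triangular_is_power:
  assumes "entry21 (ev SL2 rho w) = 0"
  shows "\<exists>j. ev SL2 rho w = ev SL2 rho (word_pow comm_word j)"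
proof -
  obtain x y z t where A: "ev SL2 rho w = (x, y, z, t)" by (cases "ev SL2 rho w")
  have z: "z = 0" using assms A by (simp add: entry21_def)
  have "ev SL2 rho w \<in> carrier SL2" by (simp add: SL2.ev_closed)
  then have "x * t = 1" using A z by simp
  then have xt: "(x = 1 \<and> t = 1) \<or> (x = - 1 \<and> t = - 1)"
    by (metis zmult_eq_1_iff)
  have r3: "red 3 (x, y, 0, t) \<in> K3" and r4: "red 4 (x, y, 0, t) \<in> K4"
    using red_ev[of w] A z by simp_all
  have "\<exists>j::int. (x, y, 0, t) = comm_matrix [^]\<^bsub>SL2\<^esub> j"
  proof (cases "x = 1")
    case True
    then have "y mod 3 = 0" "y mod 4 = 0" "t = 1" using r3 r4 xt by (auto simp: K3_def K4_def)
    then have "\<exists>i. y = 12 * i" by presburger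
    then obtain i where "y = 12 * i" ..
    then show ?thesis using True \<open>t = 1\<close> by (intro exI[of _ "- 2 * i"]) (simp add: comm_matrix_pow)
  next
    case False
    then have "y mod 3 = 0" "y mod 4 = 2" "x = - 1" "t = - 1"
      using r3 r4 xt by (auto simp: K3_def K4_def)
    then have "\<exists>i. y = 12 * i + 6" by presburger
    then obtain i where "y = 12 * i + 6" ..
    then show ?thesis using \<open>x = - 1\<close> \<open>t = - 1\<close>
      by (intro exI[of _ "2 * i + 1"]) (simp add: comm_matrix_pow)
  qed
  then show ?thesis
    by (simp add: A z SL2.ev_word_pow ev_comm_word)
qed

section \<open>Normal forms over an amalgam\<close>

text \<open>
  The letter \<open>(h, g)\<close> is the generator \<open>g\<close> of the copy \<open>h\<close> of the free group on \<open>bool\<close>.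
\<close>

definition amalgamated :: "('g, 'r) monoid_scheme \<Rightarrow> (bool \<times> bool \<Rightarrow> 'g) \<Rightarrow> bool" where
  "amalgamated K f \<longleftrightarrow> (\<forall>l. f l \<in> carrier K) \<and>
     ev K (\<lambda>g. f (False, g)) comm_word = ev K (\<lambda>g. f (True, g)) comm_word"

fun alt_value :: "('g, 'r) monoid_scheme \<Rightarrow> (bool \<times> bool \<Rightarrow> 'g) \<Rightarrow> bool \<Rightarrow> (bool \<times> bool) list list \<Rightarrow> 'g" where
  "alt_value K f h [] = \<one>\<^bsub>K\<^esub>"
| "alt_value K f h (x # xs) = ev K (\<lambda>g. f (h, g)) x \<otimes>\<^bsub>K\<^esub> alt_value K f (\<not> h) xs"

text \<open>\<open>(j, h, xs)\<close> stands for the \<open>j\<close>-th power of the common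
  commutator times syllables taken alternately from the two copies, the first one from copy
  \<open>h\<close>. Reading the power in the copy \<open>False\<close> is a convention, as the
  commutators agree.\<close>

definition nf_value :: "('g, 'r) monoid_scheme \<Rightarrow> (bool \<times> bool \<Rightarrow> 'g) \<Rightarrow> int \<times> bool \<times> (bool \<times> bool) list list \<Rightarrow> 'g" where
  "nf_value K f = (\<lambda>(j, h, xs). ev K (\<lambda>g. f (False, g)) comm_word [^]\<^bsub>K\<^esub> j \<otimes>\<^bsub>K\<^esub> alt_value K f h xs)"

definition upper_exponent :: "(bool \<times> bool) list \<Rightarrow> int" where
  "upper_exponent y = (SOME j. ev SL2 rho y = ev SL2 rho (word_pow comm_word j))"

text \<open>The new letter absorbs the power in front, which can be read in its copy, and the first
  syllable if that lies in the same copy. An upper triangular result is itself a power of the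
  commutator and becomes the new power; the remaining syllables then start in the other copy and
  stay as they are.\<close>

definition nf_cons :: "(bool \<times> bool) \<times> bool \<Rightarrow> int \<times> bool \<times> (bool \<times> bool) list list \<Rightarrow> int \<times> bool \<times> (bool \<times> bool) list list" where
  "nf_cons = (\<lambda>((h', g), e) (j, h, xs).
     let merge = (xs \<noteq> [] \<and> h = h');
         y = [(g, e)] @ word_pow comm_word j @ (if merge then hd xs else []);
         rest = (if merge then tl xs else xs)
     in if entry21 (ev SL2 rho y) \<noteq> 0 then (0, h', y # rest) else (upper_exponent y, \<not> h', rest))"

definition nf :: "((bool \<times> bool) \<times> bool) list \<Rightarrow> int \<times> bool \<times> (bool \<times> bool) list list" where
  "nf w = foldr nf_cons w (0, True, [])"

lemma upper_exponent:
  "entry21 (ev SL2 rho y) = 0 \<Longrightarrow> ev SL2 rho y = ev SL2 rho (word_pow comm_word (upper_exponent y))"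
  unfolding upper_exponent_def by (rule someI_ex) (rule upper_triangular_is_power)

context group
begin

lemma amalgamated_comm:
  assumes "amalgamated G f"
  shows "ev G (\<lambda>g. f (h, g)) (word_pow comm_word j) = ev G (\<lambda>g. f (False, g)) comm_word [^] j"
  using assms by (cases h) (simp_all add: amalgamated_def ev_word_pow)

lemma alt_value_closed: "amalgamated G f \<Longrightarrow> alt_value G f h xs \<in> carrier G"
  by (induction xs arbitrary: h) (auto simp: amalgamated_def)

text \<open>The decisions of \<open>nf_cons\<close> are taken in the matrices, yet the value is kept
  in every amalgamated group: words with equal matrices have equal values everywhere, and powers of
  the commutator pass from one copy to the other.\<close>

lemma nf_value_cons:
  assumes f: "amalgamated G f"
  shows "nf_value G f (nf_cons l N) = (if snd l then f (fst l) else inv (f (fst l))) \<otimes> nf_value G f N"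
proof -
  obtain h' g e where l: "l = ((h', g), e)" by (metis prod.exhaust)
  obtain j h xs where N: "N = (j, h, xs)" by (metis prod.exhaust)
  define merge where "merge = (xs \<noteq> [] \<and> h = h')"
  define y where "y = [(g, e)] @ word_pow comm_word j @ (if merge then hd xs else [])"
  define rest where "rest = (if merge then tl xs else xs)"
  let ?f = "\<lambda>g. f (h', g)" and ?z = "ev G (\<lambda>g. f (False, g)) comm_word"
  have fc [simp]: "f p \<in> carrier G" for p using f by (cases p) (simp add: amalgamated_def)
  note [simp] = alt_value_closed[OF f]
  have rest_value: "alt_value G f h xs = (if merge then ev G ?f (hd xs) else \<one>) \<otimes> alt_value G f (\<not> h') rest"
  proof (cases merge)
    case True
    then show ?thesis by (cases xs) (auto simp: merge_def rest_def)
  next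
    case False
    then have "alt_value G f h xs = alt_value G f (\<not> h') rest"
      by (cases xs) (auto simp: merge_def rest_def)
    then show ?thesis using False by simp
  qed
  have "(if e then f (h', g) else inv (f (h', g))) \<otimes> nf_value G f N
      = ev G ?f y \<otimes> alt_value G f (\<not> h') rest"
    unfolding N nf_value_def prod.case rest_value
    by (simp add: y_def ev_Cons ev_append m_assoc amalgamated_comm[OF f])
  also have "\<dots> = nf_value G f (nf_cons l N)"
  proof (cases "entry21 (ev SL2 rho y) = 0")
    case True
    then have "nf_cons l N = (upper_exponent y, \<not> h', rest)"
      by (simp add: nf_cons_def l N y_def rest_def merge_def Let_def)
    moreover have "ev G ?f y = ?z [^] upper_exponent y"
      using ev_eq_of_rho_eq[OF upper_exponent[OF True], of ?f] by (simp add: amalgamated_comm[OF f])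
    ultimately show ?thesis by (simp add: nf_value_def)
  next
    case False
    then have "nf_cons l N = (0, h', y # rest)"
      by (simp add: nf_cons_def l N y_def rest_def merge_def Let_def)
    then show ?thesis by (simp add: nf_value_def)
  qed
  finally show ?thesis by (simp only: l fst_conv snd_conv)
qed

lemma nf_value:
  assumes "amalgamated G f"
  shows "nf_value G f (nf w) = ev G f w"
proof (induction w)
  case Nil
  then show ?case using assms by (simp add: nf_def nf_value_def)
next
  case (Cons l w)
  have "nf (l # w) = nf_cons l (nf w)" by (simp add: nf_def)
  with Cons nf_value_cons[OF assms] show ?case by (cases l) (simp add: ev_Cons)
qed

end

lemma nf_syllables:
  "nf w = (j, h, xs) \<Longrightarrow> x \<in> set xs \<Longrightarrow> entry21 (ev SL2 rho x) \<noteq> 0"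
proof (induction w arbitrary: j h xs)
  case (Cons l w)
  obtain h' g e where l: "l = ((h', g), e)" by (metis prod.exhaust)
  obtain j' h'' ys where N: "nf w = (j', h'', ys)" by (metis prod.exhaust)
  have "nf (l # w) = nf_cons l (nf w)" by (simp add: nf_def)
  with Cons.prems have "(j, h, xs) = nf_cons l (j', h'', ys)" by (simp add: N)
  then have "entry21 (ev SL2 rho x) \<noteq> 0 \<or> x \<in> set ys"
    using Cons.prems(2) unfolding nf_cons_def l
    by (auto simp: Let_def split: if_splits dest: list.set_sel(2))
  with Cons.IH[OF N] show ?case by blast
qed (simp add: nf_def)

subsection \<open>Conjugating one factor by powers of the commutator\<close>

definition twist :: "('g, 'r) monoid_scheme \<Rightarrow> 'g \<Rightarrow> (bool \<Rightarrow> 'g) \<Rightarrow> bool \<times> bool \<Rightarrow> 'g" where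
  "twist K t f = (\<lambda>(h, g). if h then t \<otimes>\<^bsub>K\<^esub> f g \<otimes>\<^bsub>K\<^esub> inv\<^bsub>K\<^esub> t else f g)"

context group
begin

lemma hom_conj:
  assumes "t \<in> carrier G"
  shows "(\<lambda>x. t \<otimes> x \<otimes> inv t) \<in> hom G G"
proof (rule homI)
  fix x y assume xy: "x \<in> carrier G" "y \<in> carrier G"
  have "t \<otimes> x \<otimes> inv t \<otimes> (t \<otimes> y \<otimes> inv t) = t \<otimes> x \<otimes> (inv t \<otimes> t) \<otimes> y \<otimes> inv t"
    using xy assms by (simp only: m_assoc m_closed inv_closed)
  then show "t \<otimes> (x \<otimes> y) \<otimes> inv t = t \<otimes> x \<otimes> inv t \<otimes> (t \<otimes> y \<otimes> inv t)"
    using xy assms by (simp add: m_assoc)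
qed (use assms in simp)

lemma ev_twist:
  assumes "t \<in> carrier G" "\<And>g. f g \<in> carrier G"
  shows "ev G (\<lambda>g. twist G t f (True, g)) w = t \<otimes> ev G f w \<otimes> inv t"
    "ev G (\<lambda>g. twist G t f (False, g)) w = ev G f w"
  using hom_ev[OF is_group is_group hom_conj[OF assms(1)], of f w] assms(2)
  by (simp_all add: twist_def)

lemma amalgamated_twist:
  assumes t: "t \<in> carrier G" and f: "\<And>g. f g \<in> carrier G"
    and c: "t \<otimes> ev G f comm_word = ev G f comm_word \<otimes> t"
  shows "amalgamated G (twist G t f)"
proof -
  have "t \<otimes> ev G f comm_word \<otimes> inv t = ev G f comm_word"
    using t f by (simp add: c m_assoc)
  then show ?thesis
    using t f by (auto simp: amalgamated_def ev_twist) (simp add: twist_def)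
qed

end

text \<open>When the conjugator is a power of the commutator, the twisted generators are words in
  the original ones and twisting becomes a substitution. This is what lets faithfulness of the two
  generators apply.\<close>

definition untwist :: "int \<Rightarrow> ((bool \<times> bool) \<times> bool) list \<Rightarrow> (bool \<times> bool) list" where
  "untwist n w = concat (map (\<lambda>((h, g), e).
     if h then word_pow comm_word n @ [(g, e)] @ word_pow comm_word (- n) else [(g, e)]) w)"

lemma (in group) ev_untwist:
  assumes f: "\<And>g. f g \<in> carrier G"
  shows "ev G f (untwist n w) = ev G (twist G (ev G f comm_word [^] n) f) w"
proof (induction w)
  case Nil
  then show ?case by (simp add: untwist_def)
next
  case (Cons l w)
  obtain h g e where l: "l = ((h, g), e)" by (metis prod.exhaust)
  let ?u = "ev G f comm_word"
  have "ev G f (untwist n (l # w)) =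
      ev G f (if h then word_pow comm_word n @ [(g, e)] @ word_pow comm_word (- n) else [(g, e)])
      \<otimes> ev G f (untwist n w)"
    using f by (simp add: untwist_def l ev_append)
  also have "ev G f (if h then word_pow comm_word n @ [(g, e)] @ word_pow comm_word (- n) else [(g, e)])
      = (if e then twist G (?u [^] n) f (h, g) else inv (twist G (?u [^] n) f (h, g)))"
    using f by (simp add: ev_append ev_word_pow ev_Cons twist_def int_pow_neg inv_mult_group m_assoc)
  finally show ?case
    by (simp add: Cons l ev_Cons)
qed

section \<open>Baumslag's lemma in the matrix group\<close>

lemma amalgamated_rho: "amalgamated SL2 (twist SL2 (comm_matrix [^]\<^bsub>SL2\<^esub> (n::int)) rho)"
proof (rule SL2.amalgamated_twist)
  have "comm_matrix \<in> carrier SL2" by simp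
  then show "comm_matrix [^]\<^bsub>SL2\<^esub> n \<in> carrier SL2" by (rule SL2.int_pow_closed)
  show "comm_matrix [^]\<^bsub>SL2\<^esub> n \<otimes>\<^bsub>SL2\<^esub> ev SL2 rho comm_word = ev SL2 rho comm_word \<otimes>\<^bsub>SL2\<^esub> comm_matrix [^]\<^bsub>SL2\<^esub> n"
    by (simp add: ev_comm_word comm_matrix_pow)
qed simp

text \<open>
  The first column of an alternating product, after the conjugating power in front has been
  removed, is a vector of polynomials in \<open>n\<close>; each syllable multiplies the leading coefficient of
  the lower one by the lower left entry of the syllable and by \<open>\<plusminus>6\<close>.
\<close>

lemma alt_value_column:
  assumes "xs \<noteq> []" "\<And>x. x \<in> set xs \<Longrightarrow> entry21 (ev SL2 rho x) \<noteq> 0"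
  shows "\<exists>p q :: int poly. q \<noteq> 0 \<and> degree p \<le> degree q \<and>
     (\<forall>n. \<exists>r s. alt_value SL2 (twist SL2 (comm_matrix [^]\<^bsub>SL2\<^esub> n) rho) h xs =
       (if h then (1, - 6 * n, 0, 1) else (1, 0, 0, 1)) \<otimes>\<^bsub>SL2\<^esub> (poly p n, r, poly q n, s))"
  using assms
proof (induction xs arbitrary: h)
  case (Cons x xs)
  obtain a b c d where x: "ev SL2 rho x = (a, b, c, d)" by (metis prod.exhaust)
  have c: "c \<noteq> 0" using Cons.prems x by (force simp: entry21_def)
  have comm_matrix: "comm_matrix [^]\<^bsub>SL2\<^esub> n \<in> carrier SL2" for n :: int
    by (rule SL2.int_pow_closed) simp
  \<comment> \<open>The sign of the power of the commutator matrix is central and drops out of the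
    conjugation, leaving unipotent factors.\<close>
  have xn: "ev SL2 (\<lambda>g. twist SL2 (comm_matrix [^]\<^bsub>SL2\<^esub> n) rho (h, g)) x =
      (if h then (1, - 6 * n, 0, 1) else (1, 0, 0, 1)) \<otimes>\<^bsub>SL2\<^esub> (a, b, c, d) \<otimes>\<^bsub>SL2\<^esub>
      (if h then (1, 6 * n, 0, 1) else (1, 0, 0, 1))" for n :: int
  proof -
    have "ev SL2 (\<lambda>g. twist SL2 (comm_matrix [^]\<^bsub>SL2\<^esub> n) rho (h, g)) x =
        (if h then comm_matrix [^]\<^bsub>SL2\<^esub> n \<otimes>\<^bsub>SL2\<^esub> (a, b, c, d) \<otimes>\<^bsub>SL2\<^esub> inv\<^bsub>SL2\<^esub> (comm_matrix [^]\<^bsub>SL2\<^esub> n) else (a, b, c, d))"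
      using SL2.ev_twist[OF comm_matrix rho_carrier, where w = x] by (cases h) (simp_all only: x if_True if_False)
    then show ?thesis by (simp add: comm_matrix_pow algebra_simps)
  qed
  show ?case
  proof (cases "xs = []")
    case True
    have "\<exists>r s. alt_value SL2 (twist SL2 (comm_matrix [^]\<^bsub>SL2\<^esub> n) rho) h (x # xs) =
       (if h then (1, - 6 * n, 0, 1) else (1, 0, 0, 1)) \<otimes>\<^bsub>SL2\<^esub> (poly [:a:] n, r, poly [:c:] n, s)" for n
      unfolding True alt_value.simps xn by (cases h) (auto simp: algebra_simps)
    moreover have "[:c:] \<noteq> 0" "degree [:a:] \<le> degree [:c:]" using c by auto
    ultimately show ?thesis by blast
  next
    case False
    then obtain p q where q: "q \<noteq> 0" "degree p \<le> degree q" and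
      pq: "\<And>n. \<exists>r s. alt_value SL2 (twist SL2 (comm_matrix [^]\<^bsub>SL2\<^esub> n) rho) (\<not> h) xs =
       (if \<not> h then (1, - 6 * n, 0, 1) else (1, 0, 0, 1)) \<otimes>\<^bsub>SL2\<^esub> (poly p n, r, poly q n, s)"
      using Cons.IH[of "\<not> h"] Cons.prems(2) by auto
    \<comment> \<open>Between syllables of different copies exactly one unipotent factor survives:
      the closing \<open>(1, 6 * n, 0, 1)\<close> of a syllable of copy \<open>True\<close>, or the
      opening \<open>(1, - 6 * n, 0, 1)\<close> of the next one.\<close>
    define k where "k = (if h then [:0, 6:] else [:0, - 6:] :: int poly)"
    define p' where "p' = p + k * q"
    define P where "P = smult a p' + smult b q"
    define Q where "Q = smult c p' + smult d q"
    have "degree (k * q) = Suc (degree q)"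
      using q by (simp add: k_def degree_mult_eq)
    then have p': "degree p' = Suc (degree q)"
      unfolding p'_def using q by (subst degree_add_eq_right) auto
    have "degree (smult d q) < degree (smult c p')"
      using c p' degree_smult_le[of d q] by simp
    then have Q: "degree Q = Suc (degree q)"
      unfolding Q_def using c p' by (subst degree_add_eq_left) auto
    have "degree P \<le> degree Q"
      unfolding P_def Q using p' degree_smult_le[of a p'] degree_smult_le[of b q]
      by (intro degree_add_le) auto
    moreover have "Q \<noteq> 0" using Q by auto
    moreover have "\<exists>r s. alt_value SL2 (twist SL2 (comm_matrix [^]\<^bsub>SL2\<^esub> n) rho) h (x # xs) =
       (if h then (1, - 6 * n, 0, 1) else (1, 0, 0, 1)) \<otimes>\<^bsub>SL2\<^esub> (poly P n, r, poly Q n, s)" for n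
    proof -
      obtain r s where rs: "alt_value SL2 (twist SL2 (comm_matrix [^]\<^bsub>SL2\<^esub> n) rho) (\<not> h) xs =
       (if \<not> h then (1, - 6 * n, 0, 1) else (1, 0, 0, 1)) \<otimes>\<^bsub>SL2\<^esub> (poly p n, r, poly q n, s)"
        using pq by blast
      \<comment> \<open>The second column is free, so the equation for its upper entry is solved by
        subtraction.\<close>
      have [simp]: "\<exists>r. v = r + w" for v w :: int by (metis diff_add_cancel)
      show ?thesis
        unfolding alt_value.simps xn rs
        by (cases h) (auto simp: P_def Q_def p'_def k_def algebra_simps)
    qed
    ultimately show ?thesis by blast
  qed
qed simp

text \<open>The factors in front of the column are upper triangular with diagonal entries
  \<plusminus>1. Hence the lower left entry of the whole word is
  \<plusminus>\<open>poly q n\<close>, and a trivial word makes \<open>n\<close> a root.\<close>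

lemma finite_trivial_twists:
  assumes "nf w = (j, h, xs)" "xs \<noteq> []"
  shows "finite {n. ev SL2 (twist SL2 (comm_matrix [^]\<^bsub>SL2\<^esub> (n::int)) rho) w = \<one>\<^bsub>SL2\<^esub>}"
proof -
  obtain p q :: "int poly" where q: "q \<noteq> 0" and
    pq: "\<And>n. \<exists>r s. alt_value SL2 (twist SL2 (comm_matrix [^]\<^bsub>SL2\<^esub> n) rho) h xs =
       (if h then (1, - 6 * n, 0, 1) else (1, 0, 0, 1)) \<otimes>\<^bsub>SL2\<^esub> (poly p n, r, poly q n, s)"
    using alt_value_column[OF assms(2) nf_syllables[OF assms(1)]] by metis
  have "poly q n = 0" if "ev SL2 (twist SL2 (comm_matrix [^]\<^bsub>SL2\<^esub> n) rho) w = \<one>\<^bsub>SL2\<^esub>" for n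
  proof -
    obtain r s where rs: "alt_value SL2 (twist SL2 (comm_matrix [^]\<^bsub>SL2\<^esub> n) rho) h xs =
       (if h then (1, - 6 * n, 0, 1) else (1, 0, 0, 1)) \<otimes>\<^bsub>SL2\<^esub> (poly p n, r, poly q n, s)"
      using pq by blast
    have "ev SL2 (\<lambda>g. twist SL2 (comm_matrix [^]\<^bsub>SL2\<^esub> n) rho (False, g)) comm_word = comm_matrix"
      by (simp add: twist_def ev_comm_word)
    then have "comm_matrix [^]\<^bsub>SL2\<^esub> j \<otimes>\<^bsub>SL2\<^esub> alt_value SL2 (twist SL2 (comm_matrix [^]\<^bsub>SL2\<^esub> n) rho) h xs = \<one>\<^bsub>SL2\<^esub>"
      using SL2.nf_value[OF amalgamated_rho[of n], of w] assms(1) that by (simp add: nf_value_def)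
    then show ?thesis
      unfolding rs by (auto simp: comm_matrix_pow split: if_splits)
  qed
  then show ?thesis
    using poly_roots_finite[OF q] by (simp add: Collect_mono rev_finite_subset)
qed

text \<open>Baumslag's lemma. A word without syllables is a power of the commutator; being
  nontrivial in \<open>G\<close> it has nonzero exponent, and no twist kills it in the matrices.
  With syllables, only roots of a nonzero polynomial can kill it.\<close>

lemma (in group) trivial_or_finite_twists:
  assumes "amalgamated G f" "ev G f w \<noteq> \<one>"
  shows "finite {n. ev SL2 (twist SL2 (comm_matrix [^]\<^bsub>SL2\<^esub> (n::int)) rho) w = \<one>\<^bsub>SL2\<^esub>}"
proof -
  obtain j h xs where N: "nf w = (j, h, xs)" by (metis prod.exhaust)
  show ?thesis
  proof (cases "xs = []")
    case True
    have "j \<noteq> 0"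
      using nf_value[OF assms(1), of w] assms N True by (auto simp: nf_value_def)
    moreover have "ev SL2 (twist SL2 (comm_matrix [^]\<^bsub>SL2\<^esub> n) rho) w = comm_matrix [^]\<^bsub>SL2\<^esub> j" for n :: int
      using SL2.nf_value[OF amalgamated_rho[of n], of w] N True
      by (auto simp: nf_value_def twist_def ev_comm_word comm_matrix_pow)
    ultimately have "{n. ev SL2 (twist SL2 (comm_matrix [^]\<^bsub>SL2\<^esub> (n::int)) rho) w = \<one>\<^bsub>SL2\<^esub>} = {}"
      by (auto simp: comm_matrix_pow)
    then show ?thesis by (metis finite.emptyI)
  next
    case False
    then show ?thesis using finite_trivial_twists N by blast
  qed
qed

section \<open>Generic conjugators in a compact group\<close>

context topological_group
begin

lemma carrier_topspace [simp]: "topspace T = carrier G"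
  by (rule topspace_eq)

lemma continuous_mult_fun:
  assumes "continuous_map X T f" "continuous_map X T g"
  shows "continuous_map X T (\<lambda>x. f x \<otimes> g x)"
  using continuous_map_compose[OF _ continuous_mult, of X "\<lambda>x. (f x, g x)"] assms
  by (simp add: continuous_map_paired o_def)

lemma continuous_inv_fun: "continuous_map X T f \<Longrightarrow> continuous_map X T (\<lambda>x. inv (f x))"
  using continuous_map_compose[OF _ continuous_inv, of X f] by (simp add: o_def)

lemma continuous_const_fun: "c \<in> carrier G \<Longrightarrow> continuous_map X T (\<lambda>x. c)"
  by simp

lemma continuous_ev_twist:
  assumes "\<And>g. f g \<in> carrier G"
  shows "continuous_map T T (\<lambda>t. ev G (twist G t f) w)"
proof (induction w)
  case Nil
  then show ?case by simp
next
  case (Cons l w)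
  obtain h g e where l: "l = ((h, g), e)" by (metis prod.exhaust)
  have id: "continuous_map T T (\<lambda>t. t)"
    using continuous_map_id[of T] by (simp add: id_def)
  have "continuous_map T T (\<lambda>t. twist G t f (h, g))"
    using assms by (cases h)
      (auto simp: twist_def intro!: continuous_mult_fun continuous_inv_fun continuous_const_fun id)
  then show ?case
    unfolding l ev_Cons using Cons
    by (cases e) (auto intro!: continuous_mult_fun continuous_inv_fun)
qed

lemma closedin_singleton: "x \<in> carrier G \<Longrightarrow> closedin T {x}"
  using hausdorff by (simp add: closedin_Hausdorff_sing_eq)

end

context compact_group
begin

text \<open>
  Two distinct powers close to an accumulation point have a quotient close to \<open>\<one>\<close>.
\<close>

lemma power_close_to_one:
  assumes u: "u \<in> carrier G" "inj (\<lambda>n::int. u [^] n)" and V0: "openin T V0" "\<one> \<in> V0"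
  shows "\<exists>n::int. n \<noteq> 0 \<and> u [^] n \<in> V0"
proof -
  have "infinite (range (\<lambda>n::int. u [^] n))"
    using u(2) by (simp add: finite_image_iff)
  moreover have "range (\<lambda>n::int. u [^] n) \<subseteq> topspace T"
    using u(1) by (auto simp: int_pow_closed)
  ultimately obtain y where y: "y \<in> T derived_set_of (range (\<lambda>n::int. u [^] n))"
    using compact_space_imp_Bolzano_Weierstrass[OF compact] by blast
  then have yG: "y \<in> carrier G" by (simp add: in_derived_set_of)
  have "continuous_map (prod_topology T T) T (\<lambda>z. fst z \<otimes> inv (snd z))"
    by (intro continuous_mult_fun continuous_inv_fun continuous_map_fst continuous_map_snd)
  then have "openin (prod_topology T T) {z \<in> topspace (prod_topology T T). fst z \<otimes> inv (snd z) \<in> V0}"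
    using V0(1) by (rule openin_continuous_map_preimage)
  moreover have "(y, y) \<in> {z \<in> topspace (prod_topology T T). fst z \<otimes> inv (snd z) \<in> V0}"
    using yG V0(2) by simp
  ultimately obtain A B where AB: "openin T A" "openin T B" "y \<in> A" "y \<in> B"
    "A \<times> B \<subseteq> {z \<in> topspace (prod_topology T T). fst z \<otimes> inv (snd z) \<in> V0}"
    unfolding openin_prod_topology_alt by meson
  have AB': "openin T (A \<inter> B)" "y \<in> A \<inter> B" using AB by auto
  have near: "\<exists>i::int. u [^] i \<in> W \<and> u [^] i \<noteq> y" if "openin T W" "y \<in> W" for W
    using y that unfolding in_derived_set_of by auto
  obtain i :: int where i: "u [^] i \<in> A \<inter> B" "u [^] i \<noteq> y"
    using near[OF AB'] by blast
  have "openin T (A \<inter> B - {u [^] i})"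
    using AB' closedin_singleton u(1) by (intro openin_diff) (simp_all add: int_pow_closed)
  then obtain j :: int where j: "u [^] j \<in> A \<inter> B - {u [^] i}"
    using near AB'(2) i(2) by (metis DiffI singletonD)
  have "u [^] i \<otimes> inv (u [^] j) \<in> V0" using AB(5) i j by auto
  moreover have "u [^] i \<otimes> inv (u [^] j) = u [^] (i - j)"
    using u(1) by (simp add: int_pow_diff)
  moreover have "i - j \<noteq> 0" using j by auto
  ultimately show ?thesis by metis
qed

text \<open>Were there only finitely many, discarding all but the \<open>k\<close>-th and
  translating by its inverse would leave a neighbourhood of \<one> without any other power of
  \<open>u\<close>.\<close>

lemma infinite_powers_in_open:
  assumes u: "u \<in> carrier G" "inj (\<lambda>n::int. u [^] n)" and V0: "openin T V0" "u [^] (k::int) \<in> V0"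
  shows "infinite {n::int. u [^] n \<in> V0}"
proof
  let ?J = "{n::int. u [^] n \<in> V0} - {k}"
  assume fin: "finite {n::int. u [^] n \<in> V0}"
  have P: "u [^] (n::int) \<in> carrier G" for n using u(1) by simp
  note [simp] = u(1)
  have "closedin T ((\<lambda>n. u [^] n) ` ?J)"
    using fin by (intro closedin_Hausdorff_finite[OF hausdorff]) auto
  then have "openin T (V0 - (\<lambda>n. u [^] n) ` ?J)" using V0(1) by (rule openin_diff[rotated])
  moreover have "continuous_map T T (\<lambda>x. u [^] k \<otimes> x)"
    using continuous_map_id[of T] by (intro continuous_mult_fun) (simp_all add: id_def)
  ultimately have op: "openin T {x \<in> topspace T. u [^] k \<otimes> x \<in> V0 - (\<lambda>n. u [^] n) ` ?J}"
    by (rule openin_continuous_map_preimage[rotated])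
  have "u [^] k \<notin> (\<lambda>n. u [^] n) ` ?J"
    using u(2) by (auto dest: injD)
  then have one: "\<one> \<in> {x \<in> topspace T. u [^] k \<otimes> x \<in> V0 - (\<lambda>n. u [^] n) ` ?J}"
    using V0(2) by simp
  obtain n :: int where n: "n \<noteq> 0" "u [^] k \<otimes> u [^] n \<in> V0 - (\<lambda>n. u [^] n) ` ?J"
    using power_close_to_one[OF u op one] by blast
  then have "u [^] (k + n) \<in> V0 - (\<lambda>n. u [^] n) ` ?J"
    using u(1) by (simp add: int_pow_mult)
  with n(1) show False by auto
qed

text \<open>\<open>K\<close>, later the fundamental group, only supplies the words that must stay
  nontrivial. The search is confined to the closure of the powers of \<open>u\<close>, rather than
  to the centraliser, because there an open set can be tested on powers.\<close>

lemma generic_conjugator: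
  fixes K :: "('k, 'r) monoid_scheme"
  assumes f: "\<And>g. f g \<in> carrier G"
    and faithful: "\<And>w. ev G f w = \<one> \<Longrightarrow> ev SL2 rho w = \<one>\<^bsub>SL2\<^esub>"
    and K: "group K" "amalgamated K F"
  shows "\<exists>t\<in>carrier G. amalgamated G (twist G t f) \<and>
    (\<forall>w. ev G (twist G t f) w = \<one> \<longrightarrow> ev K F w = \<one>\<^bsub>K\<^esub>)"
proof -
  define u where "u = ev G f comm_word"
  have u: "u \<in> carrier G" using f by (simp add: u_def)
  have P [simp]: "u [^] (n::int) \<in> carrier G" for n using u by (simp add: int_pow_closed)
  have inj: "inj (\<lambda>n::int. u [^] n)"
  proof (rule injI)
    fix m n :: int assume "u [^] m = u [^] n"
    then have "u [^] (m - n) = \<one>" using u by (simp add: int_pow_diff)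
    then have "ev G f (word_pow comm_word (m - n)) = \<one>"
      using f by (simp add: ev_word_pow u_def)
    then have "comm_matrix [^]\<^bsub>SL2\<^esub> (m - n) = \<one>\<^bsub>SL2\<^esub>"
      using faithful SL2.ev_word_pow[of rho comm_word "m - n"] by (simp add: ev_comm_word)
    then show "m = n" by (auto simp: comm_matrix_pow split: if_splits)
  qed
  define C where "C = T closure_of (range (\<lambda>n::int. u [^] n))"
  define X where "X = subtopology T C"
  have C: "closedin T C" by (simp add: C_def)
  have CG: "C \<subseteq> carrier G" using closedin_subset[OF C] by simp
  have PC: "u [^] (n::int) \<in> C" for n
    unfolding C_def by (rule set_mp[OF closure_of_subset]) auto
  have X: "topspace X = C" using CG by (auto simp: X_def)
  define Z where "Z w = {t \<in> carrier G. ev G (twist G t f) w = \<one>} \<inter> C" for w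
  have "closedin T {t \<in> topspace T. ev G (twist G t f) w = \<one>}" for w
    using hausdorff continuous_ev_twist[OF f] continuous_const_fun[OF one_closed]
    by (rule closedin_continuous_maps_eq)
  then have Z: "closedin X (Z w)" for w
    by (auto simp: X_def closedin_subtopology Z_def)
  have empty: "X interior_of (Z w) = {}" if w: "ev K F w \<noteq> \<one>\<^bsub>K\<^esub>" for w
  proof (rule ccontr)
    assume "X interior_of (Z w) \<noteq> {}"
    then obtain x V where xV: "openin X V" "x \<in> V" "V \<subseteq> Z w" by (auto simp: interior_of_def)
    then obtain V0 where V0: "openin T V0" "V = V0 \<inter> C" by (auto simp: X_def openin_subtopology)
    then have "x \<in> C" "x \<in> V0" using xV by auto
    then obtain k :: int where "u [^] k \<in> V0"
      using V0(1) unfolding C_def in_closure_of by blast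
    then have "infinite {n::int. u [^] n \<in> V0}"
      using infinite_powers_in_open[OF u inj V0(1)] by blast
    \<comment> \<open>At a power of \<open>u\<close> the condition defining \<open>Z w\<close> says
      that a word in the two free generators is trivial, which the matrices decide.\<close>
    moreover have "{n::int. u [^] n \<in> V0} \<subseteq> {n. ev SL2 (twist SL2 (comm_matrix [^]\<^bsub>SL2\<^esub> n) rho) w = \<one>\<^bsub>SL2\<^esub>}"
    proof
      fix n :: int assume "n \<in> {n::int. u [^] n \<in> V0}"
      then have "u [^] n \<in> Z w" using PC V0 xV by blast
      then have "ev G f (untwist n w) = \<one>"
        using f by (simp add: Z_def ev_untwist u_def)
      then have "ev SL2 rho (untwist n w) = \<one>\<^bsub>SL2\<^esub>" by (rule faithful)
      then have "ev SL2 (twist SL2 (comm_matrix [^]\<^bsub>SL2\<^esub> n) rho) w = \<one>\<^bsub>SL2\<^esub>"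
        using SL2.ev_untwist[OF rho_carrier, where n = n and w = w] by (simp only: ev_comm_word)
      then show "n \<in> {n. ev SL2 (twist SL2 (comm_matrix [^]\<^bsub>SL2\<^esub> n) rho) w = \<one>\<^bsub>SL2\<^esub>}" by blast
    qed
    ultimately show False
      using group.trivial_or_finite_twists[OF K w] by (metis finite_subset)
  qed
  have "X interior_of \<Union>(Z ` {w. ev K F w \<noteq> \<one>\<^bsub>K\<^esub>}) = {}"
  proof (rule Baire_category_alt)
    have "compact_space X"
      unfolding X_def using C compact by (simp add: closedin_compact_space compact_space_subtopology)
    then show "completely_metrizable_space X \<or> locally_compact_space X \<and> regular_space X"
      using hausdorff compact_Hausdorff_imp_regular_space[of X]
      by (auto simp: X_def Hausdorff_space_subtopology intro!: compact_imp_locally_compact_space)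
    \<comment> \<open>There are only countably many words, so Baire's theorem handles all of them at
      once.\<close>
    show "countable (Z ` {w. ev K F w \<noteq> \<one>\<^bsub>K\<^esub>})" by simp
  qed (use Z empty in auto)
  moreover have "X interior_of C = C" using X by (metis interior_of_topspace)
  moreover have "C \<noteq> {}" using PC by blast
  ultimately have "\<not> C \<subseteq> \<Union>(Z ` {w. ev K F w \<noteq> \<one>\<^bsub>K\<^esub>})"
    by (metis interior_of_mono subset_empty)
  then obtain t where t: "t \<in> C" "\<And>w. ev K F w \<noteq> \<one>\<^bsub>K\<^esub> \<Longrightarrow> t \<notin> Z w" by blast
  have tG: "t \<in> carrier G" using t CG by blast
  \<comment> \<open>Commuting with \<open>u\<close> is a closed condition and holds on the powers,
    hence on their closure; it gives the twisted copy the same commutator.\<close>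
  have "continuous_map T T (\<lambda>x. x \<otimes> u)" "continuous_map T T (\<lambda>x. u \<otimes> x)"
    using u continuous_map_id[of T] by (auto intro!: continuous_mult_fun simp: id_def)
  then have "closedin T {x \<in> topspace T. x \<otimes> u = u \<otimes> x}"
    using hausdorff closedin_continuous_maps_eq by blast
  moreover have "range (\<lambda>n::int. u [^] n) \<subseteq> {x \<in> topspace T. x \<otimes> u = u \<otimes> x}"
  proof -
    have "u [^] n \<otimes> u = u \<otimes> u [^] n" for n :: int
      using u int_pow_mult[of u n 1] int_pow_mult[of u 1 n] by (simp add: int_pow_1 add.commute)
    then show ?thesis by auto
  qed
  ultimately have "t \<otimes> u = u \<otimes> t"
    using t(1) closure_of_minimal unfolding C_def by blast
  then have "amalgamated G (twist G t f)"
    using amalgamated_twist[OF tG f] by (simp add: u_def)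
  moreover have "ev K F w = \<one>\<^bsub>K\<^esub>" if "ev G (twist G t f) w = \<one>" for w
    using t tG that unfolding Z_def by blast
  ultimately show ?thesis using tG by blast
qed

end

section \<open>Local systems and holonomy\<close>

text \<open>
  A local system on \<open>X\<close> with values in the group \<open>K\<close>, given by its parallel transports between nearby
  points; the values of \<open>h\<close> at distant pairs of points are irrelevant.
\<close>

definition transport_system :: "('k, 'r) monoid_scheme \<Rightarrow> 'x topology \<Rightarrow> ('x \<Rightarrow> 'x \<Rightarrow> 'k) \<Rightarrow> bool" where
  "transport_system K X h \<longleftrightarrow> (\<forall>x y. h x y \<in> carrier K) \<and>
     (\<forall>x\<in>topspace X. \<exists>V \<sigma>. openin X V \<and> x \<in> V \<and> (\<forall>y. \<sigma> y \<in> carrier K) \<and>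
        (\<forall>y\<in>V. \<forall>z\<in>V. h y z = inv\<^bsub>K\<^esub> (\<sigma> y) \<otimes>\<^bsub>K\<^esub> \<sigma> z))"

text \<open>Transport is trusted only below a uniform scale \<delta>, which compact domains provide.
  Allowing any metric domain covers paths as well as homotopies.\<close>

definition parallel_on :: "('k, 'r) monoid_scheme \<Rightarrow> ('x \<Rightarrow> 'x \<Rightarrow> 'k) \<Rightarrow> 'e::metric_space set \<Rightarrow> ('e \<Rightarrow> 'x) \<Rightarrow> ('e \<Rightarrow> 'k) \<Rightarrow> bool" where
  "parallel_on K h S p f \<longleftrightarrow> (\<forall>s\<in>S. f s \<in> carrier K) \<and>
     (\<exists>\<delta>>0. \<forall>s\<in>S. \<forall>t\<in>S. dist s t < \<delta> \<longrightarrow> f t = f s \<otimes>\<^bsub>K\<^esub> h (p s) (p t))"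

definition holonomy :: "('k, 'r) monoid_scheme \<Rightarrow> ('x \<Rightarrow> 'x \<Rightarrow> 'k) \<Rightarrow> (real \<Rightarrow> 'x) \<Rightarrow> 'k \<Rightarrow> bool" where
  "holonomy K h p k \<longleftrightarrow> (\<exists>f. parallel_on K h {0..1} p f \<and> f 0 = \<one>\<^bsub>K\<^esub> \<and> f 1 = k)"

lemma parallel_onI:
  assumes "\<And>s. s \<in> S \<Longrightarrow> f s \<in> carrier K" "d > 0"
    "\<And>s t. s \<in> S \<Longrightarrow> t \<in> S \<Longrightarrow> dist s t < d \<Longrightarrow> f t = f s \<otimes>\<^bsub>K\<^esub> h (p s) (p t)"
  shows "parallel_on K h S p f"
  using assms unfolding parallel_on_def by blast

lemma parallel_on_closed: "parallel_on K h S p f \<Longrightarrow> s \<in> S \<Longrightarrow> f s \<in> carrier K"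
  by (simp add: parallel_on_def)

lemma transport_system_closed: "transport_system K X h \<Longrightarrow> h x y \<in> carrier K"
  by (simp add: transport_system_def)

lemma (in group) transport_system_refl:
  assumes "transport_system G X h" "x \<in> topspace X"
  shows "h x x = \<one>"
  using assms unfolding transport_system_def by (metis l_inv)

text \<open>\<delta> is a Lebesgue number for the preimages of trivialising sets; inside one of
  these the transports are quotients of values of \<sigma>, and the product telescopes.\<close>

lemma (in group) cocycle_near:
  fixes S :: "'e::heine_borel set"
  assumes h: "transport_system G X h" and S: "compact S" and p: "continuous_map (top_of_set S) X p"
  shows "\<exists>\<delta>>0. \<forall>x\<in>S. \<forall>y\<in>S. \<forall>z\<in>S. dist x y < \<delta> \<longrightarrow> dist x z < \<delta> \<longrightarrow>
    h (p x) (p y) \<otimes> h (p y) (p z) = h (p x) (p z)"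
proof -
  have "\<exists>W. open W \<and> x \<in> W \<and> (\<exists>\<sigma>. (\<forall>y. \<sigma> y \<in> carrier G) \<and>
      (\<forall>y\<in>S \<inter> W. \<forall>z\<in>S \<inter> W. h (p y) (p z) = inv (\<sigma> (p y)) \<otimes> \<sigma> (p z)))" if x: "x \<in> S" for x
  proof -
    have "p x \<in> topspace X"
      using continuous_map_image_subset_topspace[OF p] x by auto
    then obtain V \<sigma> where V: "openin X V" "p x \<in> V" "\<forall>y. \<sigma> y \<in> carrier G"
      "\<forall>y\<in>V. \<forall>z\<in>V. h y z = inv (\<sigma> y) \<otimes> \<sigma> z"
      using h unfolding transport_system_def by blast
    have "openin (top_of_set S) {y \<in> topspace (top_of_set S). p y \<in> V}"
      using p V(1) by (rule openin_continuous_map_preimage)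
    then obtain W where W: "open W" "{y \<in> S. p y \<in> V} = S \<inter> W"
      by (auto simp: openin_open)
    then show ?thesis
      using V x by (intro exI[of _ W]) blast
  qed
  then obtain W where W: "\<And>x. x \<in> S \<Longrightarrow> open (W x)" "\<And>x. x \<in> S \<Longrightarrow> x \<in> W x"
    "\<And>x. x \<in> S \<Longrightarrow> \<exists>\<sigma>. (\<forall>y. \<sigma> y \<in> carrier G) \<and>
      (\<forall>y\<in>S \<inter> W x. \<forall>z\<in>S \<inter> W x. h (p y) (p z) = inv (\<sigma> (p y)) \<otimes> \<sigma> (p z))"
    by metis
  have "S \<subseteq> \<Union>(W ` S)" using W by blast
  then obtain \<delta> where \<delta>: "\<delta> > 0" "\<And>x. x \<in> S \<Longrightarrow> \<exists>A \<in> W ` S. ball x \<delta> \<subseteq> A"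
    using Heine_Borel_lemma[OF S, of "W ` S"] W(1) by (metis imageE)
  have "h (p x) (p y) \<otimes> h (p y) (p z) = h (p x) (p z)"
    if "x \<in> S" "y \<in> S" "z \<in> S" "dist x y < \<delta>" "dist x z < \<delta>" for x y z
  proof -
    obtain a where "a \<in> S" "ball x \<delta> \<subseteq> W a" using \<delta>(2) \<open>x \<in> S\<close> by blast
    then have "x \<in> S \<inter> W a" "y \<in> S \<inter> W a" "z \<in> S \<inter> W a"
      using that \<delta>(1) by auto
    with W(3)[OF \<open>a \<in> S\<close>] obtain \<sigma> where \<sigma>: "\<And>y. \<sigma> y \<in> carrier G"
      "h (p x) (p y) = inv (\<sigma> (p x)) \<otimes> \<sigma> (p y)" "h (p y) (p z) = inv (\<sigma> (p y)) \<otimes> \<sigma> (p z)"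
      "h (p x) (p z) = inv (\<sigma> (p x)) \<otimes> \<sigma> (p z)" by metis
    have "\<sigma> (p y) \<otimes> (inv (\<sigma> (p y)) \<otimes> \<sigma> (p z)) = \<sigma> (p z)"
      using \<sigma>(1) by (simp add: m_assoc[symmetric])
    then show ?thesis using \<sigma>(1) by (simp add: \<sigma>(2,3,4) m_assoc)
  qed
  with \<delta>(1) show ?thesis by blast
qed

text \<open>
  The parallel section is the product of the transports along the \<open>n\<close> steps of the segment from a
  base point; comparing the segments to two nearby end points is a ladder of small squares.
\<close>

lemma (in group) parallel_exists:
  fixes S :: "'e::euclidean_space set"
  assumes h: "transport_system G X h" and S: "compact S" "convex S" "a \<in> S"
    and p: "continuous_map (top_of_set S) X p"
  shows "\<exists>f. parallel_on G h S p f \<and> f a = \<one>"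
proof -
  obtain \<delta> where \<delta>: "\<delta> > 0" and coc: "\<And>x y z. x \<in> S \<Longrightarrow> y \<in> S \<Longrightarrow> z \<in> S \<Longrightarrow> dist x y < \<delta> \<Longrightarrow> dist x z < \<delta> \<Longrightarrow>
    h (p x) (p y) \<otimes> h (p y) (p z) = h (p x) (p z)"
    using cocycle_near[OF h S(1) p] by blast
  obtain B where B: "\<And>x. x \<in> S \<Longrightarrow> norm (x - a) \<le> B"
    using compact_imp_bounded[OF S(1)] unfolding bounded_any_center[of S a]
    by (auto simp: dist_norm norm_minus_commute)
  \<comment> \<open>No segment is longer than \<open>B\<close>, so this many steps have length below
    \<open>\<delta> / 2\<close> each.\<close>
  obtain n :: nat where n: "n > 0" "B / \<delta> * 2 < n"
  proof -
    obtain m :: nat where "B / \<delta> * 2 < real m" using reals_Archimedean2 by blast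
    then show ?thesis using that[of "Suc m"] by simp
  qed
  have hc [simp]: "h x y \<in> carrier G" for x y using h by (rule transport_system_closed)
  define c where "c i x = a + (real i / real n) *\<^sub>R (x - a)" for i x
  have cS: "c i x \<in> S" if "i \<le> n" "x \<in> S" for i x
  proof -
    have "c i x = (1 - real i / real n) *\<^sub>R a + (real i / real n) *\<^sub>R x"
      by (simp add: c_def algebra_simps)
    then show ?thesis using that n S by (simp add: convexD_alt)
  qed
  have step: "dist (c i x) (c (Suc i) x) < \<delta> / 2" if "x \<in> S" for i x
  proof -
    have "c (Suc i) x - c i x = (1 / real n) *\<^sub>R (x - a)"
      by (simp add: c_def add_divide_distrib scaleR_add_left)
    then have "dist (c i x) (c (Suc i) x) = norm (x - a) / real n"
      by (simp add: dist_norm norm_minus_commute[of "c i x"])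
    also have "\<dots> \<le> B / real n" using B[OF that] n(1) by (simp add: divide_right_mono)
    also have "\<dots> < \<delta> / 2" using n \<delta> by (simp add: field_simps)
    finally show ?thesis .
  qed
  have side: "dist (c i x) (c i y) \<le> dist x y" if "i \<le> n" for i x y
  proof -
    have "c i x - c i y = (real i / real n) *\<^sub>R (x - y)"
      by (simp add: c_def scaleR_diff_right)
    then have "dist (c i x) (c i y) = real i / real n * dist x y" by (simp add: dist_norm)
    also have "\<dots> \<le> 1 * dist x y"
      using that n(1) by (intro mult_right_mono) auto
    finally show ?thesis by simp
  qed
  define f where "f i x = foldr (\<lambda>j y. y \<otimes> h (p (c j x)) (p (c (Suc j) x))) (rev [0..<i]) \<one>" for i x
  have f0: "f 0 x = \<one>" and fSuc: "f (Suc i) x = f i x \<otimes> h (p (c i x)) (p (c (Suc i) x))" for i x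
    by (simp_all add: f_def)
  have fc [simp]: "f i x \<in> carrier G" for i x
    by (induction i) (simp_all add: f0 fSuc)
  have h1: "h (p x) (p x) = \<one>" if "x \<in> S" for x
    using transport_system_refl[OF h] continuous_map_image_subset_topspace[OF p] that by auto
  have ladder: "f i y = f i x \<otimes> h (p (c i x)) (p (c i y))"
    if "i \<le> n" "x \<in> S" "y \<in> S" "dist x y < \<delta> / 2" for i x y
    using that(1)
  proof (induction i)
    case 0
    have "c 0 x = a" "c 0 y = a" by (simp_all add: c_def)
    then show ?case using h1[OF S(3)] by (simp add: f0)
  next
    case (Suc i)
    have P: "c i x \<in> S" "c i y \<in> S" "c (Suc i) x \<in> S" "c (Suc i) y \<in> S"
      using cS Suc that by auto
    have d: "dist (c i x) (c i y) < \<delta> / 2" "dist (c (Suc i) x) (c (Suc i) y) < \<delta> / 2"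
      using side[of i x y] side[of "Suc i" x y] Suc.prems that(4) by auto
    have s: "dist (c i x) (c (Suc i) x) < \<delta> / 2" "dist (c i y) (c (Suc i) y) < \<delta> / 2"
      using step that by auto
    have D: "dist (c i x) (c (Suc i) y) < \<delta>"
      using d(1) s(2) dist_triangle[of "c i x" "c (Suc i) y" "c i y"] by linarith
    \<comment> \<open>The small square with corners \<open>c i x\<close>, \<open>c i y\<close>,
      \<open>c (Suc i) x\<close>, \<open>c (Suc i) y\<close> commutes, because both ways round it
      equal the transport along its diagonal.\<close>
    have "f (Suc i) y = f i x \<otimes> (h (p (c i x)) (p (c i y)) \<otimes> h (p (c i y)) (p (c (Suc i) y)))"
      using Suc by (simp add: fSuc m_assoc)
    also have "h (p (c i x)) (p (c i y)) \<otimes> h (p (c i y)) (p (c (Suc i) y)) = h (p (c i x)) (p (c (Suc i) y))"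
      using d(1) D \<delta> by (intro coc P) auto
    also have "\<dots> = h (p (c i x)) (p (c (Suc i) x)) \<otimes> h (p (c (Suc i) x)) (p (c (Suc i) y))"
      using s(1) D \<delta> by (intro coc[symmetric] P) auto
    finally show ?case by (simp add: fSuc m_assoc)
  qed
  have cn: "c n x = x" for x using n(1) by (simp add: c_def)
  have "parallel_on G h S p (f n)"
    unfolding parallel_on_def
  proof (intro conjI exI[of _ "\<delta> / 2"] ballI impI)
    show "f n t = f n s \<otimes> h (p s) (p t)" if "s \<in> S" "t \<in> S" "dist s t < \<delta> / 2" for s t
      using ladder[OF order_refl that] by (simp only: cn)
  qed (use \<delta> in auto)
  moreover have "f i a = \<one>" for i
    by (induction i) (simp_all add: f0 fSuc c_def h1 S)
  ultimately show ?thesis by blast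
qed

text \<open>Inside a small ball both sections are continued by the same transports, so agreement at
  one point spreads over the ball and, by connectedness, over \<open>S\<close>.\<close>

lemma (in group) parallel_unique:
  assumes h: "transport_system G X h" and f: "parallel_on G h S p f" "parallel_on G h S p g"
    and S: "connected S" "a \<in> S" "b \<in> S" and eq: "f a = g a"
  shows "f b = g b"
proof -
  obtain d where d: "d > 0" "\<And>s t. s \<in> S \<Longrightarrow> t \<in> S \<Longrightarrow> dist s t < d \<Longrightarrow> f t = f s \<otimes> h (p s) (p t)"
    using f(1) unfolding parallel_on_def by blast
  obtain e where e: "e > 0" "\<And>s t. s \<in> S \<Longrightarrow> t \<in> S \<Longrightarrow> dist s t < e \<Longrightarrow> g t = g s \<otimes> h (p s) (p t)"
    using f(2) unfolding parallel_on_def by blast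
  show ?thesis
  proof (rule connected_induction_simple[where P = "\<lambda>s. f s = g s", OF S(1,2,3) eq])
    fix s assume s: "s \<in> S"
    let ?W = "S \<inter> ball s (min d e / 2)"
    have *: "f y = g y" if "x \<in> ?W" "y \<in> ?W" "f x = g x" for x y
    proof -
      have "dist x y < min d e"
        using that dist_triangle2[of x y s] by (auto simp: dist_commute)
      then show ?thesis using d(2)[of x y] e(2)[of x y] that by auto
    qed
    have "openin (top_of_set S) ?W" "s \<in> ?W"
      using s d(1) e(1) by (simp_all add: openin_open_Int)
    then show "\<exists>T. openin (top_of_set S) T \<and> s \<in> T \<and> (\<forall>x\<in>T. \<forall>y\<in>T. f x = g x \<longrightarrow> f y = g y)"
      using * by blast
  qed
qed

lemma (in group) holonomy_exists:
  assumes "transport_system G X h" "pathin X p"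
  shows "\<exists>k. holonomy G h p k"
  using parallel_exists[OF assms(1), of "{0..1::real}" 0 p] assms(2)
  by (auto simp: holonomy_def pathin_def)

lemma holonomy_closed: "holonomy K h p k \<Longrightarrow> k \<in> carrier K"
  using parallel_on_closed[where S = "{0..1::real}" and s = 1] by (fastforce simp: holonomy_def)

lemma (in group) holonomy_unique:
  assumes "transport_system G X h" "holonomy G h p k" "holonomy G h p l"
  shows "k = l"
proof -
  obtain f g where "parallel_on G h {0..1} p f" "parallel_on G h {0..1} p g" "f 0 = g 0" "f 1 = k" "g 1 = l"
    using assms(2,3) by (auto simp: holonomy_def)
  then show ?thesis
    using parallel_unique[OF assms(1), where S = "{0..1::real}" and a = 0 and b = 1 and f = f and g = g and p = p]
    by simp
qed

lemma (in group) parallel_left_mult: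
  assumes h: "transport_system G X h" and f: "parallel_on G h S p f" and c: "c \<in> carrier G"
  shows "parallel_on G h S p (\<lambda>s. c \<otimes> f s)"
proof -
  obtain d where d: "d > 0"
    "\<And>s t. s \<in> S \<Longrightarrow> t \<in> S \<Longrightarrow> dist s t < d \<Longrightarrow> f t = f s \<otimes> h (p s) (p t)"
    using f unfolding parallel_on_def by blast
  show ?thesis
  proof (rule parallel_onI[OF _ d(1)])
    fix s t assume st: "s \<in> S" "t \<in> S" "dist s t < d"
    then show "c \<otimes> f t = c \<otimes> f s \<otimes> h (p s) (p t)"
      using d(2)[OF st] c transport_system_closed[OF h] parallel_on_closed[OF f] by (metis m_assoc)
  qed (use c parallel_on_closed[OF f] in simp)
qed

lemma (in group) holonomyI:
  assumes h: "transport_system G X h" and f: "parallel_on G h {0..1} p f"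
  shows "holonomy G h p (inv (f 0) \<otimes> f 1)"
proof -
  have "f 0 \<in> carrier G" using f by (rule parallel_on_closed) simp
  then show ?thesis
    unfolding holonomy_def
    by (intro exI[of _ "\<lambda>s. inv (f 0) \<otimes> f s"]) (simp add: parallel_left_mult[OF h f])
qed

lemma parallel_subpath:
  assumes f: "parallel_on K h {0..1::real} p f"
    and r: "\<And>s. s \<in> {0..1::real} \<Longrightarrow> r s \<in> {0..1::real}" "\<And>s t. dist (r s) (r t) \<le> dist s t"
    and q: "\<And>s. s \<in> {0..1} \<Longrightarrow> q s = p (r s)"
  shows "parallel_on K h {0..1} q (f \<circ> r)"
proof -
  obtain d where d: "d > 0" "\<And>s t. s \<in> {0..1} \<Longrightarrow> t \<in> {0..1} \<Longrightarrow> dist s t < d \<Longrightarrow> f t = f s \<otimes>\<^bsub>K\<^esub> h (p s) (p t)"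
    using f unfolding parallel_on_def by blast
  have "(f \<circ> r) t = (f \<circ> r) s \<otimes>\<^bsub>K\<^esub> h (q s) (q t)" if "s \<in> {0..1}" "t \<in> {0..1}" "dist s t < d" for s t
    using that d(2)[OF r(1)[OF that(1)] r(1)[OF that(2)]] r(2)[of s t] by (simp add: q)
  with d(1) show ?thesis
    by (rule parallel_onI[rotated]) (use parallel_on_closed[OF f] r(1) in auto)
qed

text \<open>A section along the whole path restricts to both halves; on the second it starts at
  \<open>k\<close> instead of \<one>, which a left multiplication corrects.\<close>

lemma (in group) holonomy_concat:
  assumes h: "transport_system G X h" and pq: "pathin X (loop_concat p q)" "p 1 = q 0"
    and k: "holonomy G h p k" "holonomy G h q l"
  shows "holonomy G h (loop_concat p q) (k \<otimes> l)"
proof -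
  obtain f where f: "parallel_on G h {0..1} (loop_concat p q) f" "f 0 = \<one>"
    using parallel_exists[OF h, of "{0..1::real}" 0] pq(1) by (auto simp: pathin_def)
  have fc: "f s \<in> carrier G" if "s \<in> {0..1}" for s using f(1) that by (rule parallel_on_closed)
  have "parallel_on G h {0..1} p (f \<circ> (\<lambda>t. t / 2))"
    by (rule parallel_subpath[OF f(1)]) (auto simp: loop_concat_def dist_real_def)
  from holonomyI[OF h this] have "holonomy G h p (f (1/2))"
    using f(2) fc by simp
  then have k': "k = f (1/2)" using holonomy_unique[OF h] k(1) by blast
  have "parallel_on G h {0..1} q (f \<circ> (\<lambda>t. (1 + t) / 2))"
  proof (rule parallel_subpath[OF f(1)])
    fix s :: real assume "s \<in> {0..1}"
    then show "q s = loop_concat p q ((1 + s) / 2)"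
      using pq(2) by (cases "s = 0") (auto simp: loop_concat_def field_simps)
  qed (auto simp: dist_real_def abs_if field_simps)
  from holonomyI[OF h this] have "holonomy G h q (inv (f (1/2)) \<otimes> f 1)"
    by simp
  then have "l = inv (f (1/2)) \<otimes> f 1" using holonomy_unique[OF h] k(2) by blast
  then have "k \<otimes> l = f 1" using fc k' by (simp add: m_assoc[symmetric])
  with f show ?thesis unfolding holonomy_def by (intro exI[of _ f]) simp
qed

lemma (in group) holonomy_reverse:
  assumes h: "transport_system G X h" and k: "holonomy G h p k"
  shows "holonomy G h (\<lambda>t. p (1 - t)) (inv k)"
proof -
  obtain f where f: "parallel_on G h {0..1} p f" "f 0 = \<one>" "f 1 = k"
    using k by (auto simp: holonomy_def)
  have "parallel_on G h {0..1} (\<lambda>t. p (1 - t)) (f \<circ> (\<lambda>t. 1 - t))"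
    by (rule parallel_subpath[OF f(1)]) (auto simp: dist_real_def)
  from holonomyI[OF h this] show ?thesis
    using f holonomy_closed[OF k] by simp
qed

text \<open>A parallel section over the whole square restricts to the two paths on the rows
  \<open>t = 0\<close> and \<open>t = 1\<close>. On the sides the homotopy rests at
  \<open>x\<close>, so the section is constant there and the rows have equal end values.\<close>

lemma (in group) holonomy_homotopic:
  assumes h: "transport_system G X h" and hom: "loop_homotopic X x p q" and k: "holonomy G h p k"
  shows "holonomy G h q k"
proof -
  let ?S = "{0..1} \<times> {0..1} :: (real \<times> real) set"
  have P: "prod_topology (top_of_set {0..1::real}) (top_of_set {0..1::real}) = top_of_set ?S"
    by (simp add: prod_topology_subtopology subtopology_subtopology Times_Int_Times)
  obtain H where H: "continuous_map (top_of_set ?S) X H"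
    "\<And>s. H (0, s) = p s" "\<And>s. H (1, s) = q s" "\<And>t. t \<in> {0..1} \<Longrightarrow> H (t, 0) = x \<and> H (t, 1) = x"
    using hom unfolding loop_homotopic_def homotopic_with_def P by auto
  have x: "x \<in> topspace X"
    using loop_homotopic_loops[OF hom] by (auto simp: loops_def dest: path_start_in_topspace)
  have S: "compact ?S" "convex ?S" "(0, 0) \<in> ?S"
    by (auto intro: compact_Times convex_Times)
  obtain F where F: "parallel_on G h ?S H F" "F (0, 0) = \<one>"
    using parallel_exists[OF h S H(1)] by blast
  have Fc: "F z \<in> carrier G" if "z \<in> ?S" for z using F(1) that by (rule parallel_on_closed)
  obtain d where d: "d > 0" "\<And>s t. s \<in> ?S \<Longrightarrow> t \<in> ?S \<Longrightarrow> dist s t < d \<Longrightarrow> F t = F s \<otimes> h (H s) (H t)"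
    using F(1) unfolding parallel_on_def by blast
  have row: "parallel_on G h {0..1} (\<lambda>s. H (t, s)) (\<lambda>s. F (t, s))" if "t \<in> {0..1}" for t
  proof (rule parallel_onI[OF _ d(1)])
    show "F (t, s') = F (t, s) \<otimes> h (H (t, s)) (H (t, s'))"
      if "s \<in> {0..1}" "s' \<in> {0..1}" "dist s s' < d" for s s'
      using that \<open>t \<in> {0..1}\<close> by (intro d(2)) (auto simp: dist_Pair_Pair)
  qed (use Fc that in auto)
  have column: "F (1, s) = F (0, s)" if s: "s = 0 \<or> s = 1" for s
  proof -
    have "parallel_on G h {0..1} (\<lambda>t. H (t, s)) (\<lambda>t. F (t, s))"
    proof (rule parallel_onI[OF _ d(1)])
      show "F (t', s) = F (t, s) \<otimes> h (H (t, s)) (H (t', s))"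
        if "t \<in> {0..1}" "t' \<in> {0..1}" "dist t t' < d" for t t'
        using that s by (intro d(2)) (auto simp: dist_Pair_Pair)
    qed (use Fc s in auto)
    moreover have "parallel_on G h {0..1} (\<lambda>t. H (t, s)) (\<lambda>t. F (0, s))"
    proof (rule parallel_onI[OF _ zero_less_one])
      have 0: "F (0, s) \<in> carrier G" using Fc s by auto
      show "F (0, s) = F (0, s) \<otimes> h (H (t, s)) (H (t', s))"
        if "t \<in> {0..1}" "t' \<in> {0..1}" "dist t t' < 1" for t t'
        using that s H(4)[of t] H(4)[of t'] transport_system_refl[OF h x] 0 by auto
    qed (use Fc s in auto)
    ultimately show ?thesis
      using parallel_unique[OF h, where S = "{0..1::real}" and a = 0 and b = 1 and p = "\<lambda>t. H (t, s)"
          and f = "\<lambda>t. F (t, s)" and g = "\<lambda>t. F (0, s)"] by simp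
  qed
  have "k = F (0, 1)"
    using holonomyI[OF h row[of 0]] F(2) Fc holonomy_unique[OF h k] by (simp add: H)
  moreover have "holonomy G h q (F (1, 1))"
    using holonomyI[OF h row[of 1]] column[of 0] F(2) Fc by (simp add: H)
  ultimately show ?thesis using column[of 1] by simp
qed

lemma (in group) holonomy_hom:
  assumes h: "transport_system G X h" and x: "x \<in> topspace X"
  shows "\<exists>\<Phi> \<in> hom (fundamental_group X x) G. \<forall>p\<in>loops X x. holonomy G h p (\<Phi> (loop_class X x p))"
proof -
  have ex: "\<exists>k. \<forall>p\<in>A. holonomy G h p k" if A: "A \<in> carrier (fundamental_group X x)" for A
  proof -
    obtain p where p: "p \<in> loops X x" "A = loop_class X x p" using A by (auto simp: fundamental_group_def)
    obtain k where "holonomy G h p k" using holonomy_exists[OF h] p(1) by (auto simp: loops_def)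
    then have "\<forall>q\<in>A. holonomy G h q k" using holonomy_homotopic[OF h] p(2) by (simp add: loop_class_def)
    then show ?thesis ..
  qed
  then obtain \<Phi> where \<Phi>: "\<And>A p. A \<in> carrier (fundamental_group X x) \<Longrightarrow> p \<in> A \<Longrightarrow> holonomy G h p (\<Phi> A)"
    by metis
  have cl: "holonomy G h p (\<Phi> (loop_class X x p))" if "p \<in> loops X x" for p
    using that by (intro \<Phi>) (auto simp: fundamental_group_def loop_class_def loop_homotopic_refl)
  have "\<Phi> \<in> hom (fundamental_group X x) G"
  proof (rule homI)
    fix A assume "A \<in> carrier (fundamental_group X x)"
    then obtain p where p: "p \<in> loops X x" "A = loop_class X x p" by (auto simp: fundamental_group_def)
    then show "\<Phi> A \<in> carrier G" using holonomy_closed[OF cl[OF p(1)]] by simp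
    fix B assume "B \<in> carrier (fundamental_group X x)"
    then obtain q where q: "q \<in> loops X x" "B = loop_class X x q" by (auto simp: fundamental_group_def)
    have pq: "loop_concat p q \<in> loops X x" using p q by (simp add: loop_concat_loops)
    have "holonomy G h (loop_concat p q) (\<Phi> A \<otimes> \<Phi> B)"
      using pq p q cl by (intro holonomy_concat[OF h]) (auto simp: loops_def)
    then show "\<Phi> (A \<otimes>\<^bsub>fundamental_group X x\<^esub> B) = \<Phi> A \<otimes> \<Phi> B"
      using holonomy_unique[OF h cl[OF pq]] p q by (simp add: fundamental_group_mult)
  qed
  with cl show ?thesis by blast
qed

section \<open>Coordinates on the polygon\<close>

lemma equivclp_invariant:
  assumes "equivclp R x y" "\<And>x y. R x y \<Longrightarrow> P x \<longleftrightarrow> P y"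
  shows "P x \<longleftrightarrow> P y"
  using assms(1) unfolding equivclp_def
  by (induction rule: rtranclp_induct) (use assms(2) in \<open>auto simp: symclp_def\<close>)

lemma norm_polygon_boundary [simp]: "norm (polygon_boundary g s) = 1"
  by (simp add: polygon_boundary_def)

lemma polygon_boundary_nonzero [simp]: "polygon_boundary g s \<noteq> 0"
  by (simp add: polygon_boundary_def)

lemma polygon_boundary_cball [simp]: "polygon_boundary g s \<in> cball 0 1"
  by simp

lemma polygon_boundary_shift: "g \<ge> 1 \<Longrightarrow> polygon_boundary g (s + 4 * real g) = polygon_boundary g s"
  by (simp add: polygon_boundary_def complex_eq_iff distrib_left add_divide_distrib)

lemma polygon_boundary_wrap:
  assumes "g \<ge> 1"
  shows "polygon_boundary g (real (4 * g) + s) = polygon_boundary g s"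
  using polygon_boundary_shift[OF assms, of s] by (simp add: add.commute)

lemma polygon_boundary_mod:
  assumes "g \<ge> 1"
  shows "polygon_boundary g (real (k mod (4 * g)) + t) = polygon_boundary g (real k + t)"
proof -
  have *: "polygon_boundary g (real (m * (4 * g)) + s) = polygon_boundary g s" for m s
  proof (induction m)
    case (Suc m)
    have "real (Suc m * (4 * g)) + s = real (4 * g) + (real (m * (4 * g)) + s)" by simp
    with Suc show ?case by (simp only: polygon_boundary_wrap[OF assms])
  qed simp
  have "real k + t = real (k div (4 * g) * (4 * g)) + (real (k mod (4 * g)) + t)"
    by (metis add.assoc div_mult_mod_eq of_nat_add)
  then show ?thesis by (simp only: *)
qed

lemma continuous_polygon_boundary [continuous_intros]:
  "continuous_on S f \<Longrightarrow> continuous_on S (\<lambda>x. polygon_boundary g (f x))"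
  unfolding polygon_boundary_def cis_conv_exp divide_inverse by (intro continuous_intros)

definition edge_coord :: "nat \<Rightarrow> complex \<Rightarrow> real" where
  "edge_coord g z = 4 * real g * Arg2pi z / (2 * pi)"

definition edge_index :: "nat \<Rightarrow> complex \<Rightarrow> nat" where
  "edge_index g z = nat \<lfloor>edge_coord g z\<rfloor>"

definition edge_param :: "nat \<Rightarrow> complex \<Rightarrow> real" where
  "edge_param g z = frac (edge_coord g z)"

text \<open>Cones over sets of boundary points; the centre, where the angle is meaningless, is left
  out.\<close>

abbreviation edge_region :: "nat \<Rightarrow> (nat \<Rightarrow> real \<Rightarrow> bool) \<Rightarrow> complex set" where
  "edge_region g P \<equiv> {z. z \<noteq> 0 \<and> P (edge_index g z) (edge_param g z)}"

lemma edge_coord_unique: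
  assumes "g \<ge> 1" "r > 0" "0 \<le> s" "s < 4 * real g"
  shows "edge_coord g (of_real r * polygon_boundary g s) = s"
proof -
  have "Arg2pi (of_real r * polygon_boundary g s) = 2 * pi * s / (4 * real g)"
    using assms by (intro Arg2pi_unique[of r]) (auto simp: polygon_boundary_def cis_conv_exp field_simps)
  then show ?thesis using assms by (simp add: edge_coord_def)
qed

lemma edge_index_param:
  assumes "g \<ge> 1" "r > 0" "k < 4 * g" "0 \<le> t" "t < 1"
  shows "edge_index g (of_real r * polygon_boundary g (real k + t)) = k"
    "edge_param g (of_real r * polygon_boundary g (real k + t)) = t"
proof -
  have "real k + 1 \<le> 4 * real g" using assms(3) by linarith
  then have c: "edge_coord g (of_real r * polygon_boundary g (real k + t)) = real k + t"
    using assms by (intro edge_coord_unique) auto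
  have "\<lfloor>real k + t\<rfloor> = int k" using assms by (intro floor_unique) auto
  then show "edge_index g (of_real r * polygon_boundary g (real k + t)) = k"
    "edge_param g (of_real r * polygon_boundary g (real k + t)) = t"
    by (simp_all add: edge_index_def edge_param_def c frac_def)
qed

lemma edge_decomposition:
  assumes "g \<ge> 1"
  shows "edge_index g z < 4 * g" "0 \<le> edge_param g z" "edge_param g z < 1"
    "z = of_real (norm z) * polygon_boundary g (real (edge_index g z) + edge_param g z)"
proof -
  have c: "0 \<le> edge_coord g z" "edge_coord g z < 4 * real g"
    using assms Arg2pi[of z] by (auto simp: edge_coord_def field_simps)
  then have k: "real (edge_index g z) + edge_param g z = edge_coord g z"
    by (simp add: edge_index_def edge_param_def frac_def)
  show "edge_index g z < 4 * g" "0 \<le> edge_param g z" "edge_param g z < 1"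
    using c by (auto simp: edge_index_def edge_param_def floor_less_iff nat_less_iff frac_lt_1)
  have "2 * pi * edge_coord g z / (4 * real g) = Arg2pi z"
    using assms by (simp add: edge_coord_def)
  then show "z = of_real (norm z) * polygon_boundary g (real (edge_index g z) + edge_param g z)"
    unfolding k polygon_boundary_def using Arg2pi_eq[of z] by (simp add: cis_conv_exp)
qed

text \<open>A direction slightly before vertex \<open>k\<close> lies on the preceding edge. Adding
  \<open>4 * g\<close> before subtracting 1 keeps the natural number from being cut off at
  \<open>k = 0\<close>.\<close>

lemma edge_index_wrap:
  assumes "g \<ge> 1" "r > 0" "k < 4 * g" "- 1 \<le> t" "t < 0"
  shows "edge_index g (of_real r * polygon_boundary g (real k + t)) = (k + 4 * g - 1) mod (4 * g)"
    "edge_param g (of_real r * polygon_boundary g (real k + t)) = t + 1"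
proof -
  let ?k = "(k + 4 * g - 1) mod (4 * g)"
  have eq: "real (k + 4 * g - 1) + (t + 1) = real (4 * g) + (real k + t)"
    using assms(1) by (simp add: of_nat_diff)
  have "polygon_boundary g (real k + t) = polygon_boundary g (real ?k + (t + 1))"
    unfolding polygon_boundary_mod[OF assms(1)] eq polygon_boundary_wrap[OF assms(1)] ..
  moreover have "?k < 4 * g" using assms(1) by simp
  ultimately show "edge_index g (of_real r * polygon_boundary g (real k + t)) = ?k"
    "edge_param g (of_real r * polygon_boundary g (real k + t)) = t + 1"
    using edge_index_param[of g r ?k "t + 1"] assms by auto
qed

text \<open>The angle is measured relative to \<open>z0\<close> by the logarithm of
  \<open>z / z0\<close>, which is continuous near 1, whereas \<open>Arg2pi\<close> jumps on the
  positive real axis.\<close>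

lemma near_direction:
  assumes g: "g \<ge> 1" and z0: "z0 = of_real r0 * polygon_boundary g s0" "r0 > 0" and e: "e > 0"
  shows "eventually (\<lambda>z. \<exists>r>0. \<exists>s. \<bar>s\<bar> < e \<and> z = of_real r * polygon_boundary g (s0 + s)) (nhds z0)"
proof -
  define \<phi> where "\<phi> z = 4 * real g / (2 * pi) * Im (Ln (z / z0))" for z
  have nz: "z0 \<noteq> 0" using z0 by simp
  have "isCont \<phi> z0"
    unfolding \<phi>_def using nz by (intro continuous_intros) auto
  then have "(\<phi> \<longlongrightarrow> \<phi> z0) (nhds z0)"
    by (simp add: isCont_def tendsto_at_iff_tendsto_nhds)
  moreover have "\<phi> z0 = 0" using nz by (simp add: \<phi>_def)
  ultimately have ev1: "eventually (\<lambda>z. dist (\<phi> z) 0 < e) (nhds z0)"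
    using e tendstoD by fastforce
  have ev2: "eventually (\<lambda>z. z \<noteq> 0) (nhds z0)"
    using nz by (intro t1_space_nhds) auto
  show ?thesis
    using ev1 ev2
  proof eventually_elim
    case (elim z)
    let ?w = "Ln (z / z0)"
    have "z = z0 * exp ?w" using elim nz by simp
    also have "exp ?w = of_real (exp (Re ?w)) * cis (Im ?w)"
      by (simp add: exp_eq_polar)
    also have "z0 * \<dots> = of_real (r0 * exp (Re ?w)) * (cis (2 * pi * s0 / (4 * real g)) * cis (Im ?w))"
      by (simp add: z0 polygon_boundary_def)
    also have "\<dots> = of_real (r0 * exp (Re ?w)) * polygon_boundary g (s0 + \<phi> z)"
    proof -
      have "2 * pi * s0 / (4 * real g) + Im ?w = 2 * pi * (s0 + \<phi> z) / (4 * real g)"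
        using g pi_neq_zero by (simp add: \<phi>_def distrib_left add_divide_distrib)
      then show ?thesis by (simp only: polygon_boundary_def cis_mult)
    qed
    finally have "z = of_real (r0 * exp (Re ?w)) * polygon_boundary g (s0 + \<phi> z)" .
    then show ?case using elim z0 by (intro exI[of _ "r0 * exp (Re ?w)"] conjI exI[of _ "\<phi> z"]) auto
  qed
qed

text \<open>A neighbourhood of a vertex reaches into the end of the preceding edge. The exception
  \<open>t = 0\<close> is made because the parameter 1 of that edge is never attained; the direction
  is then that of the vertex itself.\<close>

lemma open_edge_region:
  assumes g: "g \<ge> 1"
    and inner: "\<And>k t. k < 4 * g \<Longrightarrow> 0 < t \<Longrightarrow> t < 1 \<Longrightarrow> P k t \<Longrightarrow> \<exists>e>0. \<forall>t'. \<bar>t' - t\<bar> < e \<longrightarrow> P k t'"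
    and vertex: "\<And>k. k < 4 * g \<Longrightarrow> P k 0 \<Longrightarrow> \<exists>e>0. \<forall>t. 0 \<le> t \<longrightarrow> t < e \<longrightarrow> P k t \<and> P ((k + 4 * g - 1) mod (4 * g)) (1 - t) \<or> t = 0"
  shows "open (edge_region g P)"
proof (subst open_subopen, safe)
  fix z assume z: "z \<noteq> 0" "P (edge_index g z) (edge_param g z)"
  define k where "k = edge_index g z"
  define t where "t = edge_param g z"
  have k: "k < 4 * g" and t: "0 \<le> t" "t < 1"
    and zeq: "z = of_real (norm z) * polygon_boundary g (real k + t)"
    using edge_decomposition[OF g, of z] by (simp_all add: k_def t_def)
  have "norm z > 0" using z by simp
  note near = near_direction[OF g zeq this]
  have "eventually (\<lambda>z. z \<noteq> 0 \<and> P (edge_index g z) (edge_param g z)) (nhds z)"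
  proof (cases "t = 0")
    case False
    then obtain e where e: "e > 0" "\<And>t'. \<bar>t' - t\<bar> < e \<Longrightarrow> P k t'"
      using inner[OF k, of t] t z by (auto simp: k_def t_def)
    have "min e (min t (1 - t)) > 0" using e t False by auto
    from near[OF this] show ?thesis
    proof (rule eventually_mono)
      show "z \<noteq> 0 \<and> P (edge_index g z) (edge_param g z)"
        if h: "\<exists>r>0. \<exists>s. \<bar>s\<bar> < min e (min t (1 - t)) \<and> z = of_real r * polygon_boundary g (real k + t + s)" for z
      proof -
        obtain r s where rs: "r > 0" "\<bar>s\<bar> < e" "\<bar>s\<bar> < t" "\<bar>s\<bar> < 1 - t"
          "z = of_real r * polygon_boundary g (real k + (t + s))" using h by (auto simp: add.assoc)
        then have "0 \<le> t + s" "t + s < 1" by auto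
        from edge_index_param[OF g rs(1) k this] rs e(2)[of "t + s"] show ?thesis by simp
      qed
    qed
  next
    case True
    then obtain e where e: "e > 0" "\<And>t. 0 \<le> t \<Longrightarrow> t < e \<Longrightarrow> P k t \<and> P ((k + 4 * g - 1) mod (4 * g)) (1 - t) \<or> t = 0"
      using vertex[OF k] z by (auto simp: k_def t_def)
    have Pk: "P k 0" using z True by (simp add: k_def t_def)
    have "min e 1 > 0" using e by auto
    from near[OF this] show ?thesis
    proof (rule eventually_mono)
      show "z \<noteq> 0 \<and> P (edge_index g z) (edge_param g z)"
        if h: "\<exists>r>0. \<exists>s. \<bar>s\<bar> < min e 1 \<and> z = of_real r * polygon_boundary g (real k + t + s)" for z
      proof -
        obtain r s where rs: "r > 0" "\<bar>s\<bar> < e" "\<bar>s\<bar> < 1"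
          "z = of_real r * polygon_boundary g (real k + s)" using h True by auto
        show ?thesis
        proof (cases "s \<ge> 0")
          case True
          then show ?thesis
            using edge_index_param[OF g rs(1) k True] rs e(2)[of s] Pk by auto
        next
          case False
          then have "- 1 \<le> s" "s < 0" using rs by auto
          from edge_index_wrap[OF g rs(1) k this] show ?thesis
            using rs e(2)[of "- s"] False by (auto simp: add.commute)
        qed
      qed
    qed
  qed
  then show "\<exists>T. open T \<and> z \<in> T \<and> T \<subseteq> edge_region g P"
    unfolding eventually_nhds by blast
qed

section \<open>The gluing of edges and saturated sets\<close>

lemma edge_pairingE:
  assumes "edge_pairing g z w"
  obtains k t where "k + 2 < 4 * g" "k mod 4 < 2" "0 \<le> t" "t \<le> 1"
    "z = polygon_boundary g (real k + t)" "w = polygon_boundary g (real (k + 2) + (1 - t))"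
  using assms
proof cases
  case (a_edge j t)
  have "4 * real j + 3 - t = real (4 * j + 2) + (1 - t)" by simp
  with a_edge show ?thesis by (intro that[of "4 * j" t]) auto
next
  case (b_edge j t)
  have "(4 * j + 1) mod 4 = 1" by presburger
  moreover have "4 * real j + 4 - t = real (4 * j + 1 + 2) + (1 - t)" by simp
  ultimately show ?thesis using b_edge by (intro that[of "4 * j + 1" t]) (auto simp: algebra_simps)
qed

lemma edge_pairingI:
  assumes "k < 4 * g" "k mod 4 < 2" "0 \<le> t" "t \<le> 1"
  shows "edge_pairing g (polygon_boundary g (real k + t)) (polygon_boundary g (real (k + 2) + (1 - t)))"
proof -
  define j where "j = k div 4"
  have j: "j < g" using assms(1) by (simp add: j_def)
  have "k = 4 * j \<or> k = 4 * j + 1" using assms(2) unfolding j_def by presburger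
  then show ?thesis
  proof
    assume "k = 4 * j"
    then show ?thesis using a_edge[OF j assms(3,4)] by (simp add: algebra_simps)
  next
    assume "k = 4 * j + 1"
    then show ?thesis using b_edge[OF j assms(3,4)] by (simp add: algebra_simps)
  qed
qed

lemma edge_pairing_norm: "edge_pairing g z w \<Longrightarrow> norm z = 1 \<and> norm w = 1"
  by (elim edge_pairingE) simp

lemma edge_region_saturated:
  assumes g: "g \<ge> 1" and zw: "edge_pairing g z w"
    and pair: "\<And>k t. k + 2 < 4 * g \<Longrightarrow> k mod 4 < 2 \<Longrightarrow> 0 < t \<Longrightarrow> t < 1 \<Longrightarrow> P k t \<longleftrightarrow> P (k + 2) (1 - t)"
    and vertex: "\<And>k k'. k < 4 * g \<Longrightarrow> k' < 4 * g \<Longrightarrow> P k 0 \<longleftrightarrow> P k' 0"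
  shows "P (edge_index g z) (edge_param g z) \<longleftrightarrow> P (edge_index g w) (edge_param g w)"
proof -
  obtain k t where k: "k + 2 < 4 * g" "k mod 4 < 2" "0 \<le> t" "t \<le> 1"
    "z = polygon_boundary g (real k + t)" "w = polygon_boundary g (real (k + 2) + (1 - t))"
    using zw by (rule edge_pairingE)
  have coord: "edge_index g (polygon_boundary g (real j + s)) = j \<and> edge_param g (polygon_boundary g (real j + s)) = s"
    if "j < 4 * g" "0 \<le> s" "s < 1" for j s
    using edge_index_param[OF g, of 1 j s] that by simp
  \<comment> \<open>The far end of an edge is coordinatised as the start of the next one,
    cyclically, so both ends have parameter 0.\<close>
  have last: "edge_param g (polygon_boundary g (real j + 1)) = 0" for j
    using polygon_boundary_mod[OF g, of "Suc j" 0] coord[of "Suc j mod (4 * g)" 0] g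
    by (simp add: add.commute)
  consider "0 < t" "t < 1" | "t = 0" | "t = 1" using k by linarith
  then show ?thesis
  proof cases
    case 1
    then show ?thesis
      using coord[of k t] coord[of "k + 2" "1 - t"] k pair[of k t] by simp
  next
    case 2
    then have "edge_param g z = 0" "edge_param g w = 0"
      using coord[of k 0] last[of "k + 2"] k by auto
    then show ?thesis using vertex edge_decomposition(1)[OF g] by simp
  next
    case 3
    then have "edge_param g z = 0" "edge_param g w = 0"
      using coord[of "k + 2" 0] last[of k] k by auto
    then show ?thesis using vertex edge_decomposition(1)[OF g] by simp
  qed
qed

definition disc_class :: "nat \<Rightarrow> complex \<Rightarrow> complex set" where
  "disc_class g z = polygon_gluing g `` {z}"

lemma topspace_closed_surface: "topspace (closed_surface g) = disc_class g ` cball 0 1"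
  using quotient_map_closed_surface[of g] by (auto simp: quotient_map_def disc_class_def)

lemma continuous_disc_class: "continuous_map (top_of_set (cball 0 1)) (closed_surface g) (disc_class g)"
  using quotient_imp_continuous_map[OF quotient_map_closed_surface] by (simp add: disc_class_def[abs_def])

lemma disc_class_eq_iff:
  assumes "z \<in> cball 0 1" "w \<in> cball 0 1"
  shows "disc_class g z = disc_class g w \<longleftrightarrow> equivclp (edge_pairing g) z w"
  using eq_equiv_class_iff[OF equiv_polygon_gluing assms, of g] assms
  by (auto simp: disc_class_def polygon_gluing_def)

lemma disc_class_edge_pairing: "edge_pairing g z w \<Longrightarrow> disc_class g z = disc_class g w"
  using edge_pairing_norm[of g z w] by (subst disc_class_eq_iff) (auto intro: r_into_equivclp)

lemma disc_class_some:
  assumes "z \<in> cball 0 1"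
  shows "(SOME w. w \<in> disc_class g z) \<in> cball 0 1" "equivclp (edge_pairing g) z (SOME w. w \<in> disc_class g z)"
proof -
  have "z \<in> disc_class g z" using assms by (auto simp: disc_class_def polygon_gluing_def)
  then have "(SOME w. w \<in> disc_class g z) \<in> disc_class g z" by (rule someI)
  then show "(SOME w. w \<in> disc_class g z) \<in> cball 0 1" "equivclp (edge_pairing g) z (SOME w. w \<in> disc_class g z)"
    by (auto simp: disc_class_def polygon_gluing_def)
qed

lemma openin_saturated_image:
  assumes V: "open V" and sat: "\<And>z w. edge_pairing g z w \<Longrightarrow> z \<in> V \<longleftrightarrow> w \<in> V"
  shows "openin (closed_surface g) (disc_class g ` (V \<inter> cball 0 1))"
proof -
  have *: "z \<in> V" if "z \<in> cball 0 1" "w \<in> V \<inter> cball 0 1" "disc_class g z = disc_class g w" for z w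
    using that equivclp_invariant[of "edge_pairing g" z w "\<lambda>z. z \<in> V"] sat by (auto simp: disc_class_eq_iff)
  have "{z \<in> topspace (top_of_set (cball 0 1)). disc_class g z \<in> disc_class g ` (V \<inter> cball 0 1)} = V \<inter> cball 0 1"
    unfolding topspace_euclidean_subtopology by (blast dest: *)
  moreover have "openin (top_of_set (cball 0 1)) (V \<inter> cball 0 1)"
    using V by (metis openin_open_Int inf_commute)
  moreover have "disc_class g ` (V \<inter> cball 0 1) \<subseteq> topspace (closed_surface g)"
    by (auto simp: topspace_closed_surface)
  ultimately show ?thesis
    using quotient_map_closed_surface[of g] unfolding quotient_map_def disc_class_def[symmetric] by metis
qed

section \<open>Local systems on the surface from edge labels\<close>

definition edge_loop :: "nat \<Rightarrow> nat \<Rightarrow> real \<Rightarrow> complex set" where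
  "edge_loop g k = (\<lambda>t. disc_class g (polygon_boundary g (real k + t)))"

definition boundary_product :: "('k, 'r) monoid_scheme \<Rightarrow> (nat \<Rightarrow> 'k) \<Rightarrow> nat \<Rightarrow> 'k" where
  "boundary_product K L n = foldl (\<lambda>x k. x \<otimes>\<^bsub>K\<^esub> L k) \<one>\<^bsub>K\<^esub> [0..<n]"

lemma boundary_product_0 [simp]: "boundary_product K L 0 = \<one>\<^bsub>K\<^esub>"
  by (simp add: boundary_product_def)

lemma boundary_product_Suc [simp]: "boundary_product K L (Suc n) = boundary_product K L n \<otimes>\<^bsub>K\<^esub> L n"
  by (simp add: boundary_product_def)

locale edge_labelling = group K for K (structure) +
  fixes g :: nat and L :: "nat \<Rightarrow> 'a"
  assumes genus: "g \<ge> 1"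
    and L_closed [simp]: "L k \<in> carrier K"
    and L_paired: "k mod 4 < 2 \<Longrightarrow> L (k + 2) = inv (L k)"
    and L_relation: "boundary_product K L (4 * g) = \<one>"
begin

text \<open>
  Over the inner disc the system is trivialised by the developing map \<open>dev\<close>; the trivialisation
  over the boundary graph jumps at the midpoints of the edges. Positions on an edge are measured
  in the direction of its generator, that is by \<open>t\<close> on the edges \<open>k\<close> with \<open>k mod 4 < 2\<close>
  and by \<open>1 - t\<close> on the others. On the boundary the jump may only be seen by pairs of points in
  the middle third of one edge, since a vertex neighbourhood contains points of both ends.
\<close>

definition "late k t \<longleftrightarrow> (if k mod 4 < 2 then 1/2 \<le> t else t \<le> (1/2 :: real))" for k :: nat
definition "gen_label k = (if k mod 4 < 2 then L k else inv (L k))"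
definition "gen_index k = 2 * (k div 4) + k mod 2" for k :: nat
definition "jump k t = (if late k t then gen_label k else \<one>)"
text \<open>On each edge this is the product of the labels before it on the first half, and the
  product including its own label on the second. An edge run against its generator is late on its
  first half, whence the base value at \<open>Suc k\<close>; the midpoint is late on both glued
  edges.\<close>

definition "dev k t = boundary_product K L (if k mod 4 < 2 then k else Suc k) \<otimes> jump k t"
definition "middle t \<longleftrightarrow> 1/3 < t \<and> t < (2/3 :: real)"
definition "tag k t = (if middle t then Some (gen_index k, jump k t) else None)"

text \<open>Only two points in the middle thirds of edges with the same generator can see a jump;
  for all other pairs the transport is trivial by default.\<close>

fun link :: "(nat \<times> 'a) option \<Rightarrow> (nat \<times> 'a) option \<Rightarrow> 'a" where
  "link (Some (m, x)) (Some (n, y)) = (if m = n then inv x \<otimes> y else \<one>)"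
| "link _ _ = \<one>"

definition "disc_dev z = dev (edge_index g z) (edge_param g z)"
definition "disc_tag z = tag (edge_index g z) (edge_param g z)"
text \<open>The developing map rules near the centre, the links, which respect the gluing, near the
  boundary. In between the two need to agree only locally.\<close>

definition "disc_transport y z =
  (if norm y \<le> 2/3 \<or> norm z \<le> 2/3 then inv (disc_dev y) \<otimes> disc_dev z else link (disc_tag y) (disc_tag z))"

section \<open>Jumps, developing map and links on single edges\<close>

lemma boundary_product_closed [simp]: "boundary_product K L n \<in> carrier K"
  by (induction n) auto

lemma gen_label_closed [simp]: "gen_label k \<in> carrier K"
  by (simp add: gen_label_def)

lemma jump_closed [simp]: "jump k t \<in> carrier K"
  by (simp add: jump_def)

lemma dev_closed [simp]: "dev k t \<in> carrier K" "disc_dev z \<in> carrier K"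
  by (simp_all add: dev_def disc_dev_def)

lemma link_tag_closed [simp]: "link (tag k t) (tag k' t') \<in> carrier K"
  by (simp add: tag_def)

lemma disc_transport_closed [simp]: "disc_transport y z \<in> carrier K"
  by (simp add: disc_transport_def disc_tag_def)

lemma dev_low: "t < 1/2 \<Longrightarrow> dev k t = boundary_product K L k"
  by (auto simp: dev_def jump_def late_def gen_label_def m_assoc)

lemma dev_high: "t > 1/2 \<Longrightarrow> dev k t = boundary_product K L (Suc k)"
  by (auto simp: dev_def jump_def late_def gen_label_def m_assoc)

lemma dev_middle: "inv (dev k s) \<otimes> dev k t = inv (jump k s) \<otimes> jump k t"
proof -
  let ?b = "boundary_product K L (if k mod 4 < 2 then k else Suc k)"
  have "inv (dev k s) \<otimes> dev k t = inv (jump k s) \<otimes> (inv ?b \<otimes> ?b) \<otimes> jump k t"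
    unfolding dev_def by (simp only: inv_mult_group m_assoc m_closed inv_closed boundary_product_closed jump_closed)
  then show ?thesis by simp
qed

lemma gen_label_eq:
  assumes "gen_index k = gen_index k'"
  shows "gen_label k = gen_label k'"
proof -
  have "gen_index j div 2 = j div 4" "gen_index j mod 2 = j mod 2" for j
    by (simp_all add: gen_index_def)
  then have d: "k div 4 = k' div 4" and m: "k mod 2 = k' mod 2" using assms by metis+
  have "k mod 4 mod 2 = k' mod 4 mod 2" using m by (simp add: mod_mod_cancel)
  moreover have "k mod 4 \<in> {0, 1, 2, 3}" "k' mod 4 \<in> {0, 1, 2, 3}" by auto
  ultimately have "k mod 4 = k' mod 4 \<or> (k mod 4 < 2 \<and> k' mod 4 = k mod 4 + 2) \<or> (k' mod 4 < 2 \<and> k mod 4 = k' mod 4 + 2)"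
    by auto
  moreover have "k = 4 * (k div 4) + k mod 4" by simp
  moreover have "k' = 4 * (k div 4) + k' mod 4" unfolding d by simp
  ultimately have "k = k' \<or> (k mod 4 < 2 \<and> k' = k + 2) \<or> (k' mod 4 < 2 \<and> k = k' + 2)"
    by linarith
  moreover have "\<not> (j + 2) mod 4 < 2" if "j mod 4 < 2" for j :: nat using that by presburger
  ultimately show ?thesis
    using L_paired[of k] L_paired[of k'] by (auto simp: gen_label_def)
qed

lemma tag_paired:
  assumes "k mod 4 < 2"
  shows "tag (k + 2) (1 - t) = tag k t"
proof -
  have k: "\<not> (k + 2) mod 4 < 2" "gen_index (k + 2) = gen_index k"
  proof -
    have "(k + 2) div 4 = k div 4" "(k + 2) mod 2 = k mod 2" "\<not> (k + 2) mod 4 < 2"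
      using assms by presburger+
    then show "\<not> (k + 2) mod 4 < 2" "gen_index (k + 2) = gen_index k" by (simp_all add: gen_index_def)
  qed
  then have "late (k + 2) (1 - t) \<longleftrightarrow> late k t" using assms by (auto simp: late_def)
  then show ?thesis
    using k gen_label_eq[OF k(2)] by (auto simp: tag_def jump_def middle_def)
qed

lemma link_same_side:
  assumes "late k s \<longleftrightarrow> late k' t"
  shows "link (tag k s) (tag k' t) = \<one>"
  using assms gen_label_eq[of k k'] by (auto simp: tag_def jump_def)

lemma link_not_middle: "\<not> middle s \<or> \<not> middle t \<Longrightarrow> link (tag k s) (tag k' t) = \<one>"
  by (cases "tag k s") (auto simp: tag_def)

lemma link_middle:
  "middle s \<Longrightarrow> middle t \<Longrightarrow> gen_index k = gen_index k' \<Longrightarrow> link (tag k s) (tag k' t) = inv (jump k s) \<otimes> jump k' t"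
  by (simp add: tag_def)

lemma disc_tag_boundary:
  assumes "k < 4 * g" "0 \<le> t" "t \<le> 1"
  shows "disc_tag (polygon_boundary g (real k + t)) = tag k t"
proof (cases "t = 1")
  case True
  let ?k = "Suc k mod (4 * g)"
  have "polygon_boundary g (real k + t) = of_real 1 * polygon_boundary g (real ?k + 0)"
    using polygon_boundary_mod[OF genus, of "Suc k" 0] True by (simp add: add.commute)
  moreover have "?k < 4 * g" using genus by simp
  ultimately have "edge_param g (polygon_boundary g (real k + t)) = 0"
    using edge_index_param(2)[OF genus, of 1 ?k 0] by simp
  then show ?thesis using True by (simp add: disc_tag_def tag_def middle_def)
next
  case False
  then show ?thesis
    using edge_index_param[OF genus, of 1 k t] assms by (simp add: disc_tag_def)
qed

lemma disc_tag_invariant: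
  assumes "equivclp (edge_pairing g) z w"
  shows "disc_tag w = disc_tag z \<and> norm w = norm z"
proof -
  have "disc_tag x = disc_tag y \<and> norm x = norm y" if xy: "edge_pairing g x y" for x y
  proof -
    obtain k t where k: "k + 2 < 4 * g" "k mod 4 < 2" "0 \<le> t" "t \<le> 1"
      "x = polygon_boundary g (real k + t)" "y = polygon_boundary g (real (k + 2) + (1 - t))"
      using xy by (rule edge_pairingE)
    have "disc_tag x = tag k t" unfolding k using k by (intro disc_tag_boundary) auto
    moreover have "disc_tag y = tag (k + 2) (1 - t)" unfolding k using k by (intro disc_tag_boundary) auto
    ultimately show ?thesis using tag_paired[OF k(2)] k(5,6) by simp
  qed
  then show ?thesis
    using equivclp_invariant[OF assms, of "\<lambda>x. disc_tag x = disc_tag z \<and> norm x = norm z"] by auto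
qed

text \<open>Invariance under the pairing makes the image in the surface open, so that these sets
  descend to trivialising neighbourhoods.\<close>

definition trivialised :: "complex set \<Rightarrow> bool" where
  "trivialised V \<longleftrightarrow> open V \<and> (\<forall>z w. edge_pairing g z w \<longrightarrow> z \<in> V \<longleftrightarrow> w \<in> V) \<and>
     (\<exists>\<sigma>. (\<forall>y. \<sigma> y \<in> carrier K) \<and> (\<forall>y\<in>V. \<forall>z\<in>V. disc_transport y z = inv (\<sigma> y) \<otimes> \<sigma> z))"

lemma trivialised_centre: "trivialised (ball 0 (2/3))"
  unfolding trivialised_def using edge_pairing_norm
  by (intro conjI exI[of _ disc_dev]) (force simp: disc_transport_def)+

text \<open>Where the links agree with the developing map, \<open>disc_dev\<close> trivialises both
  prescriptions of \<open>disc_transport\<close>. Only points of norm 1 are glued, so the set is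
  saturated.\<close>

lemma trivialised_interior:
  assumes open_P: "open (edge_region g P)"
    and link: "\<And>k t k' t'. k < 4 * g \<Longrightarrow> k' < 4 * g \<Longrightarrow> P k t \<Longrightarrow> P k' t' \<Longrightarrow>
      link (tag k t) (tag k' t') = inv (dev k t) \<otimes> dev k' t'"
  shows "trivialised (ball 0 1 \<inter> edge_region g P)"
proof -
  have "disc_transport y z = inv (disc_dev y) \<otimes> disc_dev z"
    if "P (edge_index g y) (edge_param g y)" "P (edge_index g z) (edge_param g z)" for y z
    using link[OF edge_decomposition(1)[OF genus] edge_decomposition(1)[OF genus] that]
    by (simp add: disc_transport_def disc_tag_def disc_dev_def)
  then show ?thesis
    unfolding trivialised_def using edge_pairing_norm open_P
    by (intro conjI exI[of _ disc_dev] open_Int) force+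
qed

text \<open>Beyond radius 2/3 only the links count. They need a section \<sigma> of their own, since
  the developing map does not respect the gluing.\<close>

lemma trivialised_boundary:
  assumes open_P: "open (edge_region g P)"
    and pair: "\<And>k t. k + 2 < 4 * g \<Longrightarrow> k mod 4 < 2 \<Longrightarrow> 0 < t \<Longrightarrow> t < 1 \<Longrightarrow> P k t \<longleftrightarrow> P (k + 2) (1 - t)"
    and vertex: "\<And>k k'. k < 4 * g \<Longrightarrow> k' < 4 * g \<Longrightarrow> P k 0 \<longleftrightarrow> P k' 0"
    and \<sigma>: "\<And>k t. \<sigma> k t \<in> carrier K"
    and link: "\<And>k t k' t'. k < 4 * g \<Longrightarrow> k' < 4 * g \<Longrightarrow> P k t \<Longrightarrow> P k' t' \<Longrightarrow>
      link (tag k t) (tag k' t') = inv (\<sigma> k t) \<otimes> \<sigma> k' t'"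
  shows "trivialised (- cball 0 (2/3) \<inter> edge_region g P)"
proof -
  have "P (edge_index g z) (edge_param g z) \<longleftrightarrow> P (edge_index g w) (edge_param g w)"
    if "edge_pairing g z w" for z w
    by (rule edge_region_saturated[where P = P, OF genus that pair vertex])
  moreover have "disc_transport y z = inv (\<sigma> (edge_index g y) (edge_param g y)) \<otimes> \<sigma> (edge_index g z) (edge_param g z)"
    if "P (edge_index g y) (edge_param g y)" "P (edge_index g z) (edge_param g z)" "norm y > 2/3" "norm z > 2/3" for y z
    using link[OF edge_decomposition(1)[OF genus] edge_decomposition(1)[OF genus] that(1,2)] that
    by (simp add: disc_transport_def disc_tag_def)
  ultimately show ?thesis
    unfolding trivialised_def using edge_pairing_norm open_P \<sigma>
    by (intro conjI exI[of _ "\<lambda>z. \<sigma> (edge_index g z) (edge_param g z)"] open_Int) fastforce+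
qed

lemma trivialised_exists_interior:
  assumes z: "2/3 \<le> norm z" "norm z < 1"
  shows "\<exists>V. z \<in> V \<and> trivialised V"
proof -
  define k where "k = edge_index g z"
  define t where "t = edge_param g z"
  have kt: "k < 4 * g" "0 \<le> t" "t < 1"
    using edge_decomposition[OF genus, of z] by (simp_all add: k_def t_def)
  have nz: "z \<noteq> 0" "z \<in> ball 0 1" using z by auto
  consider "t = 0" | "0 < t" "t < 1/2" | "t = 1/2" | "1/2 < t" using kt by linarith
  then show ?thesis
  proof cases
    case 1
    let ?k' = "(k + 4 * g - 1) mod (4 * g)"
    define P where "P j s \<longleftrightarrow> (j = k \<and> s < 1/3) \<or> (j = ?k' \<and> s > (2/3::real))" for j s
    \<comment> \<open>The boundary relation enters here: across the ray through vertex 0 the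
      developing map passes from the full boundary product back to \<one>.\<close>
    have k': "boundary_product K L (Suc ?k') = boundary_product K L k"
    proof (cases "k = 0")
      case True
      then have "Suc ?k' = 4 * g" using genus by simp
      then show ?thesis using True L_relation by (simp only: boundary_product_0)
    next
      case False
      then have "k + 4 * g - 1 = (k - 1) + 4 * g" by simp
      then have "?k' = (k - 1) mod (4 * g)" by (simp only: mod_add_self2)
      then have "?k' = k - 1" using kt by (simp only: mod_less less_imp_diff_less)
      then show ?thesis using False by (simp del: boundary_product_Suc)
    qed
    have op: "open (edge_region g P)"
    proof (rule open_edge_region[OF genus])
      fix j s assume "P j s" "0 < s" "s < (1::real)"
      then show "\<exists>e>0. \<forall>t'. \<bar>t' - s\<bar> < e \<longrightarrow> P j t'"
        by (intro exI[of _ "if s < 1/3 then 1/3 - s else s - 2/3"]) (auto simp: P_def)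
    next
      fix j assume "P j 0"
      then show "\<exists>e>0. \<forall>t. 0 \<le> t \<longrightarrow> t < e \<longrightarrow> P j t \<and> P ((j + 4 * g - 1) mod (4 * g)) (1 - t) \<or> t = 0"
        by (intro exI[of _ "1/3"]) (auto simp: P_def)
    qed
    have dev_P: "dev j s = boundary_product K L k" if "P j s" for j s
      using that dev_low[of s j] dev_high[of s j] k' by (auto simp: P_def simp del: boundary_product_Suc)
    have "trivialised (ball 0 1 \<inter> edge_region g P)"
    proof (rule trivialised_interior[OF op])
      fix j s j' s' assume "P j s" "P j' s'"
      then show "link (tag j s) (tag j' s') = inv (dev j s) \<otimes> dev j' s'"
        using dev_P by (subst link_not_middle) (auto simp: P_def middle_def)
    qed
    moreover have "P k t" using 1 by (simp add: P_def)
    ultimately show ?thesis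
      using nz unfolding k_def t_def
      by (intro exI[of _ "ball 0 1 \<inter> edge_region g P"]) simp
  next
    case 2
    define P where "P j s \<longleftrightarrow> j = k \<and> 0 < s \<and> s < (1/2::real)" for j s
    have op: "open (edge_region g P)"
    proof (rule open_edge_region[OF genus])
      fix j s assume "P j s"
      then show "\<exists>e>0. \<forall>t'. \<bar>t' - s\<bar> < e \<longrightarrow> P j t'"
        by (intro exI[of _ "min s (1/2 - s)"]) (auto simp: P_def)
    qed (simp add: P_def)
    have "trivialised (ball 0 1 \<inter> edge_region g P)"
    proof (rule trivialised_interior[OF op])
      fix j s j' s' assume "P j s" "P j' s'"
      then show "link (tag j s) (tag j' s') = inv (dev j s) \<otimes> dev j' s'"
        using dev_low by (subst link_same_side) (auto simp: P_def late_def)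
    qed
    moreover have "P k t" using 2 by (simp add: P_def)
    ultimately show ?thesis
      using nz unfolding k_def t_def
      by (intro exI[of _ "ball 0 1 \<inter> edge_region g P"]) simp
  next
    case 3
    define P where "P j s \<longleftrightarrow> j = k \<and> middle s" for j s
    have op: "open (edge_region g P)"
    proof (rule open_edge_region[OF genus])
      fix j s assume "P j s"
      then show "\<exists>e>0. \<forall>t'. \<bar>t' - s\<bar> < e \<longrightarrow> P j t'"
        by (intro exI[of _ "min (s - 1/3) (2/3 - s)"]) (auto simp: P_def middle_def)
    qed (simp add: P_def middle_def)
    have "trivialised (ball 0 1 \<inter> edge_region g P)"
    proof (rule trivialised_interior[OF op])
      fix j s j' s' assume "P j s" "P j' s'"
      then show "link (tag j s) (tag j' s') = inv (dev j s) \<otimes> dev j' s'"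
        using dev_middle by (subst link_middle) (auto simp: P_def)
    qed
    moreover have "P k t" using 3 by (simp add: P_def middle_def)
    ultimately show ?thesis
      using nz unfolding k_def t_def
      by (intro exI[of _ "ball 0 1 \<inter> edge_region g P"]) simp
  next
    case 4
    define P where "P j s \<longleftrightarrow> j = k \<and> (1/2::real) < s" for j s
    have op: "open (edge_region g P)"
    proof (rule open_edge_region[OF genus])
      fix j s assume "P j s"
      then show "\<exists>e>0. \<forall>t'. \<bar>t' - s\<bar> < e \<longrightarrow> P j t'"
        by (intro exI[of _ "s - 1/2"]) (auto simp: P_def)
    qed (simp add: P_def)
    have "trivialised (ball 0 1 \<inter> edge_region g P)"
    proof (rule trivialised_interior[OF op])
      fix j s j' s' assume "P j s" "P j' s'"
      then show "link (tag j s) (tag j' s') = inv (dev j s) \<otimes> dev j' s'"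
        using dev_high by (subst link_same_side) (auto simp: P_def late_def simp del: boundary_product_Suc)
    qed
    moreover have "P k t" using 4 by (simp add: P_def)
    ultimately show ?thesis
      using nz unfolding k_def t_def
      by (intro exI[of _ "ball 0 1 \<inter> edge_region g P"]) simp
  qed
qed

lemma trivialised_exists_boundary:
  assumes z: "norm z = 1"
  shows "\<exists>V. z \<in> V \<and> trivialised V"
proof -
  define k where "k = edge_index g z"
  define t where "t = edge_param g z"
  have kt: "k < 4 * g" "0 \<le> t" "t < 1"
    using edge_decomposition[OF genus, of z] by (simp_all add: k_def t_def)
  have nz: "z \<noteq> 0" "z \<in> - cball 0 (2/3)" using z by auto
  have flip: "\<not> (j + 2) mod 4 < 2" if "j mod 4 < 2" for j :: nat using that by presburger
  consider "t = 0" | "t = 1/2" | "0 < t" "t \<noteq> 1/2" using kt by linarith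
  then show ?thesis
  proof cases
    case 1
    \<comment> \<open>All edge ends at once, since the vertices form a single class; outside the
      middle thirds no jump is seen.\<close>
    define P where "P j s \<longleftrightarrow> s < 1/3 \<or> s > (2/3::real)" for j :: nat and s
    have op: "open (edge_region g P)"
    proof (rule open_edge_region[OF genus])
      fix j s assume "P j s"
      then show "\<exists>e>0. \<forall>t'. \<bar>t' - s\<bar> < e \<longrightarrow> P j t'"
        by (intro exI[of _ "if s < 1/3 then 1/3 - s else s - 2/3"]) (auto simp: P_def)
    next
      fix j show "\<exists>e>0. \<forall>t. 0 \<le> t \<longrightarrow> t < e \<longrightarrow> P j t \<and> P ((j + 4 * g - 1) mod (4 * g)) (1 - t) \<or> t = 0"
        by (intro exI[of _ "1/3"]) (auto simp: P_def)
    qed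
    have "trivialised (- cball 0 (2/3) \<inter> edge_region g P)"
    proof (rule trivialised_boundary[OF op, where \<sigma> = "\<lambda>_ _. \<one>"])
      show "link (tag j s) (tag j' s') = inv \<one> \<otimes> \<one>" if "P j s" "P j' s'" for j s j' s'
        using that by (subst link_not_middle) (auto simp: P_def middle_def)
    qed (auto simp: P_def)
    moreover have "P k t" using 1 by (simp add: P_def)
    ultimately show ?thesis
      using nz unfolding k_def t_def
      by (intro exI[of _ "- cball 0 (2/3) \<inter> edge_region g P"]) simp
  next
    case 2
    \<comment> \<open>Both edges carrying the generator are taken; \<open>jump\<close> takes equal
      values at glued points because it depends only on the generator and the side of the
      cut.\<close>
    define P where "P j s \<longleftrightarrow> gen_index j = gen_index k \<and> middle s" for j s
    have op: "open (edge_region g P)"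
    proof (rule open_edge_region[OF genus])
      fix j s assume "P j s"
      then show "\<exists>e>0. \<forall>t'. \<bar>t' - s\<bar> < e \<longrightarrow> P j t'"
        by (intro exI[of _ "min (s - 1/3) (2/3 - s)"]) (auto simp: P_def middle_def)
    qed (simp add: P_def middle_def)
    have gi: "gen_index (j + 2) = gen_index j" if "j mod 4 < 2" for j
      using tag_paired[OF that, of "1/2"] by (simp add: tag_def middle_def)
    have "trivialised (- cball 0 (2/3) \<inter> edge_region g P)"
    proof (rule trivialised_boundary[OF op, where \<sigma> = jump])
      show "P j s \<longleftrightarrow> P (j + 2) (1 - s)" if "j mod 4 < 2" for j s
        using gi[OF that] by (auto simp: P_def middle_def)
      show "link (tag j s) (tag j' s') = inv (jump j s) \<otimes> jump j' s'" if "P j s" "P j' s'" for j s j' s'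
        using that by (subst link_middle) (auto simp: P_def)
    qed (auto simp: P_def middle_def)
    moreover have "P k t" using 2 by (simp add: P_def middle_def)
    ultimately show ?thesis
      using nz unfolding k_def t_def
      by (intro exI[of _ "- cball 0 (2/3) \<inter> edge_region g P"]) simp
  next
    case 3
    \<comment> \<open>The open halves of all edges on the same side of their cuts may be taken
      together, because the links between them are trivial.\<close>
    define P where "P j s \<longleftrightarrow> 0 < s \<and> s < 1 \<and> s \<noteq> 1/2 \<and> (late j s \<longleftrightarrow> late k t)" for j and s :: real
    have op: "open (edge_region g P)"
    proof (rule open_edge_region[OF genus])
      fix j s assume P: "P j s"
      have *: "P j t'" if "\<bar>t' - s\<bar> < min (min s (1 - s)) \<bar>s - 1/2\<bar>" for t'
      proof -
        have "0 < t'" "t' < 1" "t' \<noteq> 1/2" "1/2 \<le> t' \<longleftrightarrow> 1/2 \<le> s" "t' \<le> 1/2 \<longleftrightarrow> s \<le> 1/2"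
          using that by (auto simp: abs_if split: if_splits)
        then show ?thesis using P unfolding P_def late_def by auto
      qed
      moreover have "min (min s (1 - s)) \<bar>s - 1/2\<bar> > 0" using P by (auto simp: P_def)
      ultimately show "\<exists>e>0. \<forall>t'. \<bar>t' - s\<bar> < e \<longrightarrow> P j t'" by blast
    qed (simp add: P_def)
    have "trivialised (- cball 0 (2/3) \<inter> edge_region g P)"
    proof (rule trivialised_boundary[OF op, where \<sigma> = "\<lambda>_ _. \<one>"])
      show "P j s \<longleftrightarrow> P (j + 2) (1 - s)" if "j mod 4 < 2" for j s
      proof -
        have "late (j + 2) (1 - s) \<longleftrightarrow> late j s" using that flip[OF that] by (auto simp: late_def)
        then show ?thesis by (auto simp: P_def)
      qed
      show "link (tag j s) (tag j' s') = inv \<one> \<otimes> \<one>" if "P j s" "P j' s'" for j s j' s'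
        using that by (subst link_same_side) (auto simp: P_def)
    qed (auto simp: P_def)
    moreover have "P k t" using 3 kt by (simp add: P_def)
    ultimately show ?thesis
      using nz unfolding k_def t_def
      by (intro exI[of _ "- cball 0 (2/3) \<inter> edge_region g P"]) simp
  qed
qed

lemma trivialised_exists:
  assumes "z \<in> cball 0 1"
  shows "\<exists>V. z \<in> V \<and> trivialised V"
proof -
  consider "norm z < 2/3" | "2/3 \<le> norm z" "norm z < 1" | "norm z = 1" using assms by fastforce
  then show ?thesis
    using trivialised_centre trivialised_exists_interior trivialised_exists_boundary
    by cases (auto intro!: exI[of _ "ball 0 (2/3)"])
qed

text \<open>The arbitrary representatives do no harm: every representative of a point in the image
  of a saturated set lies in that set, where the transport is trivialised.\<close>

definition "surface_transport X Y = disc_transport (SOME y. y \<in> X) (SOME z. z \<in> Y)"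

lemma transport_system_surface: "transport_system K (closed_surface g) surface_transport"
  unfolding transport_system_def
proof (intro conjI allI ballI)
  show "surface_transport x y \<in> carrier K" for x y by (simp add: surface_transport_def)
  fix x assume "x \<in> topspace (closed_surface g)"
  then obtain z where z: "z \<in> cball 0 1" "x = disc_class g z" by (auto simp: topspace_closed_surface)
  obtain V \<sigma> where V: "z \<in> V" "open V" "\<And>z w. edge_pairing g z w \<Longrightarrow> z \<in> V \<longleftrightarrow> w \<in> V"
    "\<And>y. \<sigma> y \<in> carrier K" "\<And>y z. y \<in> V \<Longrightarrow> z \<in> V \<Longrightarrow> disc_transport y z = inv (\<sigma> y) \<otimes> \<sigma> z"
    using trivialised_exists[OF z(1)] unfolding trivialised_def by metis
  have some: "(SOME y. y \<in> Y) \<in> V" if Y: "Y \<in> disc_class g ` (V \<inter> cball 0 1)" for Y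
  proof -
    obtain y where y: "y \<in> V" "y \<in> cball 0 1" "Y = disc_class g y" using Y by blast
    show ?thesis
      using equivclp_invariant[OF disc_class_some(2)[OF y(2), of g], of "\<lambda>z. z \<in> V"] V(3) y by blast
  qed
  show "\<exists>V \<sigma>. openin (closed_surface g) V \<and> x \<in> V \<and> (\<forall>y. \<sigma> y \<in> carrier K) \<and>
      (\<forall>y\<in>V. \<forall>z\<in>V. surface_transport y z = inv (\<sigma> y) \<otimes> \<sigma> z)"
  proof (intro exI conjI ballI allI)
    show "openin (closed_surface g) (disc_class g ` (V \<inter> cball 0 1))"
      using V(2,3) by (rule openin_saturated_image)
    show "x \<in> disc_class g ` (V \<inter> cball 0 1)" using z V(1) by blast
    show "\<sigma> (SOME z. z \<in> y) \<in> carrier K" for y by (rule V(4))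
    show "surface_transport y z = inv (\<sigma> (SOME z. z \<in> y)) \<otimes> \<sigma> (SOME y. y \<in> z)"
      if "y \<in> disc_class g ` (V \<inter> cball 0 1)" "z \<in> disc_class g ` (V \<inter> cball 0 1)" for y z
      unfolding surface_transport_def using some[OF that(1)] some[OF that(2)] by (rule V(5))
  qed
qed

lemma holonomy_edge_loop:
  assumes k: "k < 4 * g"
  shows "holonomy K surface_transport (edge_loop g k) (L k)"
proof -
  have st: "surface_transport (edge_loop g k s) (edge_loop g k t) = link (tag k s) (tag k t)"
    if "s \<in> {0..1}" "t \<in> {0..1}" for s t
  proof -
    have "disc_tag (SOME w. w \<in> edge_loop g k r) = tag k r \<and> norm (SOME w. w \<in> edge_loop g k r) = 1"
      if "r \<in> {0..1}" for r
      using disc_tag_invariant[OF disc_class_some(2)[OF polygon_boundary_cball, of g g "real k + r"]]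
        disc_tag_boundary[OF k, of r] that by (simp add: edge_loop_def)
    with that show ?thesis by (simp add: surface_transport_def disc_transport_def)
  qed
  have "parallel_on K surface_transport {0..1} (edge_loop g k) (jump k)"
  \<comment> \<open>Points on different sides of the midpoint at distance below 1/6 both lie in the
    middle third, where the links see the jump.\<close>
  proof (rule parallel_onI[where d = "1/6"])
    fix s t :: real assume s: "s \<in> {0..1}" and t: "t \<in> {0..1}" and d: "dist s t < 1/6"
    have "jump k t = jump k s \<otimes> link (tag k s) (tag k t)"
    proof (cases "middle s \<and> middle t")
      case True
      then show ?thesis by (simp add: link_middle m_assoc[symmetric])
    next
      case False
      then have "late k s \<longleftrightarrow> late k t"
        using d unfolding middle_def late_def dist_real_def by (auto simp: abs_if split: if_splits)
      then have "jump k t = jump k s" by (simp add: jump_def)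
      then show ?thesis using False by (simp add: link_not_middle)
    qed
    then show "jump k t = jump k s \<otimes> surface_transport (edge_loop g k s) (edge_loop g k t)"
      by (simp add: st[OF s t])
  qed auto
  from holonomyI[OF transport_system_surface this]
  have "holonomy K surface_transport (edge_loop g k) (inv (jump k 0) \<otimes> jump k 1)" .
  also have "inv (jump k 0) \<otimes> jump k 1 = L k"
    by (simp add: jump_def late_def gen_label_def)
  finally show ?thesis .
qed

end

section \<open>Homotopies of paths with fixed end points\<close>

definition path_homotopic :: "'a topology \<Rightarrow> 'a \<Rightarrow> 'a \<Rightarrow> (real \<Rightarrow> 'a) \<Rightarrow> (real \<Rightarrow> 'a) \<Rightarrow> bool" where
  "path_homotopic X x y p q \<longleftrightarrow>
     homotopic_with (\<lambda>l. l 0 = x \<and> l 1 = y) (top_of_set {0..1}) X p q"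

lemma loop_homotopic_eq: "loop_homotopic X x = path_homotopic X x x"
  by (simp add: fun_eq_iff loop_homotopic_def path_homotopic_def)

lemma path_homotopic_sym: "path_homotopic X x y p q \<Longrightarrow> path_homotopic X x y q p"
  unfolding path_homotopic_def by (rule homotopic_with_symD)

lemma path_homotopic_trans [trans]:
  "path_homotopic X x y p q \<Longrightarrow> path_homotopic X x y q r \<Longrightarrow> path_homotopic X x y p r"
  unfolding path_homotopic_def by (rule homotopic_with_trans)

lemma path_homotopic_refl: "path_homotopic X x y p p \<longleftrightarrow> pathin X p \<and> p 0 = x \<and> p 1 = y"
  unfolding path_homotopic_def pathin_def by simp

lemma path_homotopic_imp:
  assumes "path_homotopic X x y p q"
  shows "pathin X p" "p 0 = x" "p 1 = y" "pathin X q" "q 0 = x" "q 1 = y"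
proof -
  have "path_homotopic X x y p p" "path_homotopic X x y q q"
    by (meson assms path_homotopic_sym path_homotopic_trans)+
  then show "pathin X p" "p 0 = x" "p 1 = y" "pathin X q" "q 0 = x" "q 1 = y"
    by (simp_all add: path_homotopic_refl)
qed

text \<open>The straight-line homotopy in a convex parameter space, pushed forward by
  \<open>F\<close>. Intervals give reparametrisations and subdivisions, the disc gives homotopies on
  the surface, the square gives the deformation of short paths.\<close>

lemma path_homotopic_convex:
  fixes S :: "'e::real_normed_vector set"
  assumes F: "continuous_map (top_of_set S) X F" and S: "convex S"
    and \<phi>: "continuous_on {0..1} \<phi>" "\<And>t. t \<in> {0..1} \<Longrightarrow> \<phi> t \<in> S"
    and \<psi>: "continuous_on {0..1} \<psi>" "\<And>t. t \<in> {0..1} \<Longrightarrow> \<psi> t \<in> S"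
    and ends: "\<phi> 0 = \<psi> 0" "\<phi> 1 = \<psi> 1" "F (\<phi> 0) = x" "F (\<phi> 1) = y"
  shows "path_homotopic X x y (\<lambda>t. F (\<phi> t)) (\<lambda>t. F (\<psi> t))"
proof -
  let ?I = "top_of_set {0..1::real}"
  define m where "m = (\<lambda>z::real \<times> real. (1 - fst z) *\<^sub>R \<phi> (snd z) + fst z *\<^sub>R \<psi> (snd z))"
  have P: "prod_topology ?I ?I = top_of_set ({0..1} \<times> {0..1})"
    by (simp add: prod_topology_subtopology subtopology_subtopology Times_Int_Times)
  have "m z \<in> S" if "z \<in> {0..1} \<times> {0..1}" for z
    unfolding m_def using that \<phi> \<psi> by (intro convexD_alt[OF S]) auto
  moreover have "continuous_on ({0..1} \<times> {0..1}) m"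
    unfolding m_def
    by (intro continuous_intros continuous_on_compose2[OF \<phi>(1)] continuous_on_compose2[OF \<psi>(1)]) auto
  ultimately have "continuous_map (prod_topology ?I ?I) (top_of_set S) m"
    unfolding P by auto
  from continuous_map_compose[OF this F]
  have "continuous_map (prod_topology ?I ?I) X (F \<circ> m)" .
  moreover have "m (t, 0) = \<phi> 0" "m (t, 1) = \<phi> 1" "m (0, t) = \<phi> t" "m (1, t) = \<psi> t" for t
    unfolding m_def using ends by (simp_all add: scaleR_left.diff)
  ultimately show ?thesis
    unfolding path_homotopic_def homotopic_with_def
    using ends by (intro exI[of _ "F \<circ> m"]) simp
qed

lemma path_homotopic_reparam:
  assumes p: "pathin X p"
    and "continuous_on {0..1} \<phi>" "\<And>t. t \<in> {0..1} \<Longrightarrow> \<phi> t \<in> {0..1::real}"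
    and "continuous_on {0..1} \<psi>" "\<And>t. t \<in> {0..1} \<Longrightarrow> \<psi> t \<in> {0..1::real}"
    and "\<phi> 0 = \<psi> 0" "\<phi> 1 = \<psi> 1" "p (\<phi> 0) = x" "p (\<phi> 1) = y"
  shows "path_homotopic X x y (\<lambda>t. p (\<phi> t)) (\<lambda>t. p (\<psi> t))"
  using assms by (intro path_homotopic_convex[of "{0..1::real}"]) (auto simp: pathin_def)

lemma path_homotopic_concat:
  assumes "path_homotopic X x y p p'" "path_homotopic X y w q q'"
  shows "path_homotopic X x w (loop_concat p q) (loop_concat p' q')"
proof -
  let ?I = "top_of_set {0..1::real}"
  obtain h where h: "continuous_map (prod_topology ?I ?I) X h"
    "\<And>s. h (0, s) = p s" "\<And>s. h (1, s) = p' s" "\<And>t. t \<in> {0..1} \<Longrightarrow> h (t, 0) = x \<and> h (t, 1) = y"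
    using assms(1) unfolding path_homotopic_def homotopic_with_def by auto
  obtain k where k: "continuous_map (prod_topology ?I ?I) X k"
    "\<And>s. k (0, s) = q s" "\<And>s. k (1, s) = q' s" "\<And>t. t \<in> {0..1} \<Longrightarrow> k (t, 0) = y \<and> k (t, 1) = w"
    using assms(2) unfolding path_homotopic_def homotopic_with_def by auto
  define m where "m = (\<lambda>z::real \<times> real. if snd z \<le> 1/2 then h (fst z, 2 * snd z) else k (fst z, 2 * snd z - 1))"
  have P: "prod_topology ?I ?I = top_of_set ({0..1} \<times> {0..1})"
    by (simp add: prod_topology_subtopology subtopology_subtopology Times_Int_Times)
  have "continuous_map (prod_topology ?I ?I) X m"
    unfolding m_def
  proof (rule continuous_map_cases_le)
    show "continuous_map (prod_topology ?I ?I) euclideanreal snd"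
      "continuous_map (prod_topology ?I ?I) euclideanreal (\<lambda>z. 1/2)"
      unfolding P by (auto intro!: continuous_intros)
    have "continuous_map (subtopology (prod_topology ?I ?I) {z \<in> topspace (prod_topology ?I ?I). snd z \<le> 1/2})
       (prod_topology ?I ?I) (\<lambda>z. (fst z, 2 * snd z))"
      unfolding P by (auto simp: subtopology_subtopology intro!: continuous_intros)
    from continuous_map_compose[OF this h(1)]
    show "continuous_map (subtopology (prod_topology ?I ?I) {z \<in> topspace (prod_topology ?I ?I). snd z \<le> 1/2})
       X (\<lambda>z. h (fst z, 2 * snd z))" by (simp add: o_def)
    have "continuous_map (subtopology (prod_topology ?I ?I) {z \<in> topspace (prod_topology ?I ?I). 1/2 \<le> snd z})
       (prod_topology ?I ?I) (\<lambda>z. (fst z, 2 * snd z - 1))"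
      unfolding P by (auto simp: subtopology_subtopology intro!: continuous_intros)
    from continuous_map_compose[OF this k(1)]
    show "continuous_map (subtopology (prod_topology ?I ?I) {z \<in> topspace (prod_topology ?I ?I). 1/2 \<le> snd z})
       X (\<lambda>z. k (fst z, 2 * snd z - 1))" by (simp add: o_def)
  next
    fix z assume "z \<in> topspace (prod_topology ?I ?I)" "snd z = 1/2"
    then have "fst z \<in> {0..1}" "2 * snd z = 1" "2 * snd z - 1 = 0" by auto
    then show "h (fst z, 2 * snd z) = k (fst z, 2 * snd z - 1)" using h(4) k(4) by metis
  qed
  then show ?thesis
    unfolding path_homotopic_def homotopic_with_def
    by (intro exI[of _ m]) (auto simp: m_def loop_concat_def h k)
qed

lemma pathin_concat:
  assumes "pathin X p" "pathin X q" "p 1 = q 0"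
  shows "pathin X (loop_concat p q)"
proof -
  have "path_homotopic X (p 0) (q 0) p p" "path_homotopic X (q 0) (q 1) q q"
    using assms by (simp_all add: path_homotopic_refl)
  from path_homotopic_concat[OF this] show ?thesis by (rule path_homotopic_imp)
qed

lemma loop_concat_ends [simp]: "loop_concat p q 0 = p 0" "loop_concat p q 1 = q 1"
  by (simp_all add: loop_concat_def)

lemma path_homotopic_concat_refl:
  assumes "pathin X p" "p 0 = x" "p 1 = y" "path_homotopic X y w q q'"
  shows "path_homotopic X x w (loop_concat p q) (loop_concat p q')"
  using assms by (intro path_homotopic_concat) (auto simp: path_homotopic_refl)

lemma path_homotopic_assoc:
  assumes "pathin X p" "pathin X q" "pathin X r" "p 1 = q 0" "q 1 = r 0"
  shows "path_homotopic X (p 0) (r 1) (loop_concat (loop_concat p q) r) (loop_concat p (loop_concat q r))"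
proof -
  define \<phi> :: "real \<Rightarrow> real" where
    "\<phi> = (\<lambda>t. if t \<le> 1/2 then (if t \<le> 1/4 then 2 * t else t + 1/4) else t / 2 + 1/2)"
  have "continuous_on {0..1} \<phi>"
    unfolding \<phi>_def by (intro cont_if continuous_intros) auto
  then have "path_homotopic X (p 0) (r 1) (\<lambda>t. loop_concat p (loop_concat q r) (\<phi> t)) (\<lambda>t. loop_concat p (loop_concat q r) t)"
    using assms by (intro path_homotopic_reparam pathin_concat) (auto simp: \<phi>_def loop_concat_def)
  moreover have "(\<lambda>t. loop_concat p (loop_concat q r) (\<phi> t)) = loop_concat (loop_concat p q) r"
  proof
    fix t :: real
    consider "t \<le> 1/4" | "1/4 < t" "t \<le> 1/2" | "1/2 < t" by linarith
    then show "loop_concat p (loop_concat q r) (\<phi> t) = loop_concat (loop_concat p q) r t"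
    proof cases
      case 1 then show ?thesis by (simp add: loop_concat_def \<phi>_def)
    next
      case 2
      have "2 * (2 * (t + 1/4) - 1) = 2 * (2 * t) - 1" by simp
      with 2 show ?thesis by (simp add: loop_concat_def \<phi>_def)
    next
      case 3
      have "2 * (2 * (t / 2 + 1/2) - 1) - 1 = 2 * t - 1" by simp
      with 3 show ?thesis by (simp add: loop_concat_def \<phi>_def)
    qed
  qed
  ultimately show ?thesis by simp
qed

lemma path_homotopic_right_unit:
  assumes "pathin X p"
  shows "path_homotopic X (p 0) (p 1) (loop_concat p (\<lambda>_. p 1)) p"
proof -
  define \<phi> :: "real \<Rightarrow> real" where "\<phi> = (\<lambda>t. if t \<le> 1/2 then 2 * t else 1)"
  have "continuous_on {0..1} \<phi>"
    unfolding \<phi>_def by (intro cont_if continuous_intros) auto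
  then have "path_homotopic X (p 0) (p 1) (\<lambda>t. p (\<phi> t)) (\<lambda>t. p t)"
    using assms by (intro path_homotopic_reparam) (auto simp: \<phi>_def)
  moreover have "(\<lambda>t. p (\<phi> t)) = loop_concat p (\<lambda>_. p 1)"
    by (auto simp: loop_concat_def \<phi>_def)
  ultimately show ?thesis by simp
qed

lemma path_homotopic_reverse:
  assumes "path_homotopic X x y p q"
  shows "path_homotopic X y x (\<lambda>t. p (1 - t)) (\<lambda>t. q (1 - t))"
proof -
  let ?I = "top_of_set {0..1::real}"
  obtain h where h: "continuous_map (prod_topology ?I ?I) X h"
    "\<And>s. h (0, s) = p s" "\<And>s. h (1, s) = q s" "\<And>t. t \<in> {0..1} \<Longrightarrow> h (t, 0) = x \<and> h (t, 1) = y"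
    using assms unfolding path_homotopic_def homotopic_with_def by auto
  have P: "prod_topology ?I ?I = top_of_set ({0..1} \<times> {0..1})"
    by (simp add: prod_topology_subtopology subtopology_subtopology Times_Int_Times)
  have "continuous_map (prod_topology ?I ?I) (prod_topology ?I ?I) (\<lambda>z. (fst z, 1 - snd z))"
    unfolding P by (auto intro!: continuous_intros)
  from continuous_map_compose[OF this h(1)]
  have "continuous_map (prod_topology ?I ?I) X (\<lambda>z. h (fst z, 1 - snd z))" by (simp add: o_def)
  then show ?thesis
    unfolding path_homotopic_def homotopic_with_def
    by (intro exI[of _ "\<lambda>z. h (fst z, 1 - snd z)"]) (auto simp: h)
qed

section \<open>Subpaths and their concatenation\<close>

definition subpath :: "(real \<Rightarrow> 'a) \<Rightarrow> real \<Rightarrow> real \<Rightarrow> real \<Rightarrow> 'a" where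
  "subpath p a b = (\<lambda>t. p (a + (b - a) * t))"

lemma subpath_ends [simp]: "subpath p a b 0 = p a" "subpath p a b 1 = p b"
  by (simp_all add: subpath_def)

lemma subpath_reverse: "(\<lambda>t. subpath p a b (1 - t)) = subpath p b a"
  by (auto simp: subpath_def algebra_simps)

lemma subpath_in_convex:
  assumes "convex S" "a \<in> S" "b \<in> S" "t \<in> {0..1::real}"
  shows "a + (b - a) * t \<in> (S :: real set)"
  using convexD_alt[OF assms(1-3), of t] assms(4) by (simp add: algebra_simps)

lemma pathin_subpath:
  assumes "continuous_map (top_of_set S) X p" "convex S" "a \<in> S" "b \<in> S"
  shows "pathin X (subpath p a b)"
proof -
  have "path_homotopic X (p a) (p b) (\<lambda>t. p (a + (b - a) * t)) (\<lambda>t. p (a + (b - a) * t))"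
    using assms by (intro path_homotopic_convex[OF assms(1,2)] subpath_in_convex continuous_intros) auto
  then show ?thesis unfolding subpath_def by (rule path_homotopic_imp)
qed

lemma path_homotopic_subpath_concat:
  assumes p: "continuous_map (top_of_set S) X p" "convex S" and S: "a \<in> S" "b \<in> S" "c \<in> S"
  shows "path_homotopic X (p a) (p c) (subpath p a c) (loop_concat (subpath p a b) (subpath p b c))"
proof -
  define \<phi> :: "real \<Rightarrow> real" where
    "\<phi> = (\<lambda>t. if t \<le> 1/2 then a + (b - a) * (2 * t) else b + (c - b) * (2 * t - 1))"
  have "continuous_on {0..1} \<phi>"
    unfolding \<phi>_def by (intro cont_if continuous_intros) auto
  moreover have "\<phi> t \<in> S" if "t \<in> {0..1}" for t
    unfolding \<phi>_def using that p(2) S by (auto intro!: subpath_in_convex)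
  ultimately have "path_homotopic X (p a) (p c) (\<lambda>t. p (a + (c - a) * t)) (\<lambda>t. p (\<phi> t))"
    using S by (intro path_homotopic_convex[OF p] subpath_in_convex[OF p(2)] continuous_intros) (auto simp: \<phi>_def)
  moreover have "(\<lambda>t. p (\<phi> t)) = loop_concat (subpath p a b) (subpath p b c)"
    by (auto simp: loop_concat_def subpath_def \<phi>_def)
  ultimately show ?thesis by (simp add: subpath_def)
qed

section \<open>Local contractions of the surface\<close>

lemma near_edge_coords:
  assumes g: "g \<ge> 1" and z: "z \<noteq> 0" "edge_param g z > 0" and e: "e > 0"
  shows "eventually (\<lambda>w. w \<noteq> 0 \<and> edge_index g w = edge_index g z \<and> \<bar>edge_param g w - edge_param g z\<bar> < e) (nhds z)"
proof -
  define k where "k = edge_index g z"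
  define t where "t = edge_param g z"
  have k: "k < 4 * g" and t: "0 < t" "t < 1"
    and zeq: "z = of_real (norm z) * polygon_boundary g (real k + t)"
    using edge_decomposition[OF g, of z] z by (simp_all add: k_def t_def)
  have "norm z > 0" "min e (min t (1 - t)) > 0" using z e t by auto
  from near_direction[OF g zeq this] show ?thesis
  proof (rule eventually_mono)
    fix w assume "\<exists>r>0. \<exists>s. \<bar>s\<bar> < min e (min t (1 - t)) \<and> w = of_real r * polygon_boundary g (real k + t + s)"
    then obtain r s where rs: "r > 0" "\<bar>s\<bar> < e" "\<bar>s\<bar> < t" "\<bar>s\<bar> < 1 - t"
      "w = of_real r * polygon_boundary g (real k + (t + s))" by (auto simp: add.assoc)
    then have "0 \<le> t + s" "t + s < 1" by auto
    from edge_index_param[OF g rs(1) k this] rs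
    show "w \<noteq> 0 \<and> edge_index g w = edge_index g z \<and> \<bar>edge_param g w - edge_param g z\<bar> < e"
      by (simp add: k_def t_def)
  qed
qed

lemma near_vertex_coords:
  assumes g: "g \<ge> 1" and z: "z \<noteq> 0" "edge_param g z = 0" and e: "e > 0"
  shows "eventually (\<lambda>w. w \<noteq> 0 \<and> (edge_index g w = edge_index g z \<and> edge_param g w < e \<or>
    edge_index g w = (edge_index g z + 4 * g - 1) mod (4 * g) \<and> edge_param g w > 1 - e)) (nhds z)"
proof -
  define k where "k = edge_index g z"
  have k: "k < 4 * g" and zeq: "z = of_real (norm z) * polygon_boundary g (real k)"
    using edge_decomposition[OF g, of z] z by (simp_all add: k_def)
  have "norm z > 0" "min e 1 > 0" using z e by auto
  from near_direction[OF g zeq this] show ?thesis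
  proof (rule eventually_mono)
    fix w assume "\<exists>r>0. \<exists>s. \<bar>s\<bar> < min e 1 \<and> w = of_real r * polygon_boundary g (real k + s)"
    then obtain r s where rs: "r > 0" "\<bar>s\<bar> < e" "\<bar>s\<bar> < 1"
      "w = of_real r * polygon_boundary g (real k + s)" by auto
    show "w \<noteq> 0 \<and> (edge_index g w = edge_index g z \<and> edge_param g w < e \<or>
      edge_index g w = (edge_index g z + 4 * g - 1) mod (4 * g) \<and> edge_param g w > 1 - e)"
    proof (cases "s \<ge> 0")
      case True
      then show ?thesis
        using edge_index_param[OF g rs(1) k True] rs by (simp add: k_def)
    next
      case False
      then have "- 1 \<le> s" "s < 0" using rs by auto
      from edge_index_wrap[OF g rs(1) k this] show ?thesis
        using rs False by (simp add: k_def)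
    qed
  qed
qed

text \<open>In each block of four edges the pairings join the corners \<open>4 * a\<close>,
  \<open>4 * a + 3\<close>, \<open>4 * a + 2\<close>, \<open>4 * a + 1\<close>,
  \<open>4 * a + 4\<close> in this order, and consecutive blocks share a corner.\<close>

lemma disc_class_vertex:
  assumes "k \<le> 4 * g"
  shows "disc_class g (polygon_boundary g (real k)) = disc_class g (polygon_boundary g 0)"
proof -
  let ?q = "\<lambda>k. disc_class g (polygon_boundary g (real k))"
  have pair: "?q j = ?q (j + 3)" "?q (j + 1) = ?q (j + 2)" if "j < 4 * g" "j mod 4 < 2" for j
    using disc_class_edge_pairing[OF edge_pairingI[OF that, of 0]] disc_class_edge_pairing[OF edge_pairingI[OF that, of 1]]
    by (simp_all add: add.commute)
  have eqs: "?q (4 * a + r) = ?q (4 * a)" if "a < g" "r \<le> 4" for a r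
  proof -
    have m: "(4 * a + 1) mod 4 = 1" by presburger
    have e: "4 * a + 1 + 3 = 4 * a + 4" "4 * a + 1 + 1 = 4 * a + 2" "4 * a + 1 + 2 = 4 * a + 3" by simp_all
    have "?q (4 * a) = ?q (4 * a + 3)" "?q (4 * a + 1) = ?q (4 * a + 2)"
      using that by (intro pair; simp)+
    moreover have "?q (4 * a + 1) = ?q (4 * a + 1 + 3)" "?q (4 * a + 1 + 1) = ?q (4 * a + 1 + 2)"
      using that m by (intro pair; simp)+
    note this[unfolded e]
    moreover have "r = 0 \<or> r = 1 \<or> r = 2 \<or> r = 3 \<or> r = 4" using that(2) by linarith
    ultimately show ?thesis by (elim disjE) (simp_all only: add_0_right)
  qed
  have base: "a \<le> g \<Longrightarrow> ?q (4 * a) = ?q 0" for a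
  proof (induction a)
    case (Suc a)
    then show ?case using eqs[of a 4] by (simp add: add.commute)
  qed simp
  show ?thesis
  proof (cases "k = 4 * g")
    case True
    then show ?thesis using base[of g] by simp
  next
    case False
    then have "k div 4 < g" using assms by linarith
    then have "?q (4 * (k div 4) + k mod 4) = ?q 0"
      using eqs[of "k div 4" "k mod 4"] base[of "k div 4"] by (simp add: less_imp_le)
    then show ?thesis by simp
  qed
qed

text \<open>The contraction may leave \<open>U\<close>. What path lifting uses is that the centre
  stays fixed throughout and that the track of every point comes from a path in the disc.\<close>

definition locally_contractible_at :: "nat \<Rightarrow> complex set \<Rightarrow> bool" where
  "locally_contractible_at g x \<longleftrightarrow> (\<exists>U m. openin (closed_surface g) U \<and> x \<in> U \<and>
     continuous_map (prod_topology (subtopology (closed_surface g) U) (top_of_set {0..1::real})) (closed_surface g) m \<and>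
     (\<forall>l\<in>{0..1}. m (x, l) = x) \<and>
     (\<forall>y\<in>U. m (y, 0) = x \<and> m (y, 1) = y \<and>
       (\<exists>\<gamma>. continuous_on {0..1} \<gamma> \<and> \<gamma> ` {0..1} \<subseteq> cball 0 1 \<and> (\<forall>l\<in>{0..1}. m (y, l) = disc_class g (\<gamma> l)))))"

text \<open>The contraction is built in the disc and descends: the product of a quotient map with
  the locally compact interval is again a quotient map, and compatibility with the pairing makes the
  composite constant on its fibres.\<close>

lemma locally_contractibleI:
  assumes V: "open V" "z0 \<in> V" "z0 \<in> cball 0 1"
    and sat: "\<And>z w. edge_pairing g z w \<Longrightarrow> z \<in> V \<longleftrightarrow> w \<in> V"
    and M: "continuous_on ((V \<inter> cball 0 1) \<times> {0..1::real}) M"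
    and M_cball: "\<And>z l. z \<in> V \<inter> cball 0 1 \<Longrightarrow> l \<in> {0..1} \<Longrightarrow> M (z, l) \<in> cball 0 1"
    and M0: "\<And>z. z \<in> V \<inter> cball 0 1 \<Longrightarrow> disc_class g (M (z, 0)) = disc_class g z0"
    and M1: "\<And>z. z \<in> V \<inter> cball 0 1 \<Longrightarrow> M (z, 1) = z"
    and fixed: "\<And>l. l \<in> {0..1} \<Longrightarrow> disc_class g (M (z0, l)) = disc_class g z0"
    and compat: "\<And>z w l. edge_pairing g z w \<Longrightarrow> z \<in> V \<Longrightarrow> l \<in> {0..1} \<Longrightarrow> disc_class g (M (z, l)) = disc_class g (M (w, l))"
  shows "locally_contractible_at g (disc_class g z0)"
proof -
  let ?X = "closed_surface g" and ?D = "top_of_set (cball (0::complex) 1)" and ?I = "top_of_set {0..1::real}"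
  let ?W = "V \<inter> cball 0 1"
  define U where "U = disc_class g ` ?W"
  have U: "openin ?X U" unfolding U_def using V(1) sat by (rule openin_saturated_image)
  have inv: "disc_class g (M (z, l)) = disc_class g (M (w, l)) \<and> (z \<in> V \<longleftrightarrow> w \<in> V)"
    if zw: "disc_class g z = disc_class g w" "z \<in> cball 0 1" "w \<in> cball 0 1" "z \<in> V" and l: "l \<in> {0..1}" for z w l
  proof -
    have "equivclp (edge_pairing g) z w" using zw by (simp add: disc_class_eq_iff)
    moreover have "x \<in> V \<and> disc_class g (M (z, l)) = disc_class g (M (x, l)) \<longleftrightarrow>
        y \<in> V \<and> disc_class g (M (z, l)) = disc_class g (M (y, l))" if "edge_pairing g x y" for x y
      using sat[OF that] compat[OF that _ l] by auto
    ultimately have "z \<in> V \<and> disc_class g (M (z, l)) = disc_class g (M (z, l)) \<longleftrightarrow>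
        w \<in> V \<and> disc_class g (M (z, l)) = disc_class g (M (w, l))"
      by (rule equivclp_invariant)
    then show ?thesis using zw by blast
  qed
  have pre: "{z \<in> topspace ?D. disc_class g z \<in> U} = ?W"
  proof (intro subset_antisym subsetI)
    fix z assume "z \<in> {z \<in> topspace ?D. disc_class g z \<in> U}"
    then obtain w where "z \<in> cball 0 1" "w \<in> ?W" "disc_class g z = disc_class g w"
      by (auto simp: U_def)
    then show "z \<in> ?W" using inv[of w z 0] by simp
  next
    fix z assume "z \<in> ?W"
    then show "z \<in> {z \<in> topspace ?D. disc_class g z \<in> U}" unfolding U_def by simp
  qed
  have "quotient_map ?D ?X (disc_class g)"
    using quotient_map_closed_surface by (simp add: disc_class_def[abs_def])
  from quotient_map_restriction[OF this pre] U
  have "quotient_map (subtopology ?D ?W) (subtopology ?X U) (disc_class g)" by blast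
  moreover have "locally_compact_space ?I" "Hausdorff_space ?I"
    by (simp_all add: compact_imp_locally_compact_space compact_space_subtopology Hausdorff_space_subtopology)
  ultimately have q: "quotient_map (prod_topology (subtopology ?D ?W) ?I) (prod_topology (subtopology ?X U) ?I)
      (\<lambda>(z, l). (disc_class g z, l))"
    using quotient_map_prod_left by blast
  have P: "prod_topology (subtopology ?D ?W) ?I = top_of_set (?W \<times> {0..1})"
  proof -
    have "cball 0 1 \<inter> ?W = ?W" by blast
    then show ?thesis by (simp add: prod_topology_subtopology subtopology_subtopology Times_Int_Times)
  qed
  have "continuous_map (top_of_set (?W \<times> {0..1})) ?D M"
    using M M_cball by auto
  from continuous_map_compose[OF this continuous_disc_class]
  have cont: "continuous_map (prod_topology (subtopology ?D ?W) ?I) ?X (disc_class g \<circ> M)"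
    unfolding P .
  have fibres: "(disc_class g \<circ> M) u = (disc_class g \<circ> M) v"
    if "u \<in> topspace (prod_topology (subtopology ?D ?W) ?I)" "v \<in> topspace (prod_topology (subtopology ?D ?W) ?I)"
      "(\<lambda>(z, l). (disc_class g z, l)) u = (\<lambda>(z, l). (disc_class g z, l)) v" for u v
  proof -
    have u: "fst u \<in> ?W" "snd u \<in> {0..1}" and v: "fst v \<in> ?W" "snd v = snd u"
      "disc_class g (fst u) = disc_class g (fst v)"
      using that unfolding P by auto
    have "disc_class g (M (fst u, snd u)) = disc_class g (M (fst v, snd u))"
      using inv[OF v(3) _ _ _ u(2)] u v by simp
    then show ?thesis using v by (metis comp_apply prod.collapse)
  qed
  obtain m where m: "continuous_map (prod_topology (subtopology ?X U) ?I) ?X m"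
    "\<And>u. u \<in> topspace (prod_topology (subtopology ?D ?W) ?I) \<Longrightarrow> m ((\<lambda>(z, l). (disc_class g z, l)) u) = (disc_class g \<circ> M) u"
    by (rule quotient_map_lift_exists[OF q cont fibres], assumption+, rule that)
  have mM: "m (disc_class g z, l) = disc_class g (M (z, l))" if "z \<in> ?W" "l \<in> {0..1}" for z l
    using m(2)[of "(z, l)"] that unfolding P by auto
  have "\<exists>\<gamma>. continuous_on {0..1} \<gamma> \<and> \<gamma> ` {0..1} \<subseteq> cball 0 1 \<and> (\<forall>l\<in>{0..1}. m (disc_class g z, l) = disc_class g (\<gamma> l))"
    if z: "z \<in> ?W" for z
  proof (intro exI[of _ "\<lambda>l. M (z, l)"] conjI ballI)
    show "continuous_on {0..1} (\<lambda>l. M (z, l))"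
      by (rule continuous_on_compose2[OF M]) (use z in \<open>auto intro!: continuous_intros\<close>)
  qed (use z mM M_cball in auto)
  moreover have "disc_class g z0 \<in> U" using V by (auto simp: U_def)
  ultimately show ?thesis
    unfolding locally_contractible_at_def
    by (intro exI[of _ U] exI[of _ m]) (use U m(1) mM M0 M1 fixed V in \<open>auto simp: U_def\<close>)
qed

lemma locally_contractible_interior:
  assumes "norm z0 < 1"
  shows "locally_contractible_at g (disc_class g z0)"
proof (rule locally_contractibleI[where V = "ball 0 1" and M = "\<lambda>(z, l). (1 - l) *\<^sub>R z0 + l *\<^sub>R z"])
  show "continuous_on ((ball 0 1 \<inter> cball 0 1) \<times> {0..1}) (\<lambda>(z, l). (1 - l) *\<^sub>R z0 + l *\<^sub>R z)"
    unfolding split_beta by (intro continuous_intros)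
  show "(case (z, l) of (z, l) \<Rightarrow> (1 - l) *\<^sub>R z0 + l *\<^sub>R z) \<in> cball 0 1"
    if "z \<in> ball 0 1 \<inter> cball 0 1" "l \<in> {0..1}" for z and l :: real
    unfolding prod.case using that assms by (intro convexD_alt[OF convex_cball]) auto
  show "disc_class g (case (z0, l) of (z, l) \<Rightarrow> (1 - l) *\<^sub>R z0 + l *\<^sub>R z) = disc_class g z0" for l :: real
    by (simp add: scaleR_left.diff)
qed (use assms edge_pairing_norm in force)+

text \<open>
  Near a boundary point the surface is a union of sectors around the points \<open>C z\<close> of its class, and
  \<open>(r, s) \<mapsto> (r powr l, l * s)\<close> in polar coordinates around \<open>C z\<close> respects the gluing.
\<close>

lemma locally_contractible_boundary:
  fixes g :: nat and P :: "nat \<Rightarrow> real \<Rightarrow> bool" and c :: "nat \<Rightarrow> real \<Rightarrow> real"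
  defines "C \<equiv> \<lambda>z. polygon_boundary g (real (edge_index g z) + c (edge_index g z) (edge_param g z))"
  assumes g: "g \<ge> 1" and z0: "norm z0 = 1" "P (edge_index g z0) (edge_param g z0)" "c (edge_index g z0) (edge_param g z0) = edge_param g z0"
    and op: "open (edge_region g P)"
    and pair: "\<And>k t. k + 2 < 4 * g \<Longrightarrow> k mod 4 < 2 \<Longrightarrow> 0 < t \<Longrightarrow> t < 1 \<Longrightarrow> P k t \<longleftrightarrow> P (k + 2) (1 - t)"
    and vertex: "\<And>k k'. k < 4 * g \<Longrightarrow> k' < 4 * g \<Longrightarrow> P k 0 \<longleftrightarrow> P k' 0"
    and c: "\<And>k t. k < 4 * g \<Longrightarrow> P k t \<Longrightarrow> 0 \<le> c k t \<and> c k t \<le> 1"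
    and c_pair: "\<And>k t. k + 2 < 4 * g \<Longrightarrow> k mod 4 < 2 \<Longrightarrow> P k t \<Longrightarrow> 0 < t \<Longrightarrow> t < 1 \<Longrightarrow> c (k + 2) (1 - t) = 1 - c k t"
    and c_vertex: "\<And>k. k < 4 * g \<Longrightarrow> P k 0 \<Longrightarrow> c k 0 = 0"
    and C_const: "\<And>z. z \<noteq> 0 \<Longrightarrow> P (edge_index g z) (edge_param g z) \<Longrightarrow> eventually (\<lambda>w. C w = C z) (nhds z)"
    and C_class: "\<And>z. P (edge_index g z) (edge_param g z) \<Longrightarrow> disc_class g (C z) = disc_class g z0"
  shows "locally_contractible_at g (disc_class g z0)"
proof -
  let ?V = "edge_region g P"
  \<comment> \<open>Closed form of \<open>(r powr l, l * s)\<close>: the logarithm of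
    \<open>z / C z\<close> is multiplied by \<open>l\<close>.\<close>
  define M where "M = (\<lambda>u::complex \<times> real. C (fst u) * exp (of_real (snd u) * Ln (fst u / C (fst u))))"
  have C0: "C z \<noteq> 0" for z by (simp add: C_def)
  \<comment> \<open>An edge spans at most a quarter turn, so these angles stay within the principal
    branch.\<close>
  have Ln: "Ln (of_real r * polygon_boundary g s) = of_real (ln r) + \<i> * of_real (2 * pi * s / (4 * real g))"
    if "r > 0" "\<bar>s\<bar> \<le> 1" for r s
  proof -
    define \<theta> where "\<theta> = 2 * pi * s / (4 * real g)"
    have "\<bar>\<theta>\<bar> \<le> 2 * pi * 1 / 4"
      using that(2) g by (simp add: \<theta>_def abs_mult divide_simps)
    then have "- pi < \<theta>" "\<theta> \<le> pi" using pi_gt_zero by linarith+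
    moreover have "of_real r * polygon_boundary g s = exp (of_real (ln r) + \<i> * of_real \<theta>)"
      using that(1) by (simp only: polygon_boundary_def cis_conv_exp exp_add exp_of_real exp_ln \<theta>_def)
    ultimately have "Ln (of_real r * polygon_boundary g s) = of_real (ln r) + \<i> * of_real \<theta>"
      by (intro Ln_unique) auto
    then show ?thesis by (simp only: \<theta>_def)
  qed
  have polar: "z / C z = of_real (norm z) * polygon_boundary g (edge_param g z - c (edge_index g z) (edge_param g z))"
    "\<bar>edge_param g z - c (edge_index g z) (edge_param g z)\<bar> \<le> 1" if "P (edge_index g z) (edge_param g z)" for z
  proof -
    have "polygon_boundary g (real (edge_index g z) + edge_param g z) / C z
        = polygon_boundary g (edge_param g z - c (edge_index g z) (edge_param g z))"
      unfolding C_def polygon_boundary_def cis_divide by (simp add: diff_divide_distrib[symmetric] algebra_simps)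
    then show "z / C z = of_real (norm z) * polygon_boundary g (edge_param g z - c (edge_index g z) (edge_param g z))"
      using edge_decomposition(4)[OF g, of z] by (metis times_divide_eq_right)
    show "\<bar>edge_param g z - c (edge_index g z) (edge_param g z)\<bar> \<le> 1"
      using c[OF edge_decomposition(1)[OF g] that] edge_decomposition(2,3)[OF g, of z] by (auto simp: abs_if)
  qed
  have M_polar: "M (z, l) = of_real (exp (l * ln (norm z))) *
      polygon_boundary g (real (edge_index g z) + (c (edge_index g z) (edge_param g z) + l * (edge_param g z - c (edge_index g z) (edge_param g z))))"
    if "z \<in> ?V" for z l
  proof -
    let ?c = "c (edge_index g z) (edge_param g z)"
    have "norm z > 0" using that by simp
    have gen: "of_real l * (of_real b + \<i> * of_real a) = of_real (l * b) + \<i> * of_real (l * a)" for a b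
      by (simp add: algebra_simps)
    have "Ln (z / C z) = of_real (ln (norm z)) + \<i> * of_real (2 * pi * (edge_param g z - ?c) / (4 * real g))"
      using that polar[of z] Ln[OF \<open>norm z > 0\<close>] by auto
    then have "of_real l * Ln (z / C z) = of_real (l * ln (norm z)) + \<i> * of_real (l * (2 * pi * (edge_param g z - ?c) / (4 * real g)))"
      by (simp only: gen)
    moreover have "l * (2 * pi * (edge_param g z - ?c) / (4 * real g)) = 2 * pi * (l * (edge_param g z - ?c)) / (4 * real g)"
      by simp
    ultimately have "of_real l * Ln (z / C z) = of_real (l * ln (norm z)) + \<i> * of_real (2 * pi * (l * (edge_param g z - ?c)) / (4 * real g))"
      by (simp only:)
    then have "exp (of_real l * Ln (z / C z)) = of_real (exp (l * ln (norm z))) * polygon_boundary g (l * (edge_param g z - ?c))"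
      by (simp only: exp_add exp_of_real polygon_boundary_def cis_conv_exp)
    moreover have "C z * polygon_boundary g s = polygon_boundary g (real (edge_index g z) + (?c + s))" for s
      unfolding C_def polygon_boundary_def cis_mult by (simp add: add_divide_distrib[symmetric] distrib_left[symmetric] add.assoc)
    ultimately show ?thesis by (simp add: M_def mult.left_commute)
  qed
  have contM: "continuous_on ((?V \<inter> cball 0 1) \<times> {0..1}) M"
  proof (rule continuous_at_imp_continuous_on, safe)
    fix z and l :: real assume z: "z \<noteq> 0" "P (edge_index g z) (edge_param g z)"
    have nonpos: "z / C z \<notin> \<real>\<^sub>\<le>\<^sub>0"
    proof
      assume "z / C z \<in> \<real>\<^sub>\<le>\<^sub>0"
      then obtain r where r: "z / C z = of_real r" "r \<le> 0" by (auto elim: nonpos_Reals_cases)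
      then have "r < 0" using z C0[of z] by (cases "r = 0") auto
      then have "Im (Ln (z / C z)) = pi" using r by (simp add: Ln_of_real')
      moreover have "\<bar>Im (Ln (z / C z))\<bar> \<le> pi / 2"
      proof -
        have nz: "norm z > 0" using z by simp
        have "Im (Ln (z / C z)) = 2 * pi * (edge_param g z - c (edge_index g z) (edge_param g z)) / (4 * real g)"
          using polar[OF z(2)] Ln[OF nz polar(2)[OF z(2)]] by simp
        also have "\<bar>\<dots>\<bar> = pi / 2 * (\<bar>edge_param g z - c (edge_index g z) (edge_param g z)\<bar> / real g)"
          by (simp add: abs_mult)
        also have "\<dots> \<le> pi / 2 * 1"
          using polar(2)[OF z(2)] g by (intro mult_left_mono) (auto simp: field_simps)
        finally show ?thesis by simp
      qed
      ultimately show False using pi_gt_zero by linarith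
    qed
    have "isCont (\<lambda>u. C z * exp (of_real (snd u) * Ln (fst u / C z))) (z, l)"
      using nonpos C0 by (intro continuous_intros) auto
    \<comment> \<open>The centre is locally constant, so that near each point \<open>M\<close> is
      given by one continuous formula.\<close>
    moreover have "eventually (\<lambda>u. M u = C z * exp (of_real (snd u) * Ln (fst u / C z))) (nhds (z, l))"
    proof -
      have "eventually (\<lambda>u. C (fst u) = C z) (nhds z \<times>\<^sub>F nhds l)"
        unfolding eventually_prod_filter using C_const[OF z]
        by (intro exI[of _ "\<lambda>w. C w = C z"] exI[of _ "\<lambda>_. True"]) simp
      then show ?thesis by (auto simp: nhds_prod M_def elim: eventually_mono)
    qed
    ultimately show "isCont M (z, l)" by (simp only: isCont_cong)
  qed
  show ?thesis
  proof (rule locally_contractibleI[OF op _ _ _ contM])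
    show "z0 \<in> ?V" "z0 \<in> cball 0 1" using z0 by auto
    show "z \<in> ?V \<longleftrightarrow> w \<in> ?V" if "edge_pairing g z w" for z w
      using edge_region_saturated[where P = P, OF g that pair vertex] edge_pairing_norm[OF that] by auto
    fix z and l :: real
    show "M (z, l) \<in> cball 0 1" if "z \<in> ?V \<inter> cball 0 1" "l \<in> {0..1}"
      using that M_polar[of z l] by (simp add: norm_mult mult_nonneg_nonpos)
    show "disc_class g (M (z, 0)) = disc_class g z0" if "z \<in> ?V \<inter> cball 0 1"
      using that C_class by (simp add: M_def)
    show "M (z, 1) = z" if "z \<in> ?V \<inter> cball 0 1"
      using that C0[of z] by (simp add: M_def)
  next
    fix l :: real
    have "C z0 = z0" using edge_decomposition(4)[OF g, of z0] z0 by (simp add: C_def)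
    then show "disc_class g (M (z0, l)) = disc_class g z0" using z0 by (auto simp: M_def)
  next
    fix z w and l :: real assume zw: "edge_pairing g z w" and z: "z \<in> ?V" and l: "l \<in> {0..1}"
    obtain k t where k: "k + 2 < 4 * g" "k mod 4 < 2" "0 \<le> t" "t \<le> 1"
      "z = polygon_boundary g (real k + t)" "w = polygon_boundary g (real (k + 2) + (1 - t))"
      using zw by (rule edge_pairingE)
    have w: "w \<in> ?V"
      using edge_region_saturated[where P = P, OF g zw pair vertex] edge_pairing_norm[OF zw] z by auto
    show "disc_class g (M (z, l)) = disc_class g (M (w, l))"
    proof (cases "0 < t \<and> t < 1")
      case True
      have zc: "edge_index g z = k" "edge_param g z = t" and wc: "edge_index g w = k + 2" "edge_param g w = 1 - t"
        using edge_index_param[OF g, of 1 k t] edge_index_param[OF g, of 1 "k + 2" "1 - t"] True k by auto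
      \<comment> \<open>The new position is the same convex combination on both glued edges, hence
        the images are glued again.\<close>
      define s where "s = (1 - l) * c k t + l * t"
      have "0 \<le> c k t" "c k t \<le> 1" using c[of k t] k z zc by auto
      then have s: "0 \<le> s" "s \<le> 1"
        using convexD_alt[of "{0..1::real}" "c k t" t l] l True by (auto simp: s_def)
      have cp: "c (k + 2) (1 - t) = 1 - c k t" using c_pair[OF k(1,2), of t] True z zc by simp
      have "M (z, l) = polygon_boundary g (real k + s)"
        using M_polar[OF z, of l] edge_pairing_norm[OF zw] unfolding zc s_def by (simp add: algebra_simps)
      moreover have "M (w, l) = polygon_boundary g (real (k + 2) + (1 - s))"
        using M_polar[OF w, of l] edge_pairing_norm[OF zw] unfolding wc cp s_def by (simp add: algebra_simps)
      ultimately show ?thesis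
        using k s disc_class_edge_pairing[OF edge_pairingI[of k g s]] by simp
    next
      case False
      have fix_vertex: "M (y, l) = y" if "edge_param g y = 0" "norm y = 1" "y \<in> ?V" for y
      proof -
        have "C y = y" using edge_decomposition(1,4)[OF g, of y] c_vertex[of "edge_index g y"] that by (simp add: C_def)
        then show ?thesis using that by (simp add: M_def)
      qed
      have last: "edge_param g (polygon_boundary g (real j)) = 0" for j
        using polygon_boundary_mod[OF g, of j 0] edge_index_param(2)[OF g, of 1 "j mod (4 * g)" 0] g by simp
      have "t = 0 \<or> t = 1" using False k by auto
      then have "edge_param g z = 0" "edge_param g w = 0"
        using last[of k] last[of "k + 1"] last[of "k + 2"] last[of "k + 3"] k by (auto simp: add.commute)
      then show ?thesis
        using fix_vertex z w edge_pairing_norm[OF zw] disc_class_edge_pairing[OF zw] by simp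
    qed
  qed
qed

text \<open>The first third of an edge contracts towards its start and the last third towards its
  end. The centre does not jump across a vertex, because the end of one edge is the start of the
  next.\<close>

lemma locally_contractible_vertex:
  assumes g: "g \<ge> 1" and z0: "norm z0 = 1" "edge_param g z0 = 0"
  shows "locally_contractible_at g (disc_class g z0)"
proof (rule locally_contractible_boundary[where P = "\<lambda>_ t. t < 1/3 \<or> t > 2/3" and c = "\<lambda>_ t. if t < 1/3 then 0 else 1", OF g z0(1)])
  show "open {z. z \<noteq> 0 \<and> (edge_param g z < 1/3 \<or> edge_param g z > 2/3)}"
  proof (rule open_edge_region[OF g, where P = "\<lambda>_ t. t < 1/3 \<or> t > 2/3"])
    fix s :: real assume "s < 1/3 \<or> s > 2/3"
    then show "\<exists>e>0. \<forall>t'. \<bar>t' - s\<bar> < e \<longrightarrow> t' < 1/3 \<or> t' > 2/3"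
      by (intro exI[of _ "if s < 1/3 then 1/3 - s else s - 2/3"]) auto
  next
    show "\<exists>e>0. \<forall>t. 0 \<le> t \<longrightarrow> t < e \<longrightarrow>
        (t < 1/3 \<or> t > 2/3) \<and> (1 - t < 1/3 \<or> 1 - t > 2/3) \<or> t = (0::real)"
      by (intro exI[of _ "1/3"]) auto
  qed
  fix z assume z: "edge_param g z < 1/3 \<or> edge_param g z > 2/3"
  let ?C = "\<lambda>z. polygon_boundary g (real (edge_index g z) + (if edge_param g z < 1/3 then 0 else 1))"
  have "?C w = polygon_boundary g (real (edge_index g w)) \<or> ?C w = polygon_boundary g (real (Suc (edge_index g w)))" for w
    by (simp add: add.commute)
  moreover have "edge_index g w \<le> 4 * g" "Suc (edge_index g w) \<le> 4 * g" for w
    using edge_decomposition(1)[OF g, of w] by auto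
  ultimately have C: "disc_class g (?C w) = disc_class g (polygon_boundary g 0)" for w
    using disc_class_vertex by metis
  have "z0 = ?C z0" using edge_decomposition(4)[OF g, of z0] z0 by simp
  then show "disc_class g (?C z) = disc_class g z0" using C by metis
  assume nz: "z \<noteq> 0"
  consider "edge_param g z = 0" | "0 < edge_param g z" using edge_decomposition(2)[OF g, of z] by linarith
  then show "eventually (\<lambda>w. ?C w = ?C z) (nhds z)"
  proof cases
    case 1
    have pred: "?C w = ?C z" if "edge_index g w = (edge_index g z + 4 * g - 1) mod (4 * g)" "edge_param g w > 2/3" for w
    proof -
      have "real (edge_index g z + 4 * g - 1) + 1 = real (4 * g) + real (edge_index g z)"
        using g by (simp add: of_nat_diff)
      then have "polygon_boundary g (real (edge_index g w) + 1) = polygon_boundary g (real (edge_index g z))"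
        unfolding that(1) polygon_boundary_mod[OF g] by (simp only: polygon_boundary_wrap[OF g])
      then show ?thesis using that(2) 1 by simp
    qed
    have third: "(1/3 :: real) > 0" by simp
    from near_vertex_coords[OF g nz 1 third] show ?thesis
    proof (rule eventually_mono)
      fix w assume w: "w \<noteq> 0 \<and> (edge_index g w = edge_index g z \<and> edge_param g w < 1/3 \<or>
        edge_index g w = (edge_index g z + 4 * g - 1) mod (4 * g) \<and> edge_param g w > 1 - 1/3)"
      show "?C w = ?C z"
      proof (cases "edge_index g w = edge_index g z \<and> edge_param g w < 1/3")
        case True
        then show ?thesis using 1 by simp
      next
        case False
        then show ?thesis using w by (intro pred) auto
      qed
    qed
  next
    case 2
    define e where "e = (if edge_param g z < 1/3 then 1/3 - edge_param g z else edge_param g z - 2/3)"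
    have "e > 0" using z by (auto simp: e_def)
    from near_edge_coords[OF g nz 2 this] show ?thesis
    proof (rule eventually_mono)
      fix w assume w: "w \<noteq> 0 \<and> edge_index g w = edge_index g z \<and> \<bar>edge_param g w - edge_param g z\<bar> < e"
      then have "edge_param g w < 1/3 \<longleftrightarrow> edge_param g z < 1/3"
        using z unfolding e_def by (auto simp: abs_if split: if_splits)
      then show "?C w = ?C z" using w by simp
    qed
  qed
qed (use z0 in auto)

text \<open>Two sectors are used, around the given point and around its partner on the paired edge;
  \<open>c\<close> records the two centres.\<close>

lemma locally_contractible_edge:
  assumes g: "g \<ge> 1" and k: "k + 2 < 4 * g" "k mod 4 < 2" and t: "0 < t" "t < 1"
  shows "locally_contractible_at g (disc_class g (polygon_boundary g (real k + t)))"
proof -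
  define z0 where "z0 = polygon_boundary g (real k + t)"
  have z0: "norm z0 = 1" "edge_index g z0 = k" "edge_param g z0 = t"
    using edge_index_param[OF g, of 1 k t] k t by (simp_all add: z0_def)
  have flip: "\<not> (j + 2) mod 4 < 2" if "j mod 4 < 2" for j :: nat using that by presburger
  define P where "P j s \<longleftrightarrow> (0 < s \<and> s < 1) \<and> (j = k \<or> j = k + 2)" for j and s :: real
  define c where "c j s = (if j = k then t else 1 - t)" for j :: nat and s :: real
  have "locally_contractible_at g (disc_class g z0)"
  proof (rule locally_contractible_boundary[where P = P and c = c, OF g z0(1)])
    show "open (edge_region g P)"
    proof (rule open_edge_region[OF g])
      fix j s assume "P j s"
      then show "\<exists>e>0. \<forall>t'. \<bar>t' - s\<bar> < e \<longrightarrow> P j t'"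
        by (intro exI[of _ "min s (1 - s)"]) (auto simp: P_def)
    qed (simp add: P_def)
    show "P j s \<longleftrightarrow> P (j + 2) (1 - s)" if "j mod 4 < 2" for j s
      using flip[OF that] flip[OF k(2)] that k(2) by (auto simp: P_def)
    show "c (j + 2) (1 - s) = 1 - c j s" if "P j s" "j mod 4 < 2" for j s
      using that flip[OF k(2)] by (auto simp: P_def c_def)
    let ?C = "\<lambda>z. polygon_boundary g (real (edge_index g z) + c (edge_index g z) (edge_param g z))"
    have pair: "disc_class g (polygon_boundary g (real (k + 2) + (1 - t))) = disc_class g z0"
      using disc_class_edge_pairing[OF edge_pairingI[of k g t]] k t by (simp add: z0_def)
    show "disc_class g (?C z) = disc_class g z0" if "P (edge_index g z) (edge_param g z)" for z
    proof (cases "edge_index g z = k")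
      case True
      then show ?thesis by (simp add: c_def z0_def)
    next
      case False
      then have "edge_index g z = k + 2" using that by (simp add: P_def)
      then show ?thesis using pair by (simp add: c_def)
    qed
    show "eventually (\<lambda>w. ?C w = ?C z) (nhds z)" if "z \<noteq> 0" "P (edge_index g z) (edge_param g z)" for z
    proof -
      have "edge_param g z > 0" using that(2) by (simp add: P_def)
      from near_edge_coords[OF g that(1) this zero_less_one] show ?thesis
        by (rule eventually_mono) (simp add: c_def)
    qed
  qed (use z0 t in \<open>auto simp: P_def c_def\<close>)
  then show ?thesis by (simp add: z0_def)
qed

lemma surface_locally_contractible:
  assumes g: "g \<ge> 1" and x: "x \<in> topspace (closed_surface g)"
  shows "locally_contractible_at g x"
proof -
  obtain z where z: "z \<in> cball 0 1" "x = disc_class g z" using x by (auto simp: topspace_closed_surface)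
  define k where "k = edge_index g z"
  define t where "t = edge_param g z"
  have kt: "k < 4 * g" "0 \<le> t" "t < 1"
    using edge_decomposition[OF g, of z] by (simp_all add: k_def t_def)
  consider "norm z < 1" | "norm z = 1" "t = 0" | "norm z = 1" "0 < t" using z kt by fastforce
  then show ?thesis
  proof cases
    case 1
    then show ?thesis using locally_contractible_interior z by simp
  next
    case 2
    then show ?thesis using locally_contractible_vertex[OF g, of z] z by (simp add: t_def)
  next
    case 3
    have zeq: "z = polygon_boundary g (real k + t)"
      using edge_decomposition(4)[OF g, of z] 3 by (simp add: k_def t_def)
    have div: "k = 4 * (k div 4) + k mod 4" "k div 4 < g" "k mod 4 < 4" using kt by auto
    show ?thesis
    proof (cases "k mod 4 < 2")
      case True
      then have "k + 2 < 4 * g" using div by linarith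
      then show ?thesis using locally_contractible_edge[OF g _ True, of t] 3 kt zeq z by simp
    next
      case False
      define j where "j = k - 2"
      have j: "k = j + 2" using False div by (simp add: j_def)
      then have "j mod 4 < 2" using False by presburger
      moreover have "j + 2 < 4 * g" using kt j by simp
      moreover have "disc_class g (polygon_boundary g (real j + (1 - t))) = x"
        using disc_class_edge_pairing[OF edge_pairingI[of j g "1 - t"]] calculation kt zeq z(2) by (simp add: j)
      ultimately show ?thesis using locally_contractible_edge[OF g, of j "1 - t"] 3 kt by auto
    qed
  qed
qed

lemma path_homotopic_cong:
  assumes "pathin X p" "\<And>t. t \<in> {0..1} \<Longrightarrow> p t = q t"
  shows "path_homotopic X (p 0) (p 1) p q"
proof -
  let ?I = "top_of_set {0..1::real}"
  have "continuous_map (prod_topology ?I ?I) X (p \<circ> snd)"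
    using continuous_map_compose[OF continuous_map_snd assms(1)[unfolded pathin_def], of ?I] .
  then have "continuous_map (prod_topology ?I ?I) X (\<lambda>z. if fst z = 0 then p (snd z) else q (snd z))"
    by (rule continuous_map_eq) (use assms(2) in auto)
  then show ?thesis
    unfolding path_homotopic_def homotopic_with_def
    by (intro exI[of _ "\<lambda>z. if fst z = 0 then p (snd z) else q (snd z)"]) (use assms(2) in auto)
qed

text \<open>
  Contracting the whole path at once turns it into the track of its end point, which lifts to
  the disc.
\<close>

lemma short_paths_lift:
  assumes x: "locally_contractible_at g (p s)" and s: "s \<in> {0..1}"
    and p: "pathin (closed_surface g) p"
  shows "\<exists>e>0. \<forall>t\<in>{0..1}. \<bar>t - s\<bar> < e \<longrightarrow>
    (\<exists>\<gamma>. continuous_on {0..1} \<gamma> \<and> \<gamma> ` {0..1} \<subseteq> cball 0 1 \<and>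
      path_homotopic (closed_surface g) (p s) (p t) (subpath p s t) (\<lambda>l. disc_class g (\<gamma> l)))"
proof -
  let ?X = "closed_surface g" and ?I = "top_of_set {0..1::real}"
  let ?Q = "{0..1} \<times> {0..1} :: (real \<times> real) set"
  obtain U m where U: "openin ?X U" "p s \<in> U"
    and m: "continuous_map (prod_topology (subtopology ?X U) ?I) ?X m"
    "\<And>l. l \<in> {0..1} \<Longrightarrow> m (p s, l) = p s" "\<And>y. y \<in> U \<Longrightarrow> m (y, 0) = p s" "\<And>y. y \<in> U \<Longrightarrow> m (y, 1) = y"
    "\<And>y. y \<in> U \<Longrightarrow> \<exists>\<gamma>. continuous_on {0..1} \<gamma> \<and> \<gamma> ` {0..1} \<subseteq> cball 0 1 \<and> (\<forall>l\<in>{0..1}. m (y, l) = disc_class g (\<gamma> l))"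
    using x unfolding locally_contractible_at_def by metis
  have pc: "continuous_map ?I ?X p" using p by (simp add: pathin_def)
  have "openin ?I {t \<in> topspace ?I. p t \<in> U}"
    using pc U(1) by (rule openin_continuous_map_preimage)
  moreover have "s \<in> {t \<in> topspace ?I. p t \<in> U}" using s U(2) by simp
  ultimately obtain e where e: "e > 0" "ball s e \<inter> {0..1} \<subseteq> {t \<in> topspace ?I. p t \<in> U}"
    unfolding openin_contains_ball by blast
  have "\<exists>\<gamma>. continuous_on {0..1} \<gamma> \<and> \<gamma> ` {0..1} \<subseteq> cball 0 1 \<and>
      path_homotopic ?X (p s) (p t) (subpath p s t) (\<lambda>l. disc_class g (\<gamma> l))"
    if t: "t \<in> {0..1}" "\<bar>t - s\<bar> < e" for t
  proof -
    have seg: "s + (t - s) * l \<in> ball s e \<inter> {0..1}" if "l \<in> {0..1}" for l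
    proof (rule subpath_in_convex)
      show "convex (ball s e \<inter> {0..1})" by (intro convex_Int) auto
      show "s \<in> ball s e \<inter> {0..1}" "t \<in> ball s e \<inter> {0..1}"
        using s t e(1) by (auto simp: dist_real_def)
    qed (rule that)
    have inU: "p (s + (t - s) * l) \<in> U" if "l \<in> {0..1}" for l using e(2) seg[OF that] by blast
    then have ptU: "p t \<in> U" using inU[of 1] by simp
    obtain \<gamma> where \<gamma>: "continuous_on {0..1} \<gamma>" "\<gamma> ` {0..1} \<subseteq> cball 0 1"
      "\<And>l. l \<in> {0..1} \<Longrightarrow> m (p t, l) = disc_class g (\<gamma> l)"
      using m(5)[OF ptU] by blast
    define F where "F = (\<lambda>u. m (p (s + (t - s) * snd u), fst u))"
    have F: "continuous_map (top_of_set ?Q) ?X F"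
    proof -
      have "continuous_map (top_of_set ?Q) ?I (\<lambda>u. s + (t - s) * snd u)"
        using seg by (auto intro!: continuous_intros)
      from continuous_map_compose[OF this pc]
      have "continuous_map (top_of_set ?Q) (subtopology ?X U) (\<lambda>u. p (s + (t - s) * snd u))"
        using inU by (auto simp: continuous_map_in_subtopology o_def)
      moreover have "continuous_map (top_of_set ?Q) ?I fst"
        by (auto intro!: continuous_intros)
      ultimately have "continuous_map (top_of_set ?Q) (prod_topology (subtopology ?X U) ?I) (\<lambda>u. (p (s + (t - s) * snd u), fst u))"
        by (simp add: continuous_map_paired)
      from continuous_map_compose[OF this m(1)] show ?thesis by (simp add: F_def o_def)
    qed
    define \<phi> :: "real \<Rightarrow> real \<times> real" where "\<phi> = (\<lambda>l. (1, l))"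
    \<comment> \<open>The side \<phi> of the square is replaced by the other three, each in a third
      of the time: the contraction run backwards at the fixed point \<open>p s\<close>, the fully
      contracted path, constant at \<open>p s\<close>, and the track of \<open>p t\<close>.\<close>
    define \<psi> :: "real \<Rightarrow> real \<times> real" where
      "\<psi> = (\<lambda>l. (max (1 - 3 * l) (max 0 (3 * l - 2)), min 1 (max 0 (3 * l - 1))))"
    have "path_homotopic ?X (p s) (p t) (\<lambda>l. F (\<phi> l)) (\<lambda>l. F (\<psi> l))"
    proof (rule path_homotopic_convex[OF F])
      show "convex ?Q" by (intro convex_Times) auto
      show "continuous_on {0..1} \<phi>" "continuous_on {0..1} \<psi>"
        unfolding \<phi>_def \<psi>_def by (intro continuous_intros)+
      show "\<phi> l \<in> ?Q" "\<psi> l \<in> ?Q" if "l \<in> {0..1}" for l using that by (auto simp: \<phi>_def \<psi>_def)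
      show "F (\<phi> 0) = p s" "F (\<phi> 1) = p t" using m(4) U(2) ptU by (simp_all add: F_def \<phi>_def)
    qed (auto simp: \<phi>_def \<psi>_def)
    moreover have "path_homotopic ?X (p s) (p t) (\<lambda>l. F (\<phi> l)) (subpath p s t)"
      using path_homotopic_cong[of ?X "\<lambda>l. F (\<phi> l)" "subpath p s t"] path_homotopic_imp[OF calculation]
        m(4) inU by (simp add: F_def \<phi>_def subpath_def)
    moreover have "path_homotopic ?X (p s) (p t) (\<lambda>l. F (\<psi> l)) (\<lambda>l. disc_class g (\<gamma> (max 0 (3 * l - 2))))"
    proof -
      have "F (\<psi> l) = disc_class g (\<gamma> (max 0 (3 * l - 2)))" if l: "l \<in> {0..1}" for l
      proof -
        have g0: "disc_class g (\<gamma> 0) = p s" using \<gamma>(3)[of 0] m(3)[OF ptU] by simp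
        consider "l \<le> 1/3" | "1/3 \<le> l" "l \<le> 2/3" | "2/3 \<le> l" by linarith
        then show ?thesis
        proof cases
          case 1
          then have "snd (\<psi> l) = 0" "fst (\<psi> l) \<in> {0..1}" using l by (auto simp: \<psi>_def)
          then have "F (\<psi> l) = p s" using m(2) by (simp add: F_def)
          then show ?thesis using 1 g0 by simp
        next
          case 2
          then have "fst (\<psi> l) = 0" "snd (\<psi> l) \<in> {0..1}" using l by (auto simp: \<psi>_def)
          then have "F (\<psi> l) = p s" using m(3)[OF inU] by (simp add: F_def)
          then show ?thesis using 2 g0 by simp
        next
          case 3
          then have "snd (\<psi> l) = 1" "fst (\<psi> l) = 3 * l - 2" using l by (auto simp: \<psi>_def)
          then show ?thesis using \<gamma>(3)[of "3 * l - 2"] 3 l by (simp add: F_def)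
        qed
      qed
      then show ?thesis
        using path_homotopic_cong[of ?X "\<lambda>l. F (\<psi> l)"] path_homotopic_imp[OF calculation(1)] by simp
    qed
    ultimately have "path_homotopic ?X (p s) (p t) (subpath p s t) (\<lambda>l. disc_class g (\<gamma> (max 0 (3 * l - 2))))"
      by (meson path_homotopic_sym path_homotopic_trans)
    moreover have "continuous_on {0..1} (\<lambda>l. \<gamma> (max 0 (3 * l - 2)))"
      by (rule continuous_on_compose2[OF \<gamma>(1)]) (auto intro!: continuous_intros)
    moreover have "(\<lambda>l. \<gamma> (max 0 (3 * l - 2))) ` {0..1} \<subseteq> cball 0 1"
      using \<gamma>(2) by (force simp: image_subset_iff)
    ultimately show ?thesis by blast
  qed
  with e(1) show ?thesis by blast
qed

section \<open>Generation of the fundamental group by edge loops\<close>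

definition base_vertex :: "nat \<Rightarrow> complex set" where
  "base_vertex g = disc_class g 1"

definition boundary_curve :: "nat \<Rightarrow> real \<Rightarrow> complex set" where
  "boundary_curve g s = disc_class g (polygon_boundary g s)"

definition edge_class :: "nat \<Rightarrow> nat \<Rightarrow> (real \<Rightarrow> complex set) set" where
  "edge_class g k = loop_class (closed_surface g) (base_vertex g) (edge_loop g k)"

abbreviation surface_pi1 :: "nat \<Rightarrow> (real \<Rightarrow> complex set) set monoid" where
  "surface_pi1 g \<equiv> fundamental_group (closed_surface g) (base_vertex g)"

lemma polygon_boundary_0 [simp]: "polygon_boundary g 0 = 1"
  by (simp add: polygon_boundary_def)

lemma base_vertex_topspace: "base_vertex g \<in> topspace (closed_surface g)"
  by (simp add: topspace_closed_surface base_vertex_def)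

lemma group_surface_pi1: "group (surface_pi1 g)"
  by (rule group_fundamental_group) (rule base_vertex_topspace)

lemma continuous_boundary_curve: "continuous_map (top_of_set UNIV) (closed_surface g) (boundary_curve g)"
proof -
  have "continuous_map (top_of_set (UNIV::real set)) (top_of_set (cball 0 1)) (polygon_boundary g)"
  proof -
    have "continuous_on UNIV (\<lambda>s. polygon_boundary g s)" by (intro continuous_intros)
    then show ?thesis by (simp add: continuous_map_in_subtopology image_subset_iff)
  qed
  from continuous_map_compose[OF this continuous_disc_class]
  show ?thesis by (simp add: boundary_curve_def[abs_def] o_def)
qed

lemma boundary_curve_vertex: "k \<le> 4 * g \<Longrightarrow> boundary_curve g (real k) = base_vertex g"
  using disc_class_vertex[of k g] by (simp add: boundary_curve_def base_vertex_def)

lemma boundary_curve_0 [simp]: "boundary_curve g 0 = base_vertex g"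
  using boundary_curve_vertex[of 0 g] by simp

lemma edge_loop_eq_subpath: "edge_loop g k = subpath (boundary_curve g) (real k) (real (Suc k))"
  by (auto simp: edge_loop_def subpath_def boundary_curve_def)

lemma pathin_boundary_subpath: "pathin (closed_surface g) (subpath (boundary_curve g) a b)"
  by (rule pathin_subpath[OF continuous_boundary_curve]) auto

lemma boundary_subpath_concat:
  "path_homotopic (closed_surface g) (boundary_curve g a) (boundary_curve g c) (subpath (boundary_curve g) a c)
     (loop_concat (subpath (boundary_curve g) a b) (subpath (boundary_curve g) b c))"
  by (rule path_homotopic_subpath_concat[OF continuous_boundary_curve]) auto

lemma boundary_subpath_loop:
  assumes "j \<le> 4 * g" "k \<le> 4 * g"
  shows "subpath (boundary_curve g) (real j) (real k) \<in> loops (closed_surface g) (base_vertex g)"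
  using assms pathin_boundary_subpath by (simp add: loops_def boundary_curve_vertex)

lemma edge_loop_in_loops: "k < 4 * g \<Longrightarrow> edge_loop g k \<in> loops (closed_surface g) (base_vertex g)"
  unfolding edge_loop_eq_subpath by (rule boundary_subpath_loop) auto

lemma loop_class_closed: "p \<in> loops X x \<Longrightarrow> loop_class X x p \<in> carrier (fundamental_group X x)"
  by (simp add: fundamental_group_def)

lemma edge_class_closed: "k < 4 * g \<Longrightarrow> edge_class g k \<in> carrier (surface_pi1 g)"
  unfolding edge_class_def by (intro loop_class_closed edge_loop_in_loops)

lemma fundamental_group_one: "\<one>\<^bsub>fundamental_group X x\<^esub> = loop_class X x (\<lambda>_. x)"
  by (simp add: fundamental_group_def)

lemma loop_class_reverse:
  assumes x: "x \<in> topspace X" and p: "p \<in> loops X x"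
  shows "loop_class X x (\<lambda>t. p (1 - t)) = inv\<^bsub>fundamental_group X x\<^esub> (loop_class X x p)"
proof -
  interpret group "fundamental_group X x" by (rule group_fundamental_group[OF x])
  have "loop_class X x (\<lambda>t. p (1 - t)) \<otimes>\<^bsub>fundamental_group X x\<^esub> loop_class X x p = \<one>\<^bsub>fundamental_group X x\<^esub>"
    using loop_concat_left_inv[OF p] p
    by (simp add: fundamental_group_mult fundamental_group_one loop_class_eq_iff loop_concat_loops)
  then show ?thesis
    using inv_equality loop_class_closed[OF p] loop_class_closed[OF loop_concat_left_inv(1)[OF p]] by metis
qed

lemma boundary_subpath_class:
  assumes "m \<le> 4 * g"
  shows "loop_class (closed_surface g) (base_vertex g) (subpath (boundary_curve g) 0 (real m))
    = boundary_product (surface_pi1 g) (edge_class g) m"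
  using assms
proof (induction m)
  case 0
  have "subpath (boundary_curve g) 0 (real 0) = (\<lambda>_. base_vertex g)" by (simp add: subpath_def)
  then show ?case by (simp add: fundamental_group_one)
next
  case (Suc m)
  let ?X = "closed_surface g" and ?v = "base_vertex g" and ?b = "subpath (boundary_curve g)"
  have l: "?b 0 (real m) \<in> loops ?X ?v" "?b (real m) (real (Suc m)) \<in> loops ?X ?v" "?b 0 (real (Suc m)) \<in> loops ?X ?v"
    using boundary_subpath_loop[of 0 g m] boundary_subpath_loop[of m g "Suc m"] boundary_subpath_loop[of 0 g "Suc m"] Suc.prems
    by simp_all
  have "loop_homotopic ?X ?v (?b 0 (real (Suc m))) (loop_concat (?b 0 (real m)) (?b (real m) (real (Suc m))))"
    using boundary_subpath_concat[of g 0 "real (Suc m)" "real m"] boundary_curve_vertex[OF Suc.prems]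
    by (simp only: loop_homotopic_eq boundary_curve_0)
  then have "loop_class ?X ?v (?b 0 (real (Suc m))) = loop_class ?X ?v (loop_concat (?b 0 (real m)) (?b (real m) (real (Suc m))))"
    using l(3) by (simp only: loop_class_eq_iff)
  also have "\<dots> = loop_class ?X ?v (?b 0 (real m)) \<otimes>\<^bsub>surface_pi1 g\<^esub> edge_class g m"
    using l by (simp only: fundamental_group_mult edge_class_def edge_loop_eq_subpath)
  finally show ?case using Suc by simp
qed

text \<open>Before gluing, the full boundary circle contracts in the disc along straight
  lines.\<close>

lemma edge_class_relation:
  assumes g: "g \<ge> 1"
  shows "boundary_product (surface_pi1 g) (edge_class g) (4 * g) = \<one>\<^bsub>surface_pi1 g\<^esub>"
proof -
  let ?X = "closed_surface g" and ?v = "base_vertex g"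
  have end1: "polygon_boundary g (real (4 * g)) = 1"
    using polygon_boundary_wrap[OF g, of 0] by simp
  have "path_homotopic ?X ?v ?v (\<lambda>t. disc_class g (polygon_boundary g (real (4 * g) * t))) (\<lambda>t. disc_class g 1)"
    using end1 by (intro path_homotopic_convex[OF continuous_disc_class]) (auto simp: base_vertex_def intro!: continuous_intros)
  then have "loop_homotopic ?X ?v (subpath (boundary_curve g) 0 (real (4 * g))) (\<lambda>_. ?v)"
    by (simp add: loop_homotopic_eq subpath_def boundary_curve_def base_vertex_def)
  then have "loop_class ?X ?v (subpath (boundary_curve g) 0 (real (4 * g))) = \<one>\<^bsub>surface_pi1 g\<^esub>"
    using loop_homotopic_loops loop_class_eq_iff unfolding fundamental_group_one by metis
  then show ?thesis using boundary_subpath_class[of "4 * g" g] by simp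
qed

lemma edge_class_paired:
  assumes k: "k + 2 < 4 * g" "k mod 4 < 2"
  shows "edge_class g (k + 2) = inv\<^bsub>surface_pi1 g\<^esub> (edge_class g k)"
proof -
  let ?X = "closed_surface g" and ?v = "base_vertex g"
  have l: "edge_loop g k \<in> loops ?X ?v" "edge_loop g (k + 2) \<in> loops ?X ?v"
    using k by (auto intro: edge_loop_in_loops)
  have "edge_loop g (k + 2) t = edge_loop g k (1 - t)" if "t \<in> {0..1}" for t
    using disc_class_edge_pairing[OF edge_pairingI[of k g "1 - t"]] k that by (simp add: edge_loop_def)
  then have "loop_homotopic ?X ?v (edge_loop g (k + 2)) (\<lambda>t. edge_loop g k (1 - t))"
    using path_homotopic_cong[of ?X "edge_loop g (k + 2)"] l(2) by (simp add: loop_homotopic_eq loops_def)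
  then have "edge_class g (k + 2) = loop_class ?X ?v (\<lambda>t. edge_loop g k (1 - t))"
    using l(2) by (simp add: edge_class_def loop_class_eq_iff)
  also have "\<dots> = inv\<^bsub>surface_pi1 g\<^esub> (edge_class g k)"
    unfolding edge_class_def by (rule loop_class_reverse[OF base_vertex_topspace l(1)])
  finally show ?thesis .
qed

section \<open>The classes generated by edge loops\<close>

definition edge_subgroup :: "nat \<Rightarrow> (real \<Rightarrow> complex set) set set" where
  "edge_subgroup g = generate (surface_pi1 g) (edge_class g ` {..<4 * g})"

definition edge_generated :: "nat \<Rightarrow> (real \<Rightarrow> complex set) \<Rightarrow> bool" where
  "edge_generated g p \<longleftrightarrow> p \<in> loops (closed_surface g) (base_vertex g) \<and>
     loop_class (closed_surface g) (base_vertex g) p \<in> edge_subgroup g"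

lemma subgroup_edge_subgroup: "subgroup (edge_subgroup g) (surface_pi1 g)"
  unfolding edge_subgroup_def
  by (rule group.generate_is_subgroup[OF group_surface_pi1]) (auto intro: edge_class_closed)

lemma edge_generated_concat: "edge_generated g p \<Longrightarrow> edge_generated g q \<Longrightarrow> edge_generated g (loop_concat p q)"
  using subgroup.m_closed[OF subgroup_edge_subgroup, of "loop_class (closed_surface g) (base_vertex g) p" g
      "loop_class (closed_surface g) (base_vertex g) q"]
  by (simp add: edge_generated_def loop_concat_loops fundamental_group_mult)

lemma edge_generated_homotopic:
  assumes "edge_generated g p" "path_homotopic (closed_surface g) (base_vertex g) (base_vertex g) p q"
  shows "edge_generated g q"
proof -
  have h: "loop_homotopic (closed_surface g) (base_vertex g) p q" using assms(2) by (simp add: loop_homotopic_eq)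
  then show ?thesis
    using assms(1) loop_homotopic_loops[OF h] loop_class_eq_iff[of p "closed_surface g" "base_vertex g" q]
    by (simp add: edge_generated_def)
qed

lemma edge_generated_boundary:
  assumes "m \<le> 4 * g"
  shows "edge_generated g (subpath (boundary_curve g) 0 (real m))"
    "edge_generated g (subpath (boundary_curve g) (real m) 0)"
proof -
  let ?X = "closed_surface g" and ?v = "base_vertex g" and ?p = "subpath (boundary_curve g) 0 (real m)"
  have l: "?p \<in> loops ?X ?v" using boundary_subpath_loop[of 0 g m] assms by simp
  have "boundary_product (surface_pi1 g) (edge_class g) j \<in> edge_subgroup g" if "j \<le> 4 * g" for j
    using that
  proof (induction j)
    case 0
    then show ?case using subgroup.one_closed[OF subgroup_edge_subgroup] by simp
  next
    case (Suc j)
    have "edge_class g j \<in> edge_subgroup g"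
      unfolding edge_subgroup_def using Suc.prems by (intro generate.incl) auto
    then show ?case using Suc subgroup.m_closed[OF subgroup_edge_subgroup] by simp
  qed
  then have c: "loop_class ?X ?v ?p \<in> edge_subgroup g" using boundary_subpath_class[OF assms] assms by simp
  then show "edge_generated g ?p" using l by (simp add: edge_generated_def)
  have "loop_class ?X ?v (\<lambda>t. ?p (1 - t)) \<in> edge_subgroup g"
    unfolding loop_class_reverse[OF base_vertex_topspace l] using c subgroup.m_inv_closed[OF subgroup_edge_subgroup] by blast
  then show "edge_generated g (subpath (boundary_curve g) (real m) 0)"
    using loop_concat_left_inv(1)[OF l] unfolding subpath_reverse by (simp add: edge_generated_def)
qed

text \<open>The property carried along a loop: up to homotopy, a product of edge loops followed by
  the image of a path in the disc. As the disc is convex, only the end point of that path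
  matters.\<close>

definition reaches :: "nat \<Rightarrow> (real \<Rightarrow> complex set) \<Rightarrow> complex \<Rightarrow> bool" where
  "reaches g p z \<longleftrightarrow> (\<exists>l \<gamma>. edge_generated g l \<and> continuous_on {0..1} \<gamma> \<and> \<gamma> ` {0..1} \<subseteq> cball 0 1 \<and>
     \<gamma> 0 = 1 \<and> \<gamma> 1 = z \<and>
     path_homotopic (closed_surface g) (base_vertex g) (disc_class g z) p (loop_concat l (\<lambda>t. disc_class g (\<gamma> t))))"

lemma reaches_cball: "reaches g p z \<Longrightarrow> z \<in> cball 0 1"
  unfolding reaches_def by (auto simp: image_subset_iff)

lemma reaches_end: "reaches g p z \<Longrightarrow> p 1 = disc_class g z"
  unfolding reaches_def by (auto dest: path_homotopic_imp)

lemma disc_path_homotopic: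
  assumes "continuous_on {0..1} \<gamma>" "\<gamma> ` {0..1} \<subseteq> cball 0 1" "continuous_on {0..1} \<gamma>'" "\<gamma>' ` {0..1} \<subseteq> cball 0 1"
    "\<gamma> 0 = \<gamma>' 0" "\<gamma> 1 = \<gamma>' 1"
  shows "path_homotopic (closed_surface g) (disc_class g (\<gamma> 0)) (disc_class g (\<gamma> 1)) (\<lambda>t. disc_class g (\<gamma> t)) (\<lambda>t. disc_class g (\<gamma>' t))"
  using assms by (intro path_homotopic_convex[OF continuous_disc_class]) (auto simp: image_subset_iff)

text \<open>
  The end point may be replaced by any other representative of its class: crossing an edge only
  costs a further product of edge loops.
\<close>

lemma reaches_move:
  assumes r: "reaches g p (polygon_boundary g s)" and m: "m \<le> 4 * g" "m' \<le> 4 * g"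
    and eq: "\<And>t. t \<in> {0..1} \<Longrightarrow> subpath (boundary_curve g) (real m) s t = subpath (boundary_curve g) (real m') s' t"
  shows "reaches g p (polygon_boundary g s')"
proof -
  let ?X = "closed_surface g" and ?v = "base_vertex g" and ?b = "subpath (boundary_curve g)"
  obtain l \<gamma> where l: "edge_generated g l" and \<gamma>: "continuous_on {0..1} \<gamma>" "\<gamma> ` {0..1} \<subseteq> cball 0 1"
    "\<gamma> 0 = 1" "\<gamma> 1 = polygon_boundary g s"
    and p: "path_homotopic ?X ?v (boundary_curve g s) p (loop_concat l (\<lambda>t. disc_class g (\<gamma> t)))"
    using r unfolding reaches_def boundary_curve_def by blast
  have ends: "boundary_curve g (real m) = ?v" "boundary_curve g (real m') = ?v"
    using m boundary_curve_vertex by auto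
  have ss': "boundary_curve g s' = boundary_curve g s" using eq[of 1] by simp
  \<comment> \<open>The path in the disc is pushed to the boundary arc ending at parameter
    \<open>s\<close>. Cutting the arc at vertex \<open>m\<close> and returning from vertex
    \<open>m'\<close> splits off a loop of whole edges.\<close>
  have "continuous_on {0..1} (\<lambda>t. polygon_boundary g (s * t))" by (intro continuous_intros)
  moreover have "(\<lambda>t. polygon_boundary g (s * t)) ` {0..1} \<subseteq> cball 0 1" by (intro image_subsetI) simp
  ultimately have "path_homotopic ?X ?v (boundary_curve g s) (\<lambda>t. disc_class g (\<gamma> t)) (\<lambda>t. disc_class g (polygon_boundary g (s * t)))"
    using disc_path_homotopic[OF \<gamma>(1,2), of "\<lambda>t. polygon_boundary g (s * t)" g] \<gamma>(3,4)
    by (simp add: base_vertex_def boundary_curve_def)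
  also have "(\<lambda>t. disc_class g (polygon_boundary g (s * t))) = ?b 0 s"
    by (simp add: subpath_def boundary_curve_def)
  also have "path_homotopic ?X ?v (boundary_curve g s) (?b 0 s) (loop_concat (?b 0 (real m)) (?b (real m) s))"
    using boundary_subpath_concat[of g 0 s "real m"] by simp
  also have "path_homotopic ?X ?v (boundary_curve g s) (loop_concat (?b 0 (real m)) (?b (real m) s))
      (loop_concat (?b 0 (real m)) (?b (real m') s'))"
  proof (rule path_homotopic_concat_refl[OF pathin_boundary_subpath])
    show "path_homotopic ?X ?v (boundary_curve g s) (?b (real m) s) (?b (real m') s')"
      using path_homotopic_cong[OF pathin_boundary_subpath eq] ends by simp
  qed (simp_all add: ends)
  also have "path_homotopic ?X ?v (boundary_curve g s) (loop_concat (?b 0 (real m)) (?b (real m') s'))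
      (loop_concat (?b 0 (real m)) (loop_concat (?b (real m') 0) (?b 0 s')))"
  proof (rule path_homotopic_concat_refl[OF pathin_boundary_subpath])
    show "path_homotopic ?X ?v (boundary_curve g s) (?b (real m') s') (loop_concat (?b (real m') 0) (?b 0 s'))"
      using boundary_subpath_concat[of g "real m'" s' 0] ends ss' by simp
  qed (simp_all add: ends)
  also have "path_homotopic ?X ?v (boundary_curve g s) (loop_concat (?b 0 (real m)) (loop_concat (?b (real m') 0) (?b 0 s')))
      (loop_concat (loop_concat (?b 0 (real m)) (?b (real m') 0)) (?b 0 s'))"
    using path_homotopic_sym[OF path_homotopic_assoc[OF pathin_boundary_subpath pathin_boundary_subpath pathin_boundary_subpath,
        of g 0 "real m" "real m'" 0 0 s']] by (simp add: ends ss')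
  finally have q: "path_homotopic ?X ?v (boundary_curve g s) (\<lambda>t. disc_class g (\<gamma> t))
      (loop_concat (loop_concat (?b 0 (real m)) (?b (real m') 0)) (?b 0 s'))" .
  let ?l = "loop_concat (?b 0 (real m)) (?b (real m') 0)"
  have gen: "edge_generated g ?l" using m edge_generated_boundary by (intro edge_generated_concat) auto
  have lp: "pathin ?X l" "l 0 = ?v" "l 1 = ?v" "pathin ?X ?l" "?l 0 = ?v" "?l 1 = ?v"
    using l gen by (auto simp: edge_generated_def loops_def)
  have "path_homotopic ?X ?v (boundary_curve g s) p (loop_concat l (loop_concat ?l (?b 0 s')))"
    using p path_homotopic_concat_refl[OF lp(1,2,3) q] by (rule path_homotopic_trans)
  also have "path_homotopic ?X ?v (boundary_curve g s) \<dots> (loop_concat (loop_concat l ?l) (?b 0 s'))"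
    using path_homotopic_sym[OF path_homotopic_assoc[OF lp(1) lp(4) pathin_boundary_subpath, of 0 s']] lp ss' by simp
  finally have "path_homotopic ?X ?v (disc_class g (polygon_boundary g s')) p
      (loop_concat (loop_concat l ?l) (\<lambda>t. disc_class g (polygon_boundary g (s' * t))))"
    using ss' by (simp add: subpath_def boundary_curve_def)
  then show ?thesis
    unfolding reaches_def using edge_generated_concat[OF l gen]
    by (intro exI[of _ "loop_concat l ?l"] exI[of _ "\<lambda>t. polygon_boundary g (s' * t)"])
      (auto intro!: continuous_intros)
qed

lemma reaches_pair:
  assumes "edge_pairing g z w"
  shows "reaches g p z \<longleftrightarrow> reaches g p w"
proof -
  obtain k t where k: "k + 2 < 4 * g" "k mod 4 < 2" "0 \<le> t" "t \<le> 1"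
    "z = polygon_boundary g (real k + t)" "w = polygon_boundary g (real (k + 2) + (1 - t))"
    using assms by (rule edge_pairingE)
  \<comment> \<open>The partner of the point at distance \<open>t\<close> after vertex
    \<open>k\<close> lies at distance \<open>t\<close> before vertex \<open>k + 3\<close>, and the
    arcs from these vertices are glued to each other.\<close>
  have eq: "subpath (boundary_curve g) (real k) (real k + t) u = subpath (boundary_curve g) (real (k + 3)) (real (k + 2) + (1 - t)) u"
    if u: "u \<in> {0..1}" for u
  proof -
    have "0 \<le> t * u" "t * u \<le> 1" using k u by (auto simp: mult_le_one)
    then have "boundary_curve g (real k + t * u) = boundary_curve g (real (k + 2) + (1 - t * u))"
      using disc_class_edge_pairing[OF edge_pairingI[of k g "t * u"]] k by (simp add: boundary_curve_def)
    then show ?thesis by (simp add: subpath_def algebra_simps)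
  qed
  show ?thesis
    using reaches_move[of g p "real k + t" k "k + 3" "real (k + 2) + (1 - t)"]
      reaches_move[of g p "real (k + 2) + (1 - t)" "k + 3" k "real k + t"] eq k by auto
qed

lemma reaches_class:
  assumes "reaches g p z" "w \<in> cball 0 1" "disc_class g z = disc_class g w"
  shows "reaches g p w"
  using equivclp_invariant[of "edge_pairing g" z w "reaches g p"] reaches_pair assms reaches_cball[OF assms(1)]
  by (auto simp: disc_class_eq_iff)

text \<open>The lift of the short path \<open>q\<close> may begin at another representative of
  \<open>p 1\<close>; the point reached is moved there first, and then the two paths in the disc are
  joined.\<close>

lemma reaches_extend:
  assumes r: "reaches g p z" and \<gamma>: "continuous_on {0..1} \<gamma>" "\<gamma> ` {0..1} \<subseteq> cball 0 1"
    and q: "path_homotopic (closed_surface g) (p 1) (disc_class g (\<gamma> 1)) q (\<lambda>t. disc_class g (\<gamma> t))"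
    and p': "path_homotopic (closed_surface g) (base_vertex g) (disc_class g (\<gamma> 1)) p' (loop_concat p q)"
  shows "reaches g p' (\<gamma> 1)"
proof -
  let ?X = "closed_surface g" and ?v = "base_vertex g"
  have "disc_class g (\<gamma> 0) = p 1" using path_homotopic_imp[OF q] by simp
  moreover have "\<gamma> 0 \<in> cball 0 1" by (rule set_mp[OF \<gamma>(2)]) simp
  ultimately have "reaches g p (\<gamma> 0)" using reaches_class[OF r] reaches_end[OF r] by simp
  then obtain l \<beta> where l: "edge_generated g l" and \<beta>: "continuous_on {0..1} \<beta>" "\<beta> ` {0..1} \<subseteq> cball 0 1"
    "\<beta> 0 = 1" "\<beta> 1 = \<gamma> 0"
    and p: "path_homotopic ?X ?v (disc_class g (\<gamma> 0)) p (loop_concat l (\<lambda>t. disc_class g (\<beta> t)))"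
    unfolding reaches_def by blast
  have pb: "pathin ?X (\<lambda>t. disc_class g (\<beta> t))" and pg: "pathin ?X (\<lambda>t. disc_class g (\<gamma> t))"
    using disc_path_homotopic[OF \<beta>(1,2) \<beta>(1,2), of g] disc_path_homotopic[OF \<gamma> \<gamma>, of g]
    by (auto dest: path_homotopic_imp)
  have lp: "pathin ?X l" "l 0 = ?v" "l 1 = ?v" using l by (auto simp: edge_generated_def loops_def)
  have q': "path_homotopic ?X (disc_class g (\<gamma> 0)) (disc_class g (\<gamma> 1)) q (\<lambda>t. disc_class g (\<gamma> t))"
    using q \<open>disc_class g (\<gamma> 0) = p 1\<close> by simp
  define \<delta> where "\<delta> = (\<lambda>t. if t \<le> 1/2 then \<beta> (2 * t) else \<gamma> (2 * t - 1))"
  have \<delta>: "continuous_on {0..1} \<delta>" "\<delta> ` {0..1} \<subseteq> cball 0 1" "\<delta> 0 = 1" "\<delta> 1 = \<gamma> 1"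
  proof -
    show "continuous_on {0..1} \<delta>"
      unfolding \<delta>_def
    proof (rule continuous_on_cases_le[where h = "\<lambda>t. t"])
      show "continuous_on {t \<in> {0..1}. t \<le> 1/2} (\<lambda>t. \<beta> (2 * t))"
        by (rule continuous_on_compose2[OF \<beta>(1)]) (auto intro!: continuous_intros)
      show "continuous_on {t \<in> {0..1}. 1/2 \<le> t} (\<lambda>t. \<gamma> (2 * t - 1))"
        by (rule continuous_on_compose2[OF \<gamma>(1)]) (auto intro!: continuous_intros)
      show "\<beta> (2 * t) = \<gamma> (2 * t - 1)" if "t \<in> {0..1}" "t = 1/2" for t
        using \<beta>(4) by (simp add: that(2))
    qed (auto intro!: continuous_intros)
    show "\<delta> ` {0..1} \<subseteq> cball 0 1"
      using \<beta>(2) \<gamma>(2) unfolding \<delta>_def image_subset_iff by auto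
  qed (simp_all add: \<delta>_def \<beta>)
  have "loop_concat (\<lambda>t. disc_class g (\<beta> t)) (\<lambda>t. disc_class g (\<gamma> t)) = (\<lambda>t. disc_class g (\<delta> t))"
    by (simp add: fun_eq_iff loop_concat_def \<delta>_def)
  then have "path_homotopic ?X ?v (disc_class g (\<gamma> 1))
      (loop_concat (loop_concat l (\<lambda>t. disc_class g (\<beta> t))) (\<lambda>t. disc_class g (\<gamma> t)))
      (loop_concat l (\<lambda>t. disc_class g (\<delta> t)))"
    using path_homotopic_assoc[OF lp(1) pb pg] lp \<beta> by (simp add: base_vertex_def)
  moreover have "path_homotopic ?X ?v (disc_class g (\<gamma> 1)) (loop_concat p q)
      (loop_concat (loop_concat l (\<lambda>t. disc_class g (\<beta> t))) (\<lambda>t. disc_class g (\<gamma> t)))"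
    using path_homotopic_concat[OF p q'] .
  ultimately have "path_homotopic ?X ?v (disc_class g (\<gamma> 1)) p' (loop_concat l (\<lambda>t. disc_class g (\<delta> t)))"
    using p' path_homotopic_trans by metis
  then show ?thesis unfolding reaches_def using l \<delta> by blast
qed

text \<open>The times up to which a loop can be followed form a set stable under small moves
  forwards and backwards, hence the whole interval. At the end the path in the disc can be taken
  closed, and it contracts.\<close>

theorem surface_pi1_generated:
  assumes g: "g \<ge> 1"
  shows "carrier (surface_pi1 g) = edge_subgroup g"
proof
  show "edge_subgroup g \<subseteq> carrier (surface_pi1 g)"
    by (rule subgroup.subset[OF subgroup_edge_subgroup])
  show "carrier (surface_pi1 g) \<subseteq> edge_subgroup g"
  proof
    let ?X = "closed_surface g" and ?v = "base_vertex g"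
    fix A assume "A \<in> carrier (surface_pi1 g)"
    then obtain p where p: "p \<in> loops ?X ?v" "A = loop_class ?X ?v p" by (auto simp: fundamental_group_def)
    have path: "pathin ?X p" "p 0 = ?v" "p 1 = ?v" using p by (auto simp: loops_def)
    then have pc: "continuous_map (top_of_set {0..1}) ?X p" by (simp add: pathin_def)
    define R where "R t \<longleftrightarrow> (\<exists>z. reaches g (subpath p 0 t) z)" for t
    have sub: "path_homotopic ?X ?v (p b) (subpath p 0 b) (loop_concat (subpath p 0 a) (subpath p a b))"
      if "a \<in> {0..1}" "b \<in> {0..1}" for a b
      using path_homotopic_subpath_concat[OF pc, of 0 a b] that path(2) by auto
    have "R 1"
    proof (rule connected_induction_simple[of "{0..1::real}" 0 1 R])
      have "edge_generated g (\<lambda>_. ?v)"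
        using edge_generated_boundary(1)[of 0 g] by (simp add: subpath_def)
      moreover have "path_homotopic ?X ?v ?v (\<lambda>_. ?v) (loop_concat (\<lambda>_. ?v) (\<lambda>_. ?v))"
        using base_vertex_topspace[of g] by (simp add: path_homotopic_refl loop_concat_def pathin_def)
      ultimately have "reaches g (subpath p 0 0) 1"
        unfolding reaches_def subpath_def base_vertex_def[symmetric] using path(2)
        by (intro exI[of _ "\<lambda>_. ?v"] exI[of _ "\<lambda>_. 1"]) (auto simp: base_vertex_def)
      then show "R 0" unfolding R_def by blast
    next
      fix s :: real assume s: "s \<in> {0..1}"
      have "p s \<in> topspace ?X" using continuous_map_image_subset_topspace[OF pc] s by auto
      from short_paths_lift[OF surface_locally_contractible[OF g this] s path(1)]
      obtain e where e: "e > 0" "\<And>t. t \<in> {0..1} \<Longrightarrow> \<bar>t - s\<bar> < e \<Longrightarrow> \<exists>\<gamma>. continuous_on {0..1} \<gamma> \<and> \<gamma> ` {0..1} \<subseteq> cball 0 1 \<and>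
        path_homotopic ?X (p s) (p t) (subpath p s t) (\<lambda>l. disc_class g (\<gamma> l))" by blast
      have "R t \<longleftrightarrow> R s" if t: "t \<in> {0..1}" "\<bar>t - s\<bar> < e" for t
      proof -
        obtain \<gamma> where \<gamma>: "continuous_on {0..1} \<gamma>" "\<gamma> ` {0..1} \<subseteq> cball 0 1"
          "path_homotopic ?X (p s) (p t) (subpath p s t) (\<lambda>l. disc_class g (\<gamma> l))" using e(2)[OF t] by blast
        note ends = path_homotopic_imp[OF \<gamma>(3)]
        have \<gamma>': "continuous_on {0..1} (\<lambda>l. \<gamma> (1 - l))" "(\<lambda>l. \<gamma> (1 - l)) ` {0..1} \<subseteq> cball 0 1"
          using \<gamma>(2) by (auto intro!: continuous_on_compose2[OF \<gamma>(1)] continuous_intros simp: image_subset_iff)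
        have "path_homotopic ?X (p t) (p s) (subpath p t s) (\<lambda>l. disc_class g (\<gamma> (1 - l)))"
          using path_homotopic_reverse[OF \<gamma>(3)] by (simp only: subpath_reverse)
        then have "R t \<Longrightarrow> R s"
          unfolding R_def using reaches_extend[OF _ \<gamma>', of g "subpath p 0 t" _ "subpath p t s" "subpath p 0 s"] sub[OF t(1) s] ends
          by auto
        moreover have "R s \<Longrightarrow> R t"
          unfolding R_def using reaches_extend[OF _ \<gamma>(1,2), of g "subpath p 0 s" _ "subpath p s t" "subpath p 0 t"] sub[OF s t(1)] ends \<gamma>(3)
          by auto
        ultimately show ?thesis by blast
      qed
      then have "\<forall>x\<in>{0..1} \<inter> ball s e. \<forall>y\<in>{0..1} \<inter> ball s e. R x \<longrightarrow> R y"
        by (auto simp: dist_real_def abs_minus_commute)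
      moreover have "openin (top_of_set {0..1}) ({0..1} \<inter> ball s e)" "s \<in> {0..1} \<inter> ball s e"
        using s e(1) by (auto simp: openin_open_Int)
      ultimately show "\<exists>T. openin (top_of_set {0..1}) T \<and> s \<in> T \<and> (\<forall>x\<in>T. \<forall>y\<in>T. R x \<longrightarrow> R y)" by blast
    qed auto
    then obtain z where z: "reaches g p z" by (auto simp: R_def subpath_def)
    have "reaches g p 1"
      using reaches_class[OF z, of 1] reaches_end[OF z] path(3) by (simp add: base_vertex_def)
    then obtain l \<gamma> where l: "edge_generated g l" and \<gamma>: "continuous_on {0..1} \<gamma>" "\<gamma> ` {0..1} \<subseteq> cball 0 1"
      "\<gamma> 0 = 1" "\<gamma> 1 = 1" and h: "path_homotopic ?X ?v ?v p (loop_concat l (\<lambda>t. disc_class g (\<gamma> t)))"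
      unfolding reaches_def base_vertex_def by blast
    have lp: "pathin ?X l" "l 0 = ?v" "l 1 = ?v" using l by (auto simp: edge_generated_def loops_def)
    have "path_homotopic ?X ?v ?v (\<lambda>t. disc_class g (\<gamma> t)) (\<lambda>t. ?v)"
      using disc_path_homotopic[OF \<gamma>(1,2), of "\<lambda>_. 1" g] \<gamma>(3,4)
      by (simp add: base_vertex_def image_subset_iff)
    from path_homotopic_concat_refl[OF lp this]
    have "path_homotopic ?X ?v ?v (loop_concat l (\<lambda>t. disc_class g (\<gamma> t))) (loop_concat l (\<lambda>t. ?v))" .
    moreover have "path_homotopic ?X ?v ?v (loop_concat l (\<lambda>t. ?v)) l"
      using path_homotopic_right_unit[OF lp(1)] lp by simp
    ultimately have "path_homotopic ?X ?v ?v l p"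
      using h path_homotopic_trans path_homotopic_sym by metis
    then have "edge_generated g p" using edge_generated_homotopic[OF l] by blast
    then show "A \<in> edge_subgroup g" using p by (simp add: edge_generated_def)
  qed
qed

section \<open>Free subgroups and surface subgroups\<close>

lemma inv_letter_inv_letter [simp]: "inv_letter (inv_letter l) = l"
  by (simp add: inv_letter_def)

lemma reduced_words_append:
  "v @ w \<in> reduced_words S \<longleftrightarrow> v \<in> reduced_words S \<and> w \<in> reduced_words S \<and>
     (v \<noteq> [] \<longrightarrow> w \<noteq> [] \<longrightarrow> hd w \<noteq> inv_letter (last v))"
  by (induction v) (auto simp: reduced_words_Cons hd_append)

lemma reduced_inv_word: "w \<in> reduced_words UNIV \<Longrightarrow> inv_word w \<in> reduced_words UNIV"
proof (induction w)
  case (Cons l w)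
  have "inv_word (l # w) = inv_word w @ [inv_letter l]" by (simp add: inv_word_def)
  moreover have "last (inv_word w) = inv_letter (hd w)" if "w \<noteq> []"
    using that by (simp add: inv_word_def last_rev hd_map)
  moreover have "inv_word w = [] \<longleftrightarrow> w = []" by (simp add: inv_word_def)
  ultimately show ?case
    using Cons by (auto simp: reduced_words_append reduced_words_Cons)
qed (simp add: inv_word_def)

text \<open>Equal first letters cancel; if they differ, the inverse of one word followed by the
  other is reduced, nonempty and of trivial value.\<close>

lemma reduced_word_unique:
  assumes "v \<in> reduced_words UNIV" "w \<in> reduced_words UNIV" "ev SL2 rho v = ev SL2 rho w"
  shows "v = w"
  using assms
proof (induction v arbitrary: w)
  case Nil
  then show ?case using reduced_word_nontrivial[of w] by force
next
  case (Cons l v)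
  show ?case
  proof (cases w)
    case Nil
    then show ?thesis using Cons.prems reduced_word_nontrivial[of "l # v"] by simp
  next
    case (Cons m u)
    show ?thesis
    proof (cases "l = m")
      case True
      have "ev_letter l \<in> carrier SL2" by (simp add: ev_letter_def)
      then have "ev SL2 rho v = ev SL2 rho u"
        using Cons.prems(3) by (simp add: Cons True ev_rho_Cons)
      then show ?thesis using Cons.IH[of u] Cons.prems by (simp add: Cons True reduced_words_Cons)
    next
      case False
      have "last (inv_word w) = inv_letter m" "inv_word w \<noteq> []"
        using Cons by (simp_all add: inv_word_def)
      then have "inv_word w @ l # v \<in> reduced_words UNIV"
        using Cons.prems reduced_inv_word[of w] False by (simp add: reduced_words_append)
      moreover have "ev SL2 rho (inv_word w @ l # v) = \<one>\<^bsub>SL2\<^esub>"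
        using Cons.prems(3) by (simp add: SL2.ev_append SL2.ev_inv_word del: SL2_one)
      ultimately show ?thesis using reduced_word_nontrivial by blast
    qed
  qed
qed

lemma reduced_words_map:
  assumes "inj f" "range f \<subseteq> S" "w \<in> reduced_words UNIV"
  shows "map (map_prod f (\<lambda>e. e)) w \<in> reduced_words S"
  using assms(3)
proof (induction w)
  case (Cons l w)
  have "map_prod f (\<lambda>e. e) m = inv_letter (map_prod f (\<lambda>e. e) l) \<longleftrightarrow> m = inv_letter l" for m
    using assms(1) by (cases l; cases m) (auto simp: inv_letter_def dest: injD)
  moreover have "f (fst l) \<in> S" using assms(2) by blast
  ultimately show ?case
    using Cons by (cases l) (auto simp: reduced_words_Cons hd_map)
qed simp

lemma reduced_words_map_iff:
  assumes "v \<in> reduced_words (range f)"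
  shows "\<exists>w. w \<in> reduced_words UNIV \<and> v = map (map_prod f (\<lambda>e. e)) w"
  using assms
proof (induction v)
  case Nil
  then show ?case by (intro exI[of _ "[]"]) simp
next
  case (Cons l v)
  then obtain w where w: "w \<in> reduced_words UNIV" "v = map (map_prod f (\<lambda>e. e)) w"
    by (auto simp: reduced_words_Cons)
  obtain s where s: "fst l = f s" using Cons.prems by (auto simp: reduced_words_Cons)
  have "hd w \<noteq> inv_letter (s, snd l)" if "w \<noteq> []"
  proof
    assume "hd w = inv_letter (s, snd l)"
    then have "hd v = inv_letter l" using that w(2) s by (cases l) (simp add: hd_map inv_letter_def)
    then show False using Cons.prems that w(2) by (simp add: reduced_words_Cons)
  qed
  then show ?case
    using w s by (intro exI[of _ "(s, snd l) # w"]) (cases l, auto simp: reduced_words_Cons)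
qed

text \<open>Values in \<open>G\<close> are compared through the matrices: equal values give equal
  matrices, hence equal reduced words.\<close>

lemma (in group) free_subgroup_of_faithful:
  assumes f: "\<And>g. f g \<in> carrier G" and faithful: "\<And>w. ev G f w = \<one> \<Longrightarrow> ev SL2 rho w = \<one>\<^bsub>SL2\<^esub>"
  shows "\<exists>H. subgroup H G \<and> nonabelian_free_group (G\<lparr>carrier := H\<rparr>)"
proof -
  have same: "ev SL2 rho v = ev SL2 rho w" if "ev G f v = ev G f w" for v w
  proof -
    have "ev G f (v @ inv_word w) = \<one>" using that f by (simp add: ev_append ev_inv_word)
    then have "ev SL2 rho (v @ inv_word w) = \<one>\<^bsub>SL2\<^esub>" by (rule faithful)
    then have "ev SL2 rho v \<otimes>\<^bsub>SL2\<^esub> inv\<^bsub>SL2\<^esub> (ev SL2 rho w) = \<one>\<^bsub>SL2\<^esub>"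
      by (simp add: SL2.ev_append SL2.ev_inv_word del: SL2_one)
    then show ?thesis
      using SL2.inv_equality[of "ev SL2 rho v" "inv\<^bsub>SL2\<^esub> (ev SL2 rho w)"] by (simp del: SL2_one)
  qed
  have inj: "inj f"
  proof (rule injI)
    fix x y assume "f x = f y"
    then have "ev G f [(x, True)] = ev G f [(y, True)]" by (simp add: ev_Cons)
    then have "ev SL2 rho [(x, True)] = ev SL2 rho [(y, True)]" by (rule same)
    then show "x = y" by (cases x; cases y) (simp_all add: ev_rho_Cons)
  qed
  define H where "H = range (ev G f)"
  have H: "subgroup H G"
  proof (rule subgroupI)
    show "H \<subseteq> carrier G" using f by (auto simp: H_def)
    show "H \<noteq> {}" by (simp add: H_def)
    show "inv a \<in> H" if "a \<in> H" for a
    proof -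
      obtain w where "a = ev G f w" using \<open>a \<in> H\<close> by (auto simp: H_def)
      then show ?thesis using ev_inv_word[of f w] f by (metis H_def rangeI)
    qed
    show "a \<otimes> b \<in> H" if ab: "a \<in> H" "b \<in> H" for a b
    proof -
      obtain v w where "a = ev G f v" "b = ev G f w" using ab by (auto simp: H_def)
      then show ?thesis using f ev_append[of f v w] by (metis H_def rangeI)
    qed
  qed
  have fH: "f x \<in> H" for x
  proof -
    have "f x = ev G f [(x, True)]" using f by (simp add: ev_Cons)
    then show ?thesis unfolding H_def by blast
  qed
  have val: "word_value (G\<lparr>carrier := H\<rparr>) (map (map_prod f (\<lambda>e. e)) w) = ev G f w" for w
    unfolding word_value_map using ev_subgroup[OF is_group H, of f w] fH by blast
  have "bij_betw (word_value (G\<lparr>carrier := H\<rparr>)) (reduced_words (range f)) H"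
    unfolding bij_betw_def
  proof (intro conjI inj_onI subset_antisym subsetI)
    fix v w assume vw: "v \<in> reduced_words (range f)" "w \<in> reduced_words (range f)"
      "word_value (G\<lparr>carrier := H\<rparr>) v = word_value (G\<lparr>carrier := H\<rparr>) w"
    obtain v' w' where "v' \<in> reduced_words UNIV" "v = map (map_prod f (\<lambda>e. e)) v'"
      "w' \<in> reduced_words UNIV" "w = map (map_prod f (\<lambda>e. e)) w'"
      using reduced_words_map_iff vw by metis
    then show "v = w" using vw(3) same[of v' w'] reduced_word_unique[of v' w'] by (simp add: val)
  next
    fix a assume "a \<in> word_value (G\<lparr>carrier := H\<rparr>) ` reduced_words (range f)"
    then obtain v where "v \<in> reduced_words (range f)" "a = word_value (G\<lparr>carrier := H\<rparr>) v" by blast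
    then obtain w where "a = ev G f w" using reduced_words_map_iff val by metis
    then show "a \<in> H" by (simp add: H_def)
  next
    fix a assume "a \<in> H"
    then obtain w where "a = ev G f w" by (auto simp: H_def)
    then have "a = word_value (G\<lparr>carrier := H\<rparr>) (map (map_prod f (\<lambda>e. e)) (reduce w))"
      using f by (simp add: val ev_reduce)
    moreover have "map (map_prod f (\<lambda>e. e)) (reduce w) \<in> reduced_words (range f)"
      using reduced_words_map[OF inj order_refl] reduce_reduced[of w UNIV] by simp
    ultimately show "a \<in> word_value (G\<lparr>carrier := H\<rparr>) ` reduced_words (range f)" by blast
  qed
  then have "free_basis (G\<lparr>carrier := H\<rparr>) (range f)"
    using fH by (auto simp: free_basis_def)
  moreover have "f True \<noteq> f False" using inj by (auto dest: injD)
  moreover have "group (G\<lparr>carrier := H\<rparr>)" by (rule subgroup.subgroup_is_group[OF H is_group])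
  ultimately have "nonabelian_free_group (G\<lparr>carrier := H\<rparr>)"
    unfolding nonabelian_free_group_def by blast
  with H show ?thesis by blast
qed

text \<open>Two distinct basis elements suffice. A reduced word in them is reduced over the whole
  basis, so a trivial value makes it empty, and then its matrix is trivial too.\<close>

lemma (in group) faithful_of_free_subgroup:
  assumes H: "subgroup H G" "nonabelian_free_group (G\<lparr>carrier := H\<rparr>)"
  shows "\<exists>f. (\<forall>g. f g \<in> carrier G) \<and> (\<forall>w. ev G f w = \<one> \<longrightarrow> ev SL2 rho w = \<one>\<^bsub>SL2\<^esub>)"
proof -
  obtain S s t where S: "free_basis (G\<lparr>carrier := H\<rparr>) S" "s \<in> S" "t \<in> S" "s \<noteq> t"
    using H(2) unfolding nonabelian_free_group_def by blast
  define f where "f g = (if g then s else t)" for g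
  have "S \<subseteq> H" using S(1) by (simp add: free_basis_def)
  then have fH: "f g \<in> H" for g using S by (auto simp: f_def)
  then have f: "f g \<in> carrier G" for g using subgroup.subset[OF H(1)] by blast
  have inj: "inj f" using S(4) by (auto simp: inj_def f_def)
  have rf: "range f \<subseteq> S" using S by (auto simp: f_def)
  have inj_val: "inj_on (word_value (G\<lparr>carrier := H\<rparr>)) (reduced_words S)"
    using S(1) by (simp add: free_basis_def bij_betw_def)
  have "ev SL2 rho w = \<one>\<^bsub>SL2\<^esub>" if w: "ev G f w = \<one>" for w
  proof -
    have r: "reduce w \<in> reduced_words UNIV" by (rule reduce_reduced) simp
    have "word_value (G\<lparr>carrier := H\<rparr>) (map (map_prod f (\<lambda>e. e)) (reduce w)) = ev G f (reduce w)"
      unfolding word_value_map using ev_subgroup[OF is_group H(1), of f] fH by blast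
    also have "\<dots> = word_value (G\<lparr>carrier := H\<rparr>) []"
      using w f by (simp add: ev_reduce word_value_def)
    finally have "map (map_prod f (\<lambda>e. e)) (reduce w) = []"
      using inj_onD[OF inj_val] reduced_words_map[OF inj rf r] by force
    then show ?thesis using SL2.ev_reduce[of rho w] by simp
  qed
  with f show ?thesis by blast
qed

subsection \<open>From free groups to surface groups\<close>

text \<open>In the second handle \<open>E 5\<close> plays the first generator and \<open>E 4\<close>
  the second; this exchange turns the relation of genus 2 into equality of the two
  commutators.\<close>

definition genus_two_letters :: "(nat \<Rightarrow> 'k) \<Rightarrow> bool \<times> bool \<Rightarrow> 'k" where
  "genus_two_letters E = (\<lambda>(h, g). E ((if h then 4 else 0) + (if h = g then 1 else 0)))"

lemma (in group) boundary_product_8: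
  assumes E: "\<And>k. k < 8 \<Longrightarrow> E k \<in> carrier G"
    and pair: "E 2 = inv (E 0)" "E 3 = inv (E 1)" "E 6 = inv (E 4)" "E 7 = inv (E 5)"
  shows "boundary_product G E 8 = \<one> \<longleftrightarrow>
    ev G (\<lambda>g. genus_two_letters E (False, g)) comm_word = ev G (\<lambda>g. genus_two_letters E (True, g)) comm_word"
proof -
  have c: "E 0 \<in> carrier G" "E 1 \<in> carrier G" "E 4 \<in> carrier G" "E 5 \<in> carrier G" using E by auto
  let ?p = "E 0 \<otimes> E 1 \<otimes> inv (E 0) \<otimes> inv (E 1)" and ?q = "E 4 \<otimes> E 5 \<otimes> inv (E 4) \<otimes> inv (E 5)"
  have "boundary_product G E 8 = \<one> \<otimes> E 0 \<otimes> E 1 \<otimes> E 2 \<otimes> E 3 \<otimes> E 4 \<otimes> E 5 \<otimes> E 6 \<otimes> E 7"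
    by (simp add: eval_nat_numeral)
  also have "\<dots> = ?p \<otimes> ?q" using c by (simp add: pair m_assoc)
  finally have 1: "boundary_product G E 8 = ?p \<otimes> ?q" .
  have 2: "ev G (\<lambda>g. genus_two_letters E (False, g)) comm_word = ?p"
    using c by (simp add: comm_word_def ev_Cons genus_two_letters_def m_assoc)
  have 3: "ev G (\<lambda>g. genus_two_letters E (True, g)) comm_word = inv ?q"
    using c by (simp add: comm_word_def ev_Cons genus_two_letters_def m_assoc inv_mult_group)
  show ?thesis
    unfolding 1 2 3 using c by (metis inv_closed inv_equality inv_inv l_inv m_closed)
qed

lemma (in compact_group) surface_subgroup_of_faithful:
  assumes f: "\<And>g. f g \<in> carrier G" and faithful: "\<And>w. ev G f w = \<one> \<Longrightarrow> ev SL2 rho w = \<one>\<^bsub>SL2\<^esub>"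
  shows "\<exists>H. subgroup H G \<and> surface_group (G\<lparr>carrier := H\<rparr>)"
proof -
  let ?P = "surface_pi1 2" and ?E = "edge_class 2"
  interpret P: group ?P by (rule group_surface_pi1)
  have E: "?E k \<in> carrier ?P" if "k < 8" for k using that by (intro edge_class_closed) simp
  have pair: "?E 2 = inv\<^bsub>?P\<^esub> (?E 0)" "?E 3 = inv\<^bsub>?P\<^esub> (?E 1)" "?E 6 = inv\<^bsub>?P\<^esub> (?E 4)" "?E 7 = inv\<^bsub>?P\<^esub> (?E 5)"
    using edge_class_paired[of 0 2] edge_class_paired[of 1 2] edge_class_paired[of 4 2] edge_class_paired[of 5 2]
    by (simp_all add: numeral_2_eq_2 numeral_3_eq_3)
  define F where "F = genus_two_letters ?E"
  have F: "F l \<in> carrier ?P" for l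
    by (cases l) (auto simp: F_def genus_two_letters_def intro: E)
  have am: "amalgamated ?P F"
    using P.boundary_product_8[OF E pair] edge_class_relation[of 2] F by (simp add: amalgamated_def F_def)
  have "\<exists>t\<in>carrier G. amalgamated G (twist G t f) \<and>
      (\<forall>w. ev G (twist G t f) w = \<one> \<longrightarrow> ev ?P F w = \<one>\<^bsub>?P\<^esub>)"
    by (rule generic_conjugator[where f = f, OF f faithful P.is_group am])
  then obtain t where t: "t \<in> carrier G" "amalgamated G (twist G t f)"
    "\<And>w. ev G (twist G t f) w = \<one> \<Longrightarrow> ev ?P F w = \<one>\<^bsub>?P\<^esub>"
    by auto
  define W where "W = twist G t f"
  have W: "W l \<in> carrier G" for l using t(2) by (cases l) (simp add: amalgamated_def W_def)
  \<comment> \<open>The inverse of the numbering in \<open>genus_two_letters\<close> on the edges 0,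
    1, 4, 5; each glued edge, two places later, repeats the generator, and \<open>L\<close> inverts
    it.\<close>
  define B where "B k = W (k \<ge> 4, (k \<ge> 4) = odd k)" for k :: nat
  define L where "L k = (if k mod 4 < 2 then B k else inv (B k))" for k :: nat
  have LW: "genus_two_letters L = W"
    by (auto simp: fun_eq_iff genus_two_letters_def L_def B_def)
  interpret edge_labelling G 2 L
  proof
    show "L k \<in> carrier G" for k by (simp add: L_def B_def W)
    show paired: "L (k + 2) = inv (L k)" if "k mod 4 < 2" for k
    proof -
      have "\<not> (k + 2) mod 4 < 2" "k + 2 \<ge> 4 \<longleftrightarrow> k \<ge> 4" using that by presburger+
      then show ?thesis using that by (simp add: L_def B_def)
    qed
    have "boundary_product G L 8 = \<one>"
    proof (subst boundary_product_8)
      show "L 2 = inv (L 0)" "L 3 = inv (L 1)" "L 6 = inv (L 4)" "L 7 = inv (L 5)"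
        using paired[of 0] paired[of 1] paired[of 4] paired[of 5]
        by (simp_all add: numeral_2_eq_2 numeral_3_eq_3)
      show "ev G (\<lambda>g. genus_two_letters L (False, g)) comm_word = ev G (\<lambda>g. genus_two_letters L (True, g)) comm_word"
        using t(2) by (simp add: LW amalgamated_def W_def)
    qed (simp add: L_def B_def W)
    then show "boundary_product G L (4 * 2) = \<one>" by simp
  qed simp
  obtain \<Phi> where \<Phi>: "\<Phi> \<in> hom ?P G"
    "\<And>p. p \<in> loops (closed_surface 2) (base_vertex 2) \<Longrightarrow> holonomy G surface_transport p (\<Phi> (loop_class (closed_surface 2) (base_vertex 2) p))"
    using holonomy_hom[OF transport_system_surface base_vertex_topspace] by blast
  have \<Phi>E: "\<Phi> (?E k) = L k" if "k < 8" for k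
    using holonomy_unique[OF transport_system_surface \<Phi>(2)[OF edge_loop_in_loops] holonomy_edge_loop] that
    by (simp add: edge_class_def)
  have \<Phi>F: "\<Phi> (F l) = W l" for l
    unfolding LW[symmetric] F_def by (cases l) (auto simp: genus_two_letters_def intro: \<Phi>E)
  have words: "\<exists>w. A = ev ?P F w" if "A \<in> carrier ?P" for A
  proof -
    have gen: "\<exists>w. ?E k = ev ?P F w" if "k < 8" for k
    proof -
      have single: "ev ?P F [(l, e)] = (if e then F l else inv\<^bsub>?P\<^esub> (F l))" for l e
        using F by (simp add: ev_Cons)
      have "?E 0 = ev ?P F [((False, True), True)]" "?E 1 = ev ?P F [((False, False), True)]"
        "?E 2 = ev ?P F [((False, True), False)]" "?E 3 = ev ?P F [((False, False), False)]"
        "?E 4 = ev ?P F [((True, False), True)]" "?E 5 = ev ?P F [((True, True), True)]"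
        "?E 6 = ev ?P F [((True, False), False)]" "?E 7 = ev ?P F [((True, True), False)]"
        unfolding single by (simp_all add: F_def genus_two_letters_def pair)
      moreover have "k \<in> {0, 1, 2, 3, 4, 5, 6, 7}" using that by auto
      ultimately show ?thesis by blast
    qed
    have "A \<in> generate ?P (?E ` {..<8})"
      using that surface_pi1_generated[of 2] by (simp add: edge_subgroup_def)
    then show ?thesis
    proof (induction A rule: generate.induct)
      case one
      then show ?case by (intro exI[of _ "[]"]) simp
    next
      case (incl A)
      then show ?case using gen by blast
    next
      case (inv A)
      then obtain w where "A = ev ?P F w" using gen by blast
      then show ?case using P.ev_inv_word[of F w, OF F] by metis
    next
      case (eng A B)
      then show ?case using P.ev_append[of F, OF F] by metis
    qed
  qed
  interpret \<Phi>: group_hom ?P G \<Phi>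
    using \<Phi>(1) by (simp add: group_hom_def group_hom_axioms_def P.is_group)
  \<comment> \<open>Every element of the surface group is a word in the \<open>F l\<close>, and by
    the choice of \<open>t\<close> a word that dies in \<open>G\<close> is already trivial
    there.\<close>
  have inj: "inj_on \<Phi> (carrier ?P)"
  proof (rule \<Phi>.inj_on_one_iff[THEN iffD2], intro allI impI)
    fix A assume A: "A \<in> carrier ?P" "\<Phi> A = \<one>"
    then obtain w where w: "A = ev ?P F w" using words by blast
    then have "ev G W w = \<one>" using A(2) hom_ev[where f = F and w = w, OF P.is_group is_group \<Phi>(1) F] by (simp add: \<Phi>F)
    then show "A = \<one>\<^bsub>?P\<^esub>" using t(3) w by (simp add: W_def)
  qed
  define H where "H = \<Phi> ` carrier ?P"
  have H: "subgroup H G" unfolding H_def by (rule \<Phi>.img_is_subgroup)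
  have "\<Phi> \<in> iso ?P (G\<lparr>carrier := H\<rparr>)"
    using inj \<Phi>(1) by (auto simp: iso_def hom_def bij_betw_def H_def)
  then have "?P \<cong> G\<lparr>carrier := H\<rparr>" by (rule is_isoI)
  then have "G\<lparr>carrier := H\<rparr> \<cong> ?P" by (rule P.iso_sym)
  moreover have "closed_oriented_surface_of_genus 2 (closed_surface 2)"
    by (simp add: closed_oriented_surface_of_genus_def homeomorphic_space_refl)
  moreover have "group (G\<lparr>carrier := H\<rparr>)" by (rule subgroup.subgroup_is_group[OF H is_group])
  ultimately have "surface_group (G\<lparr>carrier := H\<rparr>)"
    unfolding surface_group_def using base_vertex_topspace[of 2] by (metis order_refl)
  with H show ?thesis by blast
qed

subsection \<open>From surface groups to free groups\<close>

text \<open>Carries the local system from the standard model to a surface that is merely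
  homeomorphic to it.\<close>

lemma transport_system_pullback:
  assumes h: "transport_system K Y h" and \<phi>: "continuous_map X Y \<phi>"
  shows "transport_system K X (\<lambda>x y. h (\<phi> x) (\<phi> y))"
  unfolding transport_system_def
proof (intro conjI allI ballI)
  show "h (\<phi> x) (\<phi> y) \<in> carrier K" for x y by (rule transport_system_closed[OF h])
  fix x assume x: "x \<in> topspace X"
  then have "\<phi> x \<in> topspace Y" using continuous_map_image_subset_topspace[OF \<phi>] by blast
  then obtain V \<sigma> where V: "openin Y V" "\<phi> x \<in> V" "\<And>y. \<sigma> y \<in> carrier K"
    "\<And>y z. y \<in> V \<Longrightarrow> z \<in> V \<Longrightarrow> h y z = inv\<^bsub>K\<^esub> (\<sigma> y) \<otimes>\<^bsub>K\<^esub> \<sigma> z"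
    using h unfolding transport_system_def by metis
  have "openin X {x \<in> topspace X. \<phi> x \<in> V}" using \<phi> V(1) by (rule openin_continuous_map_preimage)
  then show "\<exists>V \<sigma>. openin X V \<and> x \<in> V \<and> (\<forall>y. \<sigma> y \<in> carrier K) \<and>
      (\<forall>y\<in>V. \<forall>z\<in>V. h (\<phi> y) (\<phi> z) = inv\<^bsub>K\<^esub> (\<sigma> y) \<otimes>\<^bsub>K\<^esub> \<sigma> z)"
    using V x by (intro exI[of _ "{x \<in> topspace X. \<phi> x \<in> V}"] exI[of _ "\<lambda>x. \<sigma> (\<phi> x)"]) simp
qed

lemma holonomy_pullback: "holonomy K (\<lambda>x y. h (\<phi> x) (\<phi> y)) p k \<longleftrightarrow> holonomy K h (\<lambda>t. \<phi> (p t)) k"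
  by (simp add: holonomy_def parallel_on_def)

lemma holonomy_cong: "(\<And>t. t \<in> {0..1} \<Longrightarrow> p t = q t) \<Longrightarrow> holonomy K h p k \<longleftrightarrow> holonomy K h q k"
  by (simp add: holonomy_def parallel_on_def)

text \<open>The base point is arbitrary, so the edge loops are reached by a path to the base vertex,
  and their holonomies appear conjugated by the holonomy \<open>d\<close> of that path, the same for
  both \<open>b\<close>.\<close>

lemma surface_pi1_to_SL2:
  assumes g: "g \<ge> 2" and X: "X homeomorphic_space closed_surface g" and x: "x \<in> topspace X"
  shows "\<exists>\<Psi> \<in> hom (fundamental_group X x) SL2. \<exists>d\<in>carrier SL2. \<forall>b. \<exists>A\<in>carrier (fundamental_group X x).
    \<Psi> A = d \<otimes>\<^bsub>SL2\<^esub> rho b \<otimes>\<^bsub>SL2\<^esub> inv\<^bsub>SL2\<^esub> d"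
proof -
  \<comment> \<open>With all odd edges labelled trivially, every commutator in the boundary relation
    collapses. The edges 2 and 6 repeat the generators of 0 and 4, with which they are glued; genus
    at least 2 provides both handles.\<close>
  define B where "B k = (if k = 0 \<or> k = 2 then rho True else if k = 4 \<or> k = 6 then rho False else \<one>\<^bsub>SL2\<^esub>)" for k :: nat
  define L where "L k = (if k mod 4 < 2 then B k else inv\<^bsub>SL2\<^esub> (B k))" for k
  have Bc: "B k \<in> carrier SL2" for k by (simp add: B_def del: SL2_one)
  have Lc: "L k \<in> carrier SL2" for k using Bc by (simp add: L_def)
  have paired: "L (k + 2) = inv\<^bsub>SL2\<^esub> (L k)" if "k mod 4 < 2" for k
  proof -
    have "\<not> (k + 2) mod 4 < 2" using that by presburger
    moreover have "k \<noteq> 2" "k \<noteq> 6" using that by auto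
    ultimately show ?thesis using that by (simp add: L_def B_def del: SL2_one)
  qed
  have odd1: "L k = \<one>\<^bsub>SL2\<^esub>" if "odd k" for k
    using that by (auto simp: L_def B_def simp del: SL2_one)
  interpret edge_labelling SL2 g L
  proof
    show "g \<ge> 1" using g by simp
    have "boundary_product SL2 L (4 * j) = \<one>\<^bsub>SL2\<^esub>" for j
    proof (induction j)
      case (Suc j)
      have eq: "4 * Suc j = Suc (Suc (Suc (Suc (4 * j))))" by simp
      have "L (Suc (4 * j)) = \<one>\<^bsub>SL2\<^esub>" "L (Suc (Suc (Suc (4 * j)))) = \<one>\<^bsub>SL2\<^esub>" by (intro odd1; simp)+
      moreover have "L (Suc (Suc (4 * j))) = inv\<^bsub>SL2\<^esub> (L (4 * j))" using paired[of "4 * j"] by simp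
      ultimately show ?case unfolding eq using Suc Lc[of "4 * j"] by (simp del: SL2_one)
    qed simp
    then show "boundary_product SL2 L (4 * g) = \<one>\<^bsub>SL2\<^esub>" .
    show "L k \<in> carrier SL2" for k by (rule Lc)
    show "L (k + 2) = inv\<^bsub>SL2\<^esub> (L k)" if "k mod 4 < 2" for k using that by (rule paired)
  qed
  obtain \<phi> \<psi> where \<phi>: "continuous_map X (closed_surface g) \<phi>" "continuous_map (closed_surface g) X \<psi>"
    "\<And>x. x \<in> topspace X \<Longrightarrow> \<psi> (\<phi> x) = x" "\<And>y. y \<in> topspace (closed_surface g) \<Longrightarrow> \<phi> (\<psi> y) = y"
    using X unfolding homeomorphic_space_def homeomorphic_maps_def by blast
  have hX: "transport_system SL2 X (\<lambda>x y. surface_transport (\<phi> x) (\<phi> y))"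
    using transport_system_surface \<phi>(1) by (rule transport_system_pullback)
  obtain \<Psi> where \<Psi>: "\<Psi> \<in> hom (fundamental_group X x) SL2"
    "\<And>p. p \<in> loops X x \<Longrightarrow> holonomy SL2 (\<lambda>x y. surface_transport (\<phi> x) (\<phi> y)) p (\<Psi> (loop_class X x p))"
    using SL2.holonomy_hom[OF hX x] by blast
  have "\<phi> x \<in> topspace (closed_surface g)" using continuous_map_image_subset_topspace[OF \<phi>(1)] x by blast
  then obtain z where z: "z \<in> cball 0 1" "\<phi> x = disc_class g z" by (auto simp: topspace_closed_surface)
  define \<delta> where "\<delta> = (\<lambda>t::real. disc_class g ((1 - t) *\<^sub>R z + t *\<^sub>R 1))"
  have "path_homotopic (closed_surface g) (\<phi> x) (base_vertex g) \<delta> \<delta>"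
    unfolding \<delta>_def using z
    by (intro path_homotopic_convex[OF continuous_disc_class] continuous_intros convexD_alt) (auto simp: base_vertex_def)
  then have \<delta>: "pathin (closed_surface g) \<delta>" "\<delta> 0 = \<phi> x" "\<delta> 1 = base_vertex g"
    by (auto simp: path_homotopic_refl)
  have \<delta>r: "pathin (closed_surface g) (\<lambda>t. \<delta> (1 - t))"
    using path_homotopic_imp(1)[OF path_homotopic_reverse[of "closed_surface g" "\<phi> x" "base_vertex g" \<delta> \<delta>]] \<delta>
    by (simp add: path_homotopic_refl)
  obtain d where d: "holonomy SL2 surface_transport \<delta> d"
    using SL2.holonomy_exists[OF transport_system_surface \<delta>(1)] by blast
  have dc: "d \<in> carrier SL2" using d by (rule holonomy_closed)
  have "\<exists>A\<in>carrier (fundamental_group X x). \<Psi> A = d \<otimes>\<^bsub>SL2\<^esub> rho b \<otimes>\<^bsub>SL2\<^esub> inv\<^bsub>SL2\<^esub> d" for b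
  proof -
    define k where "k = (if b then 0 else 4 :: nat)"
    have k: "k < 4 * g" "L k = rho b" using g by (auto simp: k_def L_def B_def)
    have e: "pathin (closed_surface g) (edge_loop g k)" "edge_loop g k 0 = base_vertex g" "edge_loop g k 1 = base_vertex g"
      using edge_loop_in_loops[OF k(1)] by (auto simp: loops_def)
    define c where "c = loop_concat (loop_concat \<delta> (edge_loop g k)) (\<lambda>t. \<delta> (1 - t))"
    have c1: "pathin (closed_surface g) (loop_concat \<delta> (edge_loop g k))" using \<delta> e by (intro pathin_concat) auto
    have c: "pathin (closed_surface g) c" unfolding c_def using \<delta> e c1 \<delta>r by (intro pathin_concat) auto
    have ends: "c 0 = \<phi> x" "c 1 = \<phi> x" using \<delta> by (simp_all add: c_def)
    have hd: "holonomy SL2 surface_transport (loop_concat \<delta> (edge_loop g k)) (d \<otimes>\<^bsub>SL2\<^esub> L k)"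
      using \<delta> e by (intro SL2.holonomy_concat[OF transport_system_surface c1 _ d holonomy_edge_loop[OF k(1)]]) simp
    have hc: "holonomy SL2 surface_transport c (d \<otimes>\<^bsub>SL2\<^esub> L k \<otimes>\<^bsub>SL2\<^esub> inv\<^bsub>SL2\<^esub> d)"
      unfolding c_def using \<delta> e
      by (intro SL2.holonomy_concat[OF transport_system_surface c[unfolded c_def] _ hd
            SL2.holonomy_reverse[OF transport_system_surface d]]) simp
    define p where "p = (\<lambda>t. \<psi> (c t))"
    have "pathin X p"
      using continuous_map_compose[OF c[unfolded pathin_def] \<phi>(2)] by (simp add: p_def pathin_def o_def)
    then have p: "p \<in> loops X x" using ends \<phi>(3)[OF x] by (simp add: loops_def p_def)
    have pc: "\<phi> (p t) = c t" if "t \<in> {0..1}" for t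
    proof -
      have "c t \<in> topspace (closed_surface g)"
        using continuous_map_image_subset_topspace[OF c[unfolded pathin_def]] that by auto
      then show ?thesis by (simp add: p_def \<phi>(4))
    qed
    have "holonomy SL2 surface_transport (\<lambda>t. \<phi> (p t)) (d \<otimes>\<^bsub>SL2\<^esub> L k \<otimes>\<^bsub>SL2\<^esub> inv\<^bsub>SL2\<^esub> d)"
      using hc by (rule holonomy_cong[OF pc, THEN iffD2, rotated])
    then have "holonomy SL2 (\<lambda>x y. surface_transport (\<phi> x) (\<phi> y)) p (d \<otimes>\<^bsub>SL2\<^esub> L k \<otimes>\<^bsub>SL2\<^esub> inv\<^bsub>SL2\<^esub> d)"
      unfolding holonomy_pullback .
    then have "\<Psi> (loop_class X x p) = d \<otimes>\<^bsub>SL2\<^esub> L k \<otimes>\<^bsub>SL2\<^esub> inv\<^bsub>SL2\<^esub> d"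
      using SL2.holonomy_unique[OF hX \<Psi>(2)[OF p]] by blast
    then show ?thesis using loop_class_closed[OF p] k(2) by auto
  qed
  with \<Psi>(1) dc show ?thesis by blast
qed

text \<open>Freeness lifts along a homomorphism: a relation between preimages of the generators
  would hold for the matrices too, up to the common conjugation by \<open>d\<close>.\<close>

lemma (in group) free_subgroup_of_surface_subgroup:
  assumes H: "subgroup H G" "surface_group (G\<lparr>carrier := H\<rparr>)"
  shows "\<exists>H. subgroup H G \<and> nonabelian_free_group (G\<lparr>carrier := H\<rparr>)"
proof -
  let ?H = "G\<lparr>carrier := H\<rparr>"
  obtain g and X :: "complex set topology" and x where g: "g \<ge> 2" "X homeomorphic_space closed_surface g" and x: "x \<in> topspace X"
    and iso: "?H \<cong> fundamental_group X x"
    using H(2) unfolding surface_group_def closed_oriented_surface_of_genus_def by blast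
  let ?P = "fundamental_group X x"
  have grp: "group ?H" by (rule subgroup.subgroup_is_group[OF H(1) is_group])
  obtain \<theta> where \<theta>: "\<theta> \<in> hom ?H ?P" "bij_betw \<theta> H (carrier ?P)"
    using iso unfolding is_iso_def iso_def by auto
  obtain \<Psi> d where \<Psi>: "\<Psi> \<in> hom ?P SL2" "d \<in> carrier SL2"
    "\<And>b. \<exists>A\<in>carrier ?P. \<Psi> A = d \<otimes>\<^bsub>SL2\<^esub> rho b \<otimes>\<^bsub>SL2\<^esub> inv\<^bsub>SL2\<^esub> d"
    using surface_pi1_to_SL2[OF g x] by blast
  have "\<exists>a\<in>H. \<Psi> (\<theta> a) = d \<otimes>\<^bsub>SL2\<^esub> rho b \<otimes>\<^bsub>SL2\<^esub> inv\<^bsub>SL2\<^esub> d" for b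
    using \<Psi>(3)[of b] \<theta>(2) unfolding bij_betw_def by (metis image_iff)
  then obtain f where f: "\<And>b. f b \<in> H" "\<And>b. \<Psi> (\<theta> (f b)) = d \<otimes>\<^bsub>SL2\<^esub> rho b \<otimes>\<^bsub>SL2\<^esub> inv\<^bsub>SL2\<^esub> d"
    by metis
  have fG: "f b \<in> carrier G" for b using f(1) subgroup.subset[OF H(1)] by blast
  have hom: "(\<lambda>a. \<Psi> (\<theta> a)) \<in> hom ?H SL2"
    by (rule homI) (use \<theta>(1) \<Psi>(1) in \<open>auto simp: hom_def Pi_iff\<close>)
  have faithful: "ev SL2 rho w = \<one>\<^bsub>SL2\<^esub>" if w: "ev G f w = \<one>" for w
  proof -
    have "ev ?H f w = \<one>" using ev_subgroup[OF is_group H(1), of f w] f(1) w by simp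
    then have "\<one>\<^bsub>SL2\<^esub> = \<Psi> (\<theta> (ev ?H f w))"
      using hom_one[OF hom grp group_SL2] by simp
    also have "\<dots> = ev SL2 (\<lambda>b. d \<otimes>\<^bsub>SL2\<^esub> rho b \<otimes>\<^bsub>SL2\<^esub> inv\<^bsub>SL2\<^esub> d) w"
      using hom_ev[OF grp group_SL2 hom, of f w] f by simp
    also have "\<dots> = d \<otimes>\<^bsub>SL2\<^esub> ev SL2 rho w \<otimes>\<^bsub>SL2\<^esub> inv\<^bsub>SL2\<^esub> d"
      using hom_ev[OF group_SL2 group_SL2 SL2.hom_conj[OF \<Psi>(2)], of rho w] by simp
    finally have "d \<otimes>\<^bsub>SL2\<^esub> ev SL2 rho w \<otimes>\<^bsub>SL2\<^esub> inv\<^bsub>SL2\<^esub> d = \<one>\<^bsub>SL2\<^esub>" by (rule sym)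
    then have "d \<otimes>\<^bsub>SL2\<^esub> ev SL2 rho w = d"
      using SL2.inv_equality[of "d \<otimes>\<^bsub>SL2\<^esub> ev SL2 rho w" "inv\<^bsub>SL2\<^esub> d"] \<Psi>(2) by (simp del: SL2_one)
    then show ?thesis
      using SL2.l_cancel_one[OF \<Psi>(2), of "ev SL2 rho w"] by (simp del: SL2_one)
  qed
  show ?thesis by (rule free_subgroup_of_faithful[where f = f, OF fG faithful])
qed

theorem mainTheorem2:
  fixes G :: "('a, 'b) monoid_scheme" and T :: "'a topology"
  assumes "compact_group G T"
  shows "(\<exists>H. subgroup H G \<and> surface_group (G\<lparr>carrier := H\<rparr>)) \<longleftrightarrow>
         (\<exists>H. subgroup H G \<and> nonabelian_free_group (G\<lparr>carrier := H\<rparr>))"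
proof -
  interpret compact_group G T by (rule assms)
  show ?thesis
    using free_subgroup_of_surface_subgroup faithful_of_free_subgroup surface_subgroup_of_faithful by meson
qed

end
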